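(* Let $m>0$ and let $j\ge 0$ be a half-integer. For every admissible pair $(A,B)$ (i.e. $|A-B|\le j\le A+B$, $A+B-j\in\mathbb{Z}$) let $\psi^{AB}$ be the field of type $(A,B)$ built from a massive particle of mass $m$ and spin $j$ (and its antiparticle) with constants $\kappa^{AB},\lambda^{AB}$: $$\psi^{AB}_{ab}(x)=(2\pi)^{-3/2}\sum_\sigma\int d^3p\,\big[e^{ip\cdot x}\kappa^{AB}u^{AB}_{ab}(\mathbf p,\sigma)a(\mathbf p,\sigma)+e^{-ip\cdot x}\lambda^{AB}v^{AB}_{ab}(\mathbf p,\sigma)a^{c\dagger}(\mathbf p,\sigma)\big].$$ Let the particle be a boson (upper sign, commutators) or a fermion (lower sign, anticommutators). Then the microscopic causality condition $$[\psi^{AB}_{ab}(x),\psi^{CD\dagger}_{cd}(y)]_{\mp}=0\quad\text{whenever }(x-y)^2>0,$$ for all admissible pairs $(A,B)$, $(C,D)$ and all component indices $ab$, $cd$, holds if and only if both of the following hold: (1) the particle is a boson if $2j$ is even and a fermion if $2j$ is odd; (2) $\lambda^{AB}=(-1)^{2B}\kappa^{AB}c$ for all admissible $(A,B)$, where $c$ is a constant independent of $A,B$.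
   Context: Kinematics. Spacetime metric of signature $(+,+,+,-)$, with the minus sign for the time component $x^0$: $p\cdot x=\mathbf p\cdot\mathbf x-p^0x^0$; $x-y$ is space-like iff $(x-y)^2>0$. The mass shell is $p^0=\sqrt{\mathbf p^2+m^2}$, with rest momentum $k=(\mathbf p=\mathbf 0,\,p^0=m)$. The covering $\lambda:SL(2,\mathbb{C})\to SO^+(1,3)$ is given by $X(\lambda(\Lambda)p)=\Lambda X(p)\Lambda^\dagger$, where $X(p)=p^0I-\mathbf p\cdot\boldsymbol\sigma$ ($\boldsymbol\sigma$ the Pauli matrices). $L(p)$ is the standard boost: the positive definite Hermitian element of $SL(2,\mathbb{C})$ with $\lambda(L(p))k=p$. Representations. $D^{(s)}$ is the spin-$s$ irreducible representation of $SU(2)$ of dimension $2s+1$, unitary in its standard basis, extended holomorphically to $SL(2,\mathbb{C})$. $D^{AB}(\Lambda)=D^{(A)}(\Lambda)\otimes D^{(B)}((\Lambda^\dagger)^{-1})$ is the $(A,B)$ irreducible representation of $SL(2,\mathbb{C})$, of dimension $(2A+1)(2B+1)$, with component index $ab$; its restriction to $SU(2)$ is unitary. Coefficient functions. For each admissible $(A,B)$, $u^{AB}(\mathbf p)=(u^{AB}_{ab}(\mathbf p,\sigma))_{ab,\sigma}$ and $v^{AB}(\mathbf p)$ are $(2A+1)(2B+1)\times(2j+1)$ matrices with $u^{AB}(\mathbf p)=(m/p^0)^{1/2}D^{AB}(L(p))u^{AB}(\mathbf 0)$ and $v^{AB}(\mathbf p)=(m/p^0)^{1/2}D^{AB}(L(p))v^{AB}(\mathbf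 0)$, where for all $W\in SU(2)$: $u^{AB}(\mathbf 0)D^{(j)}(W)=D^{AB}(W)u^{AB}(\mathbf 0)$ and $v^{AB}(\mathbf 0)\overline{D^{(j)}(W)}=D^{AB}(W)v^{AB}(\mathbf 0)$. They are normalized by $u^{AB}(\mathbf 0)^\dagger u^{AB}(\mathbf 0)=I=v^{AB}(\mathbf 0)^\dagger v^{AB}(\mathbf 0)$, and phases are chosen so that $u^{AB}(\mathbf 0)u^{CD}(\mathbf 0)^\dagger=v^{AB}(\mathbf 0)v^{CD}(\mathbf 0)^\dagger$ for all admissible $(A,B),(C,D)$. Operators. $[X,Y]_\mp=XY\mp YX$. $a(\mathbf p,\sigma)$ and $a^c(\mathbf p,\sigma)$ are the annihilation operators of the particle and antiparticle on Fock space, with $[a(\mathbf p,\sigma),a^\dagger(\mathbf p',\sigma')]_\mp=\delta_{\sigma\sigma'}\delta^3(\mathbf p-\mathbf p')=[a^c(\mathbf p,\sigma),a^{c\dagger}(\mathbf p',\sigma')]_\mp$, all other (anti)commutators between particle and antiparticle operators, or between two annihilation (two creation) operators, being zero. The (anti)commutator of fields is understood as a distribution in $x,y$.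
   Formalization: The constant c is required to satisfy |c| = 1 (for other c, (1) and (2) do not give causality), and at least one of the constants κ^{AB}, λ^{AB} is assumed non-zero (if all fields vanish, causality holds for either statistics). *)

theory Defs
  imports "HOL-Analysis.Analysis" "HOL-Computational_Algebra.Polynomial"
begin

text \<open>
  Convention: every (half-integer) spin label is represented by its double, a natural number.
  Thus \<open>j\<close>, \<open>A\<close>, \<open>B\<close> below stand for the spins $j/2$, $A/2$, $B/2$, and the components of an object of
  spin $s = n/2$ are numbered $0, \dots, n$, where $k$ labels the basis vector with third
  spin component $s - k$.
\<close>

text \<open>A point is a pair (spatial part, time component).\<close>

type_synonym four_vector = "(real ^ 3) \<times> real"

definition mink :: "four_vector \<Rightarrow> four_vector \<Rightarrow> real" where
  "mink p x = fst p \<bullet> fst x - snd p * snd x"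

definition spacelike :: "four_vector \<Rightarrow> bool" where
  "spacelike x \<longleftrightarrow> mink x x > 0"

definition energy :: "real \<Rightarrow> real ^ 3 \<Rightarrow> real" where
  "energy m p = sqrt ((norm p)\<^sup>2 + m\<^sup>2)"

definition on_shell :: "real \<Rightarrow> real ^ 3 \<Rightarrow> four_vector" where
  "on_shell m p = (p, energy m p)"

definition dagger :: "complex ^ 2 ^ 2 \<Rightarrow> complex ^ 2 ^ 2" where
  "dagger M = (\<chi> i j. cnj (M $ j $ i))"

definition SL2C :: "(complex ^ 2 ^ 2) set" where
  "SL2C = {M. det M = 1}"

definition SU2 :: "(complex ^ 2 ^ 2) set" where
  "SU2 = {W \<in> SL2C. dagger W ** W = mat 1}"

definition pauli :: "3 \<Rightarrow> complex ^ 2 ^ 2" where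
  "pauli i =
     (if i = 1 then vector [vector [0, 1], vector [1, 0]]
      else if i = 2 then vector [vector [0, - \<i>], vector [\<i>, 0]]
      else vector [vector [1, 0], vector [0, - 1]])"

definition herm_of :: "four_vector \<Rightarrow> complex ^ 2 ^ 2" where
  "herm_of p = snd p *\<^sub>R mat 1 - (\<Sum>i\<in>UNIV. fst p $ i *\<^sub>R pauli i)"

definition lorentz :: "complex ^ 2 ^ 2 \<Rightarrow> four_vector \<Rightarrow> four_vector" where
  "lorentz \<Lambda> p = (THE q. herm_of q = \<Lambda> ** herm_of p ** dagger \<Lambda>)"

definition pos_def_herm :: "complex ^ 2 ^ 2 \<Rightarrow> bool" where
  "pos_def_herm M \<longleftrightarrow> dagger M = M \<and>
     (\<forall>z. z \<noteq> 0 \<longrightarrow> Re (\<Sum>i\<in>UNIV. cnj (z $ i) * (M *v z) $ i) > 0)"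

definition boost :: "real \<Rightarrow> real ^ 3 \<Rightarrow> complex ^ 2 ^ 2" where
  "boost m p = (THE L. L \<in> SL2C \<and> pos_def_herm L \<and> lorentz L (on_shell m 0) = on_shell m p)"

text \<open>
  The spin $n/2$ representation, realised on the $n$-th symmetric power of $\mathbb{C}^2$ in the
  orthonormal basis $\sqrt{\binom{n}{k}}\, e_1^{n-k} e_2^k$, $0 \le k \le n$. The image of
  $e_1^{n-k} e_2^k$ under $\Lambda$ is $(\Lambda_{11} e_1 + \Lambda_{21} e_2)^{n-k}
  (\Lambda_{12} e_1 + \Lambda_{22} e_2)^k$, which is written below with $e_1 = 1$ and $e_2$ the
  polynomial variable. The entries are polynomials in $\Lambda$, so this is at once the
  representation of $SU(2)$ and its holomorphic extension.
\<close>

definition spin_rep :: "nat \<Rightarrow> complex ^ 2 ^ 2 \<Rightarrow> nat \<Rightarrow> nat \<Rightarrow> complex" where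
  "spin_rep n \<Lambda> i k =
     of_real (sqrt (real (n choose k) / real (n choose i))) *
     coeff ([:\<Lambda> $ 1 $ 1, \<Lambda> $ 2 $ 1:] ^ (n - k) * [:\<Lambda> $ 1 $ 2, \<Lambda> $ 2 $ 2:] ^ k) i"

definition components :: "nat \<Rightarrow> nat \<Rightarrow> (nat \<times> nat) set" where
  "components A B = {..A} \<times> {..B}"

definition rep_AB ::
  "nat \<Rightarrow> nat \<Rightarrow> complex ^ 2 ^ 2 \<Rightarrow> nat \<times> nat \<Rightarrow> nat \<times> nat \<Rightarrow> complex" where
  "rep_AB A B \<Lambda> r s =
     spin_rep A \<Lambda> (fst r) (fst s) * spin_rep B (matrix_inv (dagger \<Lambda>)) (snd r) (snd s)"

definition admissible :: "nat \<Rightarrow> nat \<Rightarrow> nat \<Rightarrow> bool" where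
  "admissible j A B \<longleftrightarrow>
     \<bar>real A / 2 - real B / 2\<bar> \<le> real j / 2 \<and> real j / 2 \<le> real A / 2 + real B / 2 \<and>
     real A / 2 + real B / 2 - real j / 2 \<in> \<int>"

text \<open>\<open>u A B r \<sigma>\<close> is the entry in row \<open>r = (a, b)\<close> and column \<open>\<sigma>\<close> of the matrix of type $(A,B)$.\<close>

type_synonym coefficients = "nat \<Rightarrow> nat \<Rightarrow> nat \<times> nat \<Rightarrow> nat \<Rightarrow> complex"

definition rest_coefficients :: "nat \<Rightarrow> coefficients \<Rightarrow> coefficients \<Rightarrow> bool" where
  "rest_coefficients j u v \<longleftrightarrow>
     (\<forall>A B. admissible j A B \<longrightarrow>
        (\<forall>W\<in>SU2. \<forall>r\<in>components A B. \<forall>\<sigma>\<le>j.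
           (\<Sum>\<tau>\<le>j. u A B r \<tau> * spin_rep j W \<tau> \<sigma>) =
             (\<Sum>s\<in>components A B. rep_AB A B W r s * u A B s \<sigma>) \<and>
           (\<Sum>\<tau>\<le>j. v A B r \<tau> * cnj (spin_rep j W \<tau> \<sigma>)) =
             (\<Sum>s\<in>components A B. rep_AB A B W r s * v A B s \<sigma>)) \<and>
        (\<forall>\<sigma>\<le>j. \<forall>\<tau>\<le>j.
           (\<Sum>r\<in>components A B. cnj (u A B r \<sigma>) * u A B r \<tau>) = (if \<sigma> = \<tau> then 1 else 0) \<and>
           (\<Sum>r\<in>components A B. cnj (v A B r \<sigma>) * v A B r \<tau>) = (if \<sigma> = \<tau> then 1 else 0))) \<and>
     (\<forall>A B C D. admissible j A B \<longrightarrow> admissible j C D \<longrightarrow>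
        (\<forall>r\<in>components A B. \<forall>s\<in>components C D.
           (\<Sum>\<sigma>\<le>j. u A B r \<sigma> * cnj (u C D s \<sigma>)) = (\<Sum>\<sigma>\<le>j. v A B r \<sigma> * cnj (v C D s \<sigma>))))"

text \<open>The coefficient at momentum \<open>p\<close>, obtained by boosting the rest-frame coefficients \<open>w\<close>.\<close>

definition boosted ::
  "real \<Rightarrow> coefficients \<Rightarrow> nat \<Rightarrow> nat \<Rightarrow> real ^ 3 \<Rightarrow> nat \<times> nat \<Rightarrow> nat \<Rightarrow> complex" where
  "boosted m w A B p r \<sigma> =
     of_real (sqrt (m / energy m p)) *
     (\<Sum>s\<in>components A B. rep_AB A B (boost m p) r s * w A B s \<sigma>)"

datatype statistics = Boson | Fermion

primrec exchange_sign :: "statistics \<Rightarrow> complex" where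
  "exchange_sign Boson = 1"
| "exchange_sign Fermion = - 1"

datatype species = Particle | Antiparticle

type_synonym one_particle = "species \<times> nat \<times> (real ^ 3)"

text \<open>
  A vector of Fock space is a sequence of $n$-particle wave functions; the value at a list of
  length $n$ is the $n$-particle wave function, with respect to the measure $d^3p$ in each momentum.
\<close>

type_synonym fock_state = "one_particle list \<Rightarrow> complex"

text \<open>
  The common dense domain of the smeared operators: (anti)symmetric vectors with finitely many
  particles whose wave functions are continuous and rapidly decreasing in the momenta. By
  continuity, two such vectors are equal in the Hilbert space iff they are equal as functions.
\<close>

definition fock_domain :: "statistics \<Rightarrow> nat \<Rightarrow> fock_state set" where
  "fock_domain st j = {\<Psi>.
     (\<exists>N. \<forall>qs. length qs > N \<longrightarrow> \<Psi> qs = 0) \<and>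
     (\<forall>qs. (\<exists>(t, \<sigma>, p)\<in>set qs. \<sigma> > j) \<longrightarrow> \<Psi> qs = 0) \<and>
     (\<forall>xs q q' ys. \<Psi> (xs @ q # q' # ys) = exchange_sign st * \<Psi> (xs @ q' # q # ys)) \<and>
     (\<forall>ls :: (species \<times> nat) list. continuous_on UNIV
        (\<lambda>k :: nat \<Rightarrow> real ^ 3.
           \<Psi> (map (\<lambda>i. (fst (ls ! i), snd (ls ! i), k i)) [0..<length ls]))) \<and>
     (\<forall>n N :: nat. \<exists>C :: real. \<forall>qs. length qs = n \<longrightarrow>
        (\<Prod>(t, \<sigma>, p)\<leftarrow>qs. (1 + norm p) ^ N) * cmod (\<Psi> qs) \<le> C)}"

text \<open>$\int d^3p\, h(\mathbf{p})\, a(\mathbf{p},\sigma)$ for the given species\<close>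

definition annihilate ::
  "species \<Rightarrow> nat \<Rightarrow> (real ^ 3 \<Rightarrow> complex) \<Rightarrow> fock_state \<Rightarrow> fock_state" where
  "annihilate t \<sigma> h \<Psi> qs =
     of_real (sqrt (real (length qs + 1))) * (LINT p|lborel. h p * \<Psi> ((t, \<sigma>, p) # qs))"

text \<open>$\int d^3p\, h(\mathbf{p})\, a^\dagger(\mathbf{p},\sigma)$ for the given species\<close>

definition create ::
  "statistics \<Rightarrow> species \<Rightarrow> nat \<Rightarrow> (real ^ 3 \<Rightarrow> complex) \<Rightarrow> fock_state \<Rightarrow> fock_state" where
  "create st t \<sigma> h \<Psi> qs =
     (\<Sum>i<length qs. exchange_sign st ^ i *
        (case qs ! i of (t', \<sigma>', p) \<Rightarrow> if t' = t \<and> \<sigma>' = \<sigma> then h p else 0) *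
        \<Psi> (take i qs @ drop (Suc i) qs))
     / of_real (sqrt (real (length qs)))"

text \<open>$[X,Y]_\mp = XY \mp YX$, the upper sign for bosons and the lower one for fermions\<close>

definition bracket ::
  "statistics \<Rightarrow> (fock_state \<Rightarrow> fock_state) \<Rightarrow> (fock_state \<Rightarrow> fock_state) \<Rightarrow>
     fock_state \<Rightarrow> fock_state" where
  "bracket st X Y \<Psi> = (\<lambda>qs. X (Y \<Psi>) qs - exchange_sign st * Y (X \<Psi>) qs)"

text \<open>
  The smeared form of $[a(\mathbf{p},\sigma), a^\dagger(\mathbf{p}',\sigma')]_\mp =
  \delta_{\sigma\sigma'} \delta^3(\mathbf{p}-\mathbf{p}')$, and of its analogues involving
  antiparticles.
\<close>

lemma bracket_annihilate_create:
  assumes "integrable lborel (\<lambda>p. h p * k p)"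
    and "\<And>qs. integrable lborel (\<lambda>p. h p * \<Psi> ((t, \<sigma>, p) # qs))"
  shows "bracket st (annihilate t \<sigma> h) (create st t' \<sigma>' k) \<Psi> qs =
    (if t = t' \<and> \<sigma> = \<sigma>' then (LINT p|lborel. h p * k p) * \<Psi> qs else 0)"
proof -
  define e where "e = exchange_sign st"
  define K where
    "K i = (case qs ! i of (s, \<tau>, p) \<Rightarrow> if s = t' \<and> \<tau> = \<sigma>' then k p else 0)" for i
  define R where "R i = take i qs @ drop (Suc i) qs" for i
  define c where "c = (if t = t' \<and> \<sigma> = \<sigma>' then 1 else 0 :: complex)"
  define n where "n = length qs"
  let ?r = "complex_of_real (sqrt (real (Suc n)))"
  let ?S = "\<Sum>i<n. e ^ i * K i * (LINT p|lborel. h p * \<Psi> ((t, \<sigma>, p) # R i))"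
  have len: "length (R i) + 1 = n" if "i < n" for i
    using that by (simp add: R_def n_def)
  have 1: "create st t' \<sigma>' k \<Psi> ((t, \<sigma>, p) # qs) =
      (c * k p * \<Psi> qs + e * (\<Sum>i<n. e ^ i * K i * \<Psi> ((t, \<sigma>, p) # R i))) / ?r" for p
    unfolding create_def length_Cons sum.lessThan_Suc_shift
    by (simp add: K_def R_def e_def c_def n_def sum_distrib_left mult.assoc)
  have 2: "(LINT p|lborel. h p * create st t' \<sigma>' k \<Psi> ((t, \<sigma>, p) # qs)) =
      (c * (LINT p|lborel. h p * k p) * \<Psi> qs + e * ?S) / ?r"
  proof -
    have "(LINT p|lborel. h p * create st t' \<sigma>' k \<Psi> ((t, \<sigma>, p) # qs)) =
      (LINT p|lborel. ((h p * k p) * (c * \<Psi> qs) +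
         e * (\<Sum>i<n. (e ^ i * K i) * (h p * \<Psi> ((t, \<sigma>, p) # R i)))) / ?r)"
      unfolding 1
      by (intro Bochner_Integration.integral_cong refl)
         (simp add: algebra_simps sum_distrib_left add_divide_distrib)
    also have "\<dots> = (c * (LINT p|lborel. h p * k p) * \<Psi> qs + e * ?S) / ?r"
    proof -
      have i: "integrable lborel (\<lambda>p. (e ^ i * K i) * (h p * \<Psi> ((t, \<sigma>, p) # R i)))" for i
        using assms(2) by simp
      have "(LINT p|lborel. (\<Sum>i<n. (e ^ i * K i) * (h p * \<Psi> ((t, \<sigma>, p) # R i)))) = ?S"
        by (subst Bochner_Integration.integral_sum) (use i in simp_all)
      moreover have "integrable lborel
          (\<lambda>p. \<Sum>i<n. (e ^ i * K i) * (h p * \<Psi> ((t, \<sigma>, p) # R i)))"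
        using i by (intro Bochner_Integration.integrable_sum)
      ultimately show ?thesis
        using assms(1) by (simp add: mult_ac(2))
    qed
    finally show ?thesis .
  qed
  have 3: "annihilate t \<sigma> h (create st t' \<sigma>' k \<Psi>) qs =
      c * (LINT p|lborel. h p * k p) * \<Psi> qs + e * ?S"
    unfolding annihilate_def 2 by (simp add: n_def del: of_nat_Suc)
  have 4: "create st t' \<sigma>' k (annihilate t \<sigma> h \<Psi>) qs = ?S"
  proof (cases "n = 0")
    case False
    have "create st t' \<sigma>' k (annihilate t \<sigma> h \<Psi>) qs =
        (\<Sum>i<n. e ^ i * K i * (of_real (sqrt (real n)) *
           (LINT p|lborel. h p * \<Psi> ((t, \<sigma>, p) # R i)))) / of_real (sqrt (real n))"
      unfolding create_def annihilate_def
      using len by (simp add: e_def K_def R_def n_def)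
    also have "\<dots> = ?S"
      using False by (simp add: sum_divide_distrib mult.assoc)
    finally show ?thesis .
  qed (simp add: create_def n_def)
  show ?thesis
    unfolding bracket_def 3 4 by (simp add: c_def e_def)
qed

primrec cont_diff :: "nat \<Rightarrow> ('a::euclidean_space \<Rightarrow> 'b::real_normed_vector) \<Rightarrow> bool" where
  "cont_diff 0 f \<longleftrightarrow> continuous_on UNIV f"
| "cont_diff (Suc k) f \<longleftrightarrow> f differentiable_on UNIV \<and>
     (\<forall>e\<in>Basis. cont_diff k (\<lambda>x. frechet_derivative f (at x) e))"

definition supp :: "(four_vector \<Rightarrow> complex) \<Rightarrow> four_vector set" where
  "supp f = closure {x. f x \<noteq> 0}"

definition test_function :: "(four_vector \<Rightarrow> complex) \<Rightarrow> bool" where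
  "test_function f \<longleftrightarrow> (\<forall>k. cont_diff k f) \<and> compact (supp f)"

text \<open>$\int d^4x\, f(x)\, e^{\pm i p \cdot x}$ at the mass shell point over \<open>p\<close>, for \<open>s = \<plusminus>1\<close>\<close>

definition plane_wave_transform ::
  "real \<Rightarrow> real \<Rightarrow> (four_vector \<Rightarrow> complex) \<Rightarrow> real ^ 3 \<Rightarrow> complex" where
  "plane_wave_transform m s f p =
     (LINT x|lborel. f x * exp (\<i> * of_real (s * mink (on_shell m p) x)))"

text \<open>$\psi^{AB}_{ab}(f) = \int d^4x\, f(x)\, \psi^{AB}_{ab}(x)$, with \<open>r = (a, b)\<close>; \<open>u\<close> and \<open>v\<close>
  are the coefficients at rest.\<close>

definition psi ::
  "statistics \<Rightarrow> real \<Rightarrow> nat \<Rightarrow> coefficients \<Rightarrow> coefficients \<Rightarrow>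
   (nat \<Rightarrow> nat \<Rightarrow> complex) \<Rightarrow> (nat \<Rightarrow> nat \<Rightarrow> complex) \<Rightarrow>
   nat \<Rightarrow> nat \<Rightarrow> nat \<times> nat \<Rightarrow> (four_vector \<Rightarrow> complex) \<Rightarrow> fock_state \<Rightarrow> fock_state" where
  "psi st m j u v \<kappa> lam A B r f \<Psi> = (\<lambda>qs. of_real ((2 * pi) powr (- 3 / 2)) * (\<Sum>\<sigma>\<le>j.
     annihilate Particle \<sigma>
       (\<lambda>p. plane_wave_transform m 1 f p * \<kappa> A B * boosted m u A B p r \<sigma>) \<Psi> qs +
     create st Antiparticle \<sigma>
       (\<lambda>p. plane_wave_transform m (- 1) f p * lam A B * boosted m v A B p r \<sigma>) \<Psi> qs))"

text \<open>$\int d^4x\, f(x)\, \psi^{AB}_{ab}(x)^\dagger$; the test function is not conjugated.\<close>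

definition psi_dagger ::
  "statistics \<Rightarrow> real \<Rightarrow> nat \<Rightarrow> coefficients \<Rightarrow> coefficients \<Rightarrow>
   (nat \<Rightarrow> nat \<Rightarrow> complex) \<Rightarrow> (nat \<Rightarrow> nat \<Rightarrow> complex) \<Rightarrow>
   nat \<Rightarrow> nat \<Rightarrow> nat \<times> nat \<Rightarrow> (four_vector \<Rightarrow> complex) \<Rightarrow> fock_state \<Rightarrow> fock_state" where
  "psi_dagger st m j u v \<kappa> lam A B r f \<Psi> = (\<lambda>qs. of_real ((2 * pi) powr (- 3 / 2)) * (\<Sum>\<sigma>\<le>j.
     create st Particle \<sigma>
       (\<lambda>p. plane_wave_transform m (- 1) f p * cnj (\<kappa> A B) * cnj (boosted m u A B p r \<sigma>)) \<Psi> qs +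
     annihilate Antiparticle \<sigma>
       (\<lambda>p. plane_wave_transform m 1 f p * cnj (lam A B) * cnj (boosted m v A B p r \<sigma>)) \<Psi> qs))"

text \<open>
  Vanishing of $[\psi^{AB}_{ab}(x), \psi^{CD\dagger}_{cd}(y)]_\mp$, as a distribution in $x$ and
  $y$, on the open set $(x-y)^2 > 0$.
\<close>

definition microcausal ::
  "statistics \<Rightarrow> real \<Rightarrow> nat \<Rightarrow> coefficients \<Rightarrow> coefficients \<Rightarrow>
   (nat \<Rightarrow> nat \<Rightarrow> complex) \<Rightarrow> (nat \<Rightarrow> nat \<Rightarrow> complex) \<Rightarrow> bool" where
  "microcausal st m j u v \<kappa> lam \<longleftrightarrow>
     (\<forall>A B C D. admissible j A B \<longrightarrow> admissible j C D \<longrightarrow>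
        (\<forall>r\<in>components A B. \<forall>s\<in>components C D. \<forall>f g.
           test_function f \<longrightarrow> test_function g \<longrightarrow>
           (\<forall>x\<in>supp f. \<forall>y\<in>supp g. spacelike (x - y)) \<longrightarrow>
           (\<forall>\<Psi>\<in>fock_domain st j. \<forall>qs.
              bracket st (psi st m j u v \<kappa> lam A B r f)
                (psi_dagger st m j u v \<kappa> lam C D s g) \<Psi> qs = 0)))"

end

theory Submission
  imports Defs "HOL-Complex_Analysis.Conformal_Mappings"
begin

text \<open>
  The bracket of two smeared fields of types $(A,B)$ and $(C,D)$ is a multiple of the identity, namely,
  up to a constant,
  $\kappa\kappa'^* \int \frac{d^3p}{p^0}\, G(p) \hat f(p) \hat g(-p) \mp
  \lambda\lambda'^* \int \frac{d^3p}{p^0}\, G(p) \hat f(-p) \hat g(p)$ with the Gram matrix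
  $G$ of the boosted coefficients. The rest-frame coefficients intertwine $SU(2)$, hence by analytic
  continuation also the boosts, so that $G$ is a polynomial in $(\mathbf{p}, p^0)$ of parity
  $(-1)^{2A + 2D}$. At space-like separation the two integrals agree up to this parity: after
  $\mathbf{p} \mapsto -\mathbf{p}$ the difference of the integrands is even in $p^0$ and therefore entire
  in $\mathbf{p}$, and moving the Gaussian-regularised integral in the direction
  $i(\mathbf{x} - \mathbf{y})$ makes it arbitrarily small. Conversely the integrals do not vanish for all
  space-like separated test functions: contracting $G$ with its value at rest gives a positive function,
  and a positive energy Fourier transform that vanishes at space-like points vanishes identically.
  Causality thus says $\kappa\kappa'^* = \pm(-1)^{2A+2D}\lambda\lambda'^*$ for all pairs of types; the diagonal
  cases fix the statistics and $|\kappa| = |\lambda|$, the others fix the phases.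
\<close>

section \<open>Tempered and rapidly decreasing functions\<close>

text \<open>Neither momentum integral can be moved into complex momenta on its own: the energy is a
  square root and has branch points. Only the difference with the right parity sign contains the
  energy \<open>e\<close> solely through cos(t e) and sin(t e)/e, which are entire in e^2. At fixed
  positions the integrals do not converge absolutely, hence the damping exp(-\<epsilon> p^2), which
  also permits exchanging momentum and position integrals. A shift by y costs \<epsilon> y^2 in the
  exponent and gains \<delta> y, where \<delta> is the smallest excess of spatial distance over time
  difference on the supports. At y = \<delta> / (2 \<epsilon>) the net factor is exp(-\<delta>^2 /
  (4 \<epsilon>)), which beats every power of 1 / \<epsilon>, so all other constants need only be
  polynomial in 1 / \<epsilon>. In the converse direction the unknown is one number for each pair of
  types, so a single space-like configuration with non-zero integral suffices for each pair; an
  abstract uniqueness argument provides it without any explicit position space kernel.\<close>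

definition rapid :: "(real ^ 3 \<Rightarrow> complex) \<Rightarrow> bool" where
  "rapid f \<longleftrightarrow> continuous_on UNIV f \<and> (\<forall>N. \<exists>C. \<forall>p. (1 + norm p) ^ N * cmod (f p) \<le> C)"

text \<open>The multipliers of \<open>rapid\<close> functions. Neither class controls derivatives:
  continuity gives measurability and the bounds give integrability and domination, which is all that
  the momentum integrals ask for.\<close>

definition tempered :: "(real ^ 3 \<Rightarrow> complex) \<Rightarrow> bool" where
  "tempered f \<longleftrightarrow> continuous_on UNIV f \<and> (\<exists>N C. \<forall>p. cmod (f p) \<le> C * (1 + norm p) ^ N)"

lemma tempered_const [intro, simp]: "tempered (\<lambda>p. c)"
  unfolding tempered_def by (auto intro!: exI[of _ 0] exI[of _ "cmod c"])

lemma tempered_bound: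
  assumes "tempered f"
  shows "\<exists>N C. C \<ge> 0 \<and> (\<forall>p. cmod (f p) \<le> C * (1 + norm p) ^ N)"
proof -
  from assms obtain N C where *: "\<And>p. cmod (f p) \<le> C * (1 + norm p) ^ N"
    unfolding tempered_def by blast
  have "0 \<le> C"
    using order_trans[OF norm_ge_zero *[of 0]] by simp
  with * show ?thesis by blast
qed

lemma tempered_add [intro]:
  assumes "tempered f" "tempered g"
  shows "tempered (\<lambda>p. f p + g p)"
proof -
  obtain N C where 1: "C \<ge> 0" "\<And>p. cmod (f p) \<le> C * (1 + norm p) ^ N"
    using tempered_bound[OF assms(1)] by blast
  obtain M D where 2: "D \<ge> 0" "\<And>p. cmod (g p) \<le> D * (1 + norm p) ^ M"
    using tempered_bound[OF assms(2)] by blast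
  have "cmod (f p + g p) \<le> (C + D) * (1 + norm p) ^ (N + M)" for p
  proof -
    have "cmod (f p) \<le> C * (1 + norm p) ^ (N + M)"
      using 1(2)[of p] by (rule order_trans) (intro mult_left_mono power_increasing, use 1 in auto)
    moreover have "cmod (g p) \<le> D * (1 + norm p) ^ (N + M)"
      using 2(2)[of p] by (rule order_trans) (intro mult_left_mono power_increasing, use 2 in auto)
    ultimately show ?thesis
      using norm_triangle_ineq[of "f p" "g p"] by (simp add: algebra_simps)
  qed
  then show ?thesis
    using assms unfolding tempered_def by (blast intro: continuous_on_add)
qed

lemma tempered_mult [intro]:
  assumes "tempered f" "tempered g"
  shows "tempered (\<lambda>p. f p * g p)"
proof -
  obtain N C where 1: "C \<ge> 0" "\<And>p. cmod (f p) \<le> C * (1 + norm p) ^ N"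
    using tempered_bound[OF assms(1)] by blast
  obtain M D where 2: "D \<ge> 0" "\<And>p. cmod (g p) \<le> D * (1 + norm p) ^ M"
    using tempered_bound[OF assms(2)] by blast
  have "cmod (f p * g p) \<le> (C * D) * (1 + norm p) ^ (N + M)" for p
    using mult_mono[OF 1(2)[of p] 2(2)[of p]] 1 2
    by (simp add: norm_mult power_add mult_ac)
  then show ?thesis
    using assms unfolding tempered_def by (blast intro: continuous_on_mult)
qed

lemma tempered_sum [intro]: "(\<And>i. i \<in> I \<Longrightarrow> tempered (f i)) \<Longrightarrow> tempered (\<lambda>p. \<Sum>i\<in>I. f i p)"
  by (induction I rule: infinite_finite_induct) auto

lemma tempered_diff [intro]:
  assumes "tempered f" "tempered g" shows "tempered (\<lambda>p. f p - g p)"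
  using tempered_add[OF assms(1) tempered_mult[OF tempered_const[of "-1"] assms(2)]] by simp

lemma tempered_cnj [intro]: "tempered f \<Longrightarrow> tempered (\<lambda>p. cnj (f p))"
  unfolding tempered_def by (auto intro!: continuous_intros)

lemma rapid_mult_tempered [intro]:
  assumes "rapid f" "tempered g"
  shows "rapid (\<lambda>p. f p * g p)"
proof -
  obtain M D where 2: "D \<ge> 0" "\<And>p. cmod (g p) \<le> D * (1 + norm p) ^ M"
    using tempered_bound[OF assms(2)] by blast
  have "\<exists>C. \<forall>p. (1 + norm p) ^ N * cmod (f p * g p) \<le> C" for N
  proof -
    obtain C where C: "\<And>p. (1 + norm p) ^ (N + M) * cmod (f p) \<le> C"
      using assms(1) unfolding rapid_def by blast
    have "(1 + norm p) ^ N * cmod (f p * g p) \<le> C * D" for p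
    proof -
      have "(1 + norm p) ^ N * cmod (f p * g p) \<le> (1 + norm p) ^ N * (cmod (f p) * (D * (1 + norm p) ^ M))"
        unfolding norm_mult by (intro mult_left_mono 2) auto
      also have "\<dots> = ((1 + norm p) ^ (N + M) * cmod (f p)) * D"
        by (simp add: power_add mult_ac)
      also have "\<dots> \<le> C * D" by (intro mult_right_mono C 2)
      finally show ?thesis .
    qed
    then show ?thesis by blast
  qed
  then show ?thesis
    using assms unfolding rapid_def tempered_def by (blast intro: continuous_on_mult)
qed

lemma rapid_imp_tempered [intro]: "rapid f \<Longrightarrow> tempered f"
  unfolding rapid_def tempered_def
  by (metis mult.right_neutral power_0 mult.left_neutral)

lemma rapid_mult_tempered' [intro]: "tempered f \<Longrightarrow> rapid g \<Longrightarrow> rapid (\<lambda>p. f p * g p)"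
  using rapid_mult_tempered[of g f] by (simp add: mult.commute)

lemma rapid_bound:
  assumes "rapid f"
  shows "\<exists>C>0. \<forall>p. (1 + norm p) ^ N * cmod (f p) \<le> C"
proof -
  obtain C where C: "\<And>p. (1 + norm p) ^ N * cmod (f p) \<le> C"
    using assms unfolding rapid_def by blast
  have "(1 + norm p) ^ N * cmod (f p) \<le> max C 1" for p
    using C[of p] by linarith
  then show ?thesis by (intro exI[of _ "max C 1"]) auto
qed

text \<open>Between the radii n and n + 1 the integrand is at most (n + 1)^-5, and covering this
  shell by the whole ball, of volume proportional to (n + 1)^3, leaves the convergent sum of (n +
  1)^-2. The exponent 5 is the least integer for which this crude covering converges; it is the
  standard majorant from here on.\<close>

lemma integrable_decay: "integrable lborel (\<lambda>p :: real ^ 3. 1 / (1 + norm p) ^ 5)"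
proof (rule integrableI_nonneg)
  let ?c = "unit_ball_vol 3"
  let ?a = "\<lambda>n p. ennreal (1 / (1 + real n) ^ 5) * indicator (cball 0 (1 + real n)) (p :: real ^ 3)"
  have "ennreal (1 / (1 + norm p) ^ 5) \<le> (\<Sum>n. ?a n p)" for p :: "real ^ 3"
  proof -
    define n where "n = nat \<lfloor>norm p\<rfloor>"
    have n: "real n \<le> norm p" "norm p \<le> 1 + real n"
      unfolding n_def by (simp, linarith)
    have "ennreal (1 / (1 + norm p) ^ 5) \<le> ?a n p"
    proof -
      have "1 / (1 + norm p) ^ 5 \<le> 1 / (1 + real n) ^ 5"
        using n by (intro divide_left_mono power_mono) auto
      then show ?thesis
        using n by (simp add: ennreal_leI)
    qed
    also have "\<dots> \<le> (\<Sum>n. ?a n p)"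
    proof -
      have "a n \<le> suminf a" for a :: "nat \<Rightarrow> ennreal"
        using sum_le_suminf[of a "{n}"] by simp
      then show ?thesis .
    qed
    finally show ?thesis .
  qed
  then have "(\<integral>\<^sup>+p. ennreal (1 / (1 + norm (p :: real ^ 3)) ^ 5) \<partial>lborel) \<le>
      (\<integral>\<^sup>+p. (\<Sum>n. ?a n p) \<partial>lborel)"
    by (intro nn_integral_mono)
  also have "\<dots> = (\<Sum>n. \<integral>\<^sup>+p. ?a n p \<partial>lborel)"
    by (intro nn_integral_suminf borel_measurable_times_ennreal borel_measurable_const
        borel_measurable_indicator) simp
  also have "\<dots> = (\<Sum>n. ennreal (?c / (1 + real n) ^ 2))"
  proof (intro suminf_cong)
    fix n :: nat
    have "(\<integral>\<^sup>+p. ?a n p \<partial>lborel) = ennreal (1 / (1 + real n) ^ 5) * ennreal (?c * (1 + real n) ^ 3)"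
      by (subst nn_integral_cmult_indicator) (simp_all add: emeasure_cball)
    also have "\<dots> = ennreal (1 / (1 + real n) ^ 5 * (?c * (1 + real n) ^ 3))"
      by (simp add: ennreal_mult' flip: times_divide_eq_left)
    also have "1 / (1 + real n) ^ 5 * (?c * (1 + real n) ^ 3) = ?c / (1 + real n) ^ 2"
    proof -
      have "(1 + real n) ^ 5 = (1 + real n) ^ 2 * (1 + real n) ^ 3"
        by (simp flip: power_add)
      moreover have "(1 + real n) ^ 3 \<noteq> 0" by (simp add: add_nonneg_eq_0_iff)
      ultimately show ?thesis by (simp add: divide_simps)
    qed
    finally show "(\<integral>\<^sup>+p. ?a n p \<partial>lborel) = ennreal (?c / (1 + real n) ^ 2)" .
  qed
  also have "\<dots> < \<infinity>"
  proof -
    have "summable (\<lambda>n. ?c / (1 + real n) ^ 2)"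
      using summable_mult[OF inverse_power_summable[of 2, where 'a = real, THEN summable_ignore_initial_segment[of _ 1]], of ?c]
      by (simp add: field_simps)
    then show ?thesis
      by (subst suminf_ennreal2) auto
  qed
  finally show "(\<integral>\<^sup>+p. ennreal (1 / (1 + norm (p::real^3)) ^ 5) \<partial>lborel) < \<infinity>" .
qed auto

lemma rapid_measurable [measurable_dest]: "rapid f \<Longrightarrow> f \<in> borel_measurable borel"
  unfolding rapid_def by (intro borel_measurable_continuous_onI) auto

lemma rapid_le_decay:
  assumes "rapid f"
  shows "\<exists>C>0. \<forall>p. cmod (f p) \<le> C * (1 / (1 + norm p) ^ 5)"
proof -
  obtain C where C: "C > 0" "\<And>p. (1 + norm p) ^ 5 * cmod (f p) \<le> C"
    using rapid_bound[OF assms] by blast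
  have "cmod (f p) \<le> C * (1 / (1 + norm p) ^ 5)" for p
  proof -
    have "(1 + norm p) ^ 5 > 0" by (intro zero_less_power) (simp add: add_pos_nonneg)
    then show ?thesis using C(2)[of p] by (simp add: field_simps)
  qed
  with C show ?thesis by blast
qed

lemma rapid_integrable:
  assumes "rapid f" shows "integrable lborel f"
proof -
  obtain C where C: "C > 0" "\<And>p. cmod (f p) \<le> C * (1 / (1 + norm p) ^ 5)"
    using rapid_le_decay[OF assms] by blast
  show ?thesis
    by (rule Bochner_Integration.integrable_bound
        [OF integrable_mult_right[OF integrable_decay, of C]])
      (use C rapid_measurable[OF assms] in \<open>auto intro!: always_eventually order_trans[OF C(2)]\<close>)
qed

section \<open>Holomorphic parameter integrals\<close>

text \<open>Cauchy's inequality turns the local bound \<open>B\<close> on the integrand into the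
  bound \<open>B x / r\<close> on its derivative, hence on its difference quotients, and dominated
  convergence differentiates under the integral.\<close>

lemma holomorphic_on_integral:
  fixes F :: "complex \<Rightarrow> 'a \<Rightarrow> complex"
  assumes U: "open U"
    and meas: "\<And>w. w \<in> U \<Longrightarrow> F w \<in> borel_measurable M"
    and hol: "\<And>x. x \<in> space M \<Longrightarrow> (\<lambda>w. F w x) holomorphic_on U"
    and dom: "\<And>w. w \<in> U \<Longrightarrow> \<exists>r>0. \<exists>B. integrable M B \<and>
      (\<forall>v\<in>ball w r \<inter> U. \<forall>x\<in>space M. cmod (F v x) \<le> B x)"
  shows "(\<lambda>w. LINT x|M. F w x) holomorphic_on U"
proof -
  have "(\<lambda>w. LINT x|M. F w x) field_differentiable (at w)" if w: "w \<in> U" for w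
  proof -
    obtain r0 B where r0: "r0 > 0" and B: "integrable M B"
      and bd0: "\<And>v x. v \<in> ball w r0 \<inter> U \<Longrightarrow> x \<in> space M \<Longrightarrow> cmod (F v x) \<le> B x"
      using dom[OF w] by blast
    obtain r1 where r1: "r1 > 0" "ball w r1 \<subseteq> U"
      using U w open_contains_ball by blast
    \<comment> \<open>A third of the radius: discs of radius \<open>r\<close> about points of
      \<open>ball w r\<close> stay inside \<open>ball w (3 * r)\<close>, where the bound
      holds.\<close>
    define r where "r = min r0 r1 / 3"
    have r: "r > 0" using r0 r1 by (simp add: r_def)
    have sub: "ball w (3 * r) \<subseteq> ball w r0 \<inter> U"
      using r1 by (auto simp: r_def)
    have bd: "cmod (F v x) \<le> B x" if "v \<in> ball w (3 * r)" "x \<in> space M" for v x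
      using bd0 sub that by blast
    have int: "integrable M (F v)" if "v \<in> ball w (3 * r)" for v
    proof (rule Bochner_Integration.integrable_bound[OF B])
      show "F v \<in> borel_measurable M" using meas that sub by blast
      show "AE x in M. norm (F v x) \<le> norm (B x)"
      proof (rule AE_I2)
        fix x assume "x \<in> space M"
        then have "cmod (F v x) \<le> B x" by (rule bd[OF that])
        then show "norm (F v x) \<le> norm (B x)" by simp
      qed
    qed
    have der: "cmod (deriv (\<lambda>w. F w x) v) \<le> B x / r" if v: "v \<in> ball w r" and x: "x \<in> space M" for v x
    proof -
      have c: "cball v r \<subseteq> ball w (3 * r)"
      proof
        fix y assume "y \<in> cball v r"
        then show "y \<in> ball w (3 * r)"
          using v dist_triangle[of w y v] r by (auto simp: dist_commute)
      qed
      have h: "(\<lambda>w. F w x) holomorphic_on cball v r"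
        using hol[OF x] c sub holomorphic_on_subset by blast
      have "norm ((deriv ^^ 1) (\<lambda>w. F w x) v) \<le> fact 1 * B x / r ^ 1"
      proof (rule Cauchy_inequality)
        show "(\<lambda>w. F w x) holomorphic_on ball v r"
          using h holomorphic_on_subset ball_subset_cball by blast
        show "continuous_on (cball v r) (\<lambda>w. F w x)"
          using h by (rule holomorphic_on_imp_continuous_on)
        show "cmod (F y x) \<le> B x" if "cmod (v - y) = r" for y
          using c that by (intro bd x) (auto simp: dist_norm)
      qed (use r in simp)
      then show ?thesis by simp
    qed
    have dq: "cmod ((F v x - F w x) / (v - w)) \<le> B x / r" if v: "v \<in> ball w r" and x: "x \<in> space M" for v x
    proof -
      have "cmod (F v x - F w x) \<le> B x / r * cmod (v - w)"
      proof (rule field_differentiable_bound[of "ball w r" "\<lambda>w. F w x" "deriv (\<lambda>w. F w x)"])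
        fix z assume z: "z \<in> ball w r"
        have "z \<in> U" using z sub r by auto
        then show "((\<lambda>w. F w x) has_field_derivative deriv (\<lambda>w. F w x) z) (at z within ball w r)"
          using holomorphic_derivI[OF hol[OF x] U] has_field_derivative_at_within by blast
      qed (use v r x der in auto)
      \<comment> \<open>For \<open>v = w\<close> the quotient is 0 by the convention on division,
        and the bound only asks that \<open>B x\<close> be nonnegative.\<close>
      then show ?thesis
        using bd[of w x] x r by (cases "v = w") (auto simp: norm_divide divide_simps order_trans[OF norm_ge_zero])
    qed
    let ?D = "\<lambda>x. deriv (\<lambda>w. F w x) w"
    have lim: "(\<lambda>n. (F (X n) x - F w x) / (X n - w)) \<longlonglongrightarrow> ?D x"
      if "x \<in> space M" "\<And>n. X n \<noteq> w" "X \<longlonglongrightarrow> w" for x and X :: "nat \<Rightarrow> complex"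
    proof -
      have "((\<lambda>w. F w x) has_field_derivative ?D x) (at w)"
        using holomorphic_derivI[OF hol[OF that(1)] U w] .
      then show ?thesis
        using that(2,3) unfolding has_field_derivative_iff
        by (auto simp: tendsto_at_iff_sequentially o_def)
    qed
    \<comment> \<open>The derivative is a pointwise limit of difference quotients along one fixed
      sequence, hence measurable.\<close>
    have D_meas: "?D \<in> borel_measurable M"
    proof -
      define X where "X n = w + of_real (r / (n + 2))" for n :: nat
      have X: "X n \<in> ball w r" "X n \<noteq> w" for n
      proof -
        have "\<bar>r / (real n + 2)\<bar> < r"
        proof -
          have "r < r * (real n + 2)" using r by simp
          then show ?thesis using r by (simp add: divide_less_eq)
        qed
        moreover have "dist w (X n) = \<bar>r / (real n + 2)\<bar>"
          unfolding X_def dist_norm norm_minus_commute[of w]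
          by (simp only: add_diff_cancel_left' norm_of_real) simp
        moreover have "r / (real n + 2) \<noteq> 0" using r by simp
        ultimately show "X n \<in> ball w r" "X n \<noteq> w" by auto
      qed
      have "(\<lambda>n. r / (real n + 2)) \<longlonglongrightarrow> 0"
        using LIMSEQ_ignore_initial_segment[OF lim_const_over_n[of r], of 2] by (simp add: add.commute)
      then have "X \<longlonglongrightarrow> w + of_real 0"
        unfolding X_def by (intro tendsto_add tendsto_const tendsto_of_real) (simp add: add.commute)
      then have "X \<longlonglongrightarrow> w" by simp
      show ?thesis
      proof (rule borel_measurable_LIMSEQ_metric)
        show "(\<lambda>x. (F (X n) x - F w x) / (X n - w)) \<in> borel_measurable M" for n
        proof -
          have "F (X n) \<in> borel_measurable M" "F w \<in> borel_measurable M"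
            using meas X(1)[of n] sub w r by (auto simp: subset_iff)
          then show ?thesis by simp
        qed
        show "(\<lambda>n. (F (X n) x - F w x) / (X n - w)) \<longlonglongrightarrow> ?D x" if "x \<in> space M" for x
          using that X(2) \<open>X \<longlonglongrightarrow> w\<close> by (rule lim)
      qed
    qed
    have "((\<lambda>w. LINT x|M. F w x) has_field_derivative (LINT x|M. ?D x)) (at w)"
      unfolding has_field_derivative_iff tendsto_at_iff_sequentially o_def
    proof (intro allI impI)
      fix X :: "nat \<Rightarrow> complex"
      assume X: "\<forall>i. X i \<in> UNIV - {w}" "X \<longlonglongrightarrow> w"
      then have "\<forall>\<^sub>F i in sequentially. X i \<in> ball w r"
        using tendstoD[OF X(2) r] by (simp add: dist_commute)
      then obtain k where k: "\<And>i. i \<ge> k \<Longrightarrow> X i \<in> ball w r"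
        by (auto simp: eventually_sequentially)
      \<comment> \<open>Dropping finitely many terms puts the whole sequence into the disc where the
        difference quotients are dominated.\<close>
      define Y where "Y i = X (i + k)" for i
      have Y: "Y i \<in> ball w r" "Y i \<noteq> w" for i
        using k X(1) by (auto simp: Y_def)
      have Yl: "Y \<longlonglongrightarrow> w"
        unfolding Y_def using X(2) by (rule LIMSEQ_ignore_initial_segment)
      have "(\<lambda>n. LINT x|M. (F (Y n) x - F w x) / (Y n - w)) \<longlonglongrightarrow> (LINT x|M. ?D x)"
      proof (rule integral_dominated_convergence[where w = "\<lambda>x. B x / r"])
        show "(\<lambda>x. (F (Y n) x - F w x) / (Y n - w)) \<in> borel_measurable M" for n
        proof -
          have "F (Y n) \<in> borel_measurable M" "F w \<in> borel_measurable M"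
            using meas Y(1)[of n] sub w r by (auto simp: subset_iff)
          then show ?thesis by simp
        qed
        show "AE x in M. (\<lambda>n. (F (Y n) x - F w x) / (Y n - w)) \<longlonglongrightarrow> ?D x"
          using lim[OF _ Y(2) Yl] by (intro AE_I2)
        show "AE x in M. norm ((F (Y n) x - F w x) / (Y n - w)) \<le> B x / r" for n
          using dq[OF Y(1)] by (intro AE_I2)
      qed (use B D_meas in auto)
      moreover have "(LINT x|M. (F (Y n) x - F w x) / (Y n - w)) =
          ((LINT x|M. F (Y n) x) - (LINT x|M. F w x)) / (Y n - w)" for n
      proof -
        have "Y n \<in> ball w (3 * r)" "w \<in> ball w (3 * r)" using Y(1)[of n] r by auto
        then show ?thesis
          using int by (simp add: Bochner_Integration.integral_diff)
      qed
      ultimately have "(\<lambda>n. ((LINT x|M. F (Y n) x) - (LINT x|M. F w x)) / (Y n - w)) \<longlonglongrightarrow> (LINT x|M. ?D x)"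
        by (simp only:)
      then show "(\<lambda>n. ((LINT x|M. F (X n) x) - (LINT x|M. F w x)) / (X n - w)) \<longlonglongrightarrow> (LINT x|M. ?D x)"
        unfolding Y_def by (rule LIMSEQ_offset)
    qed
    then show ?thesis
      unfolding field_differentiable_def by blast
  qed
  then show ?thesis
    by (meson field_differentiable_at_within holomorphic_on_def)
qed

text \<open>Boundary uniqueness by pasting: extended by zero above the real axis, \<open>H\<close>
  is continuous across the interval and holomorphic on both sides, hence holomorphic on a disc about
  the midpoint. It vanishes on the upper half of that disc, so the identity theorem carries the zero
  into the lower half plane, and continuity carries it to the closure.\<close>

lemma zero_on_lower_half_plane:
  assumes cont: "continuous_on {z. Im z \<le> 0} H" and hol: "H holomorphic_on {z. Im z < 0}"
    and ab: "a < b" and zero: "\<And>x. a < x \<Longrightarrow> x < b \<Longrightarrow> H (of_real x) = 0"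
    and z: "Im z \<le> 0"
  shows "H z = 0"
proof -
  define c where "c = (a + b) / 2"
  define r where "r = (b - a) / 2"
  have r: "r > 0" using ab by (simp add: r_def)
  define B where "B = ball (complex_of_real c) r"
  define F where "F z = (if Im z \<le> 0 then H z else 0)" for z
  have zero': "H z = 0" if "z \<in> B" "Im z = 0" for z
  proof -
    have "z = of_real (Re z)" using that by (simp add: complex_eq_iff)
    moreover have "\<bar>c - Re z\<bar> < r"
      using that abs_Re_le_cmod[of "of_real c - z"] by (simp add: B_def dist_norm)
    then have "a < Re z" "Re z < b"
      unfolding c_def r_def abs_less_iff by (simp_all add: field_simps)
    ultimately show ?thesis using zero by metis
  qed
  have "F holomorphic_on B"
  \<comment> \<open>The direction \<open>- \<i>\<close> makes the lower half plane the positive side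
    of the line.\<close>
  proof (rule holomorphic_on_paste_across_line[where d = "- \<i>" and k = 0])
    have "continuous_on ((B \<inter> {z. Im z \<le> 0}) \<union> (B \<inter> {z. Im z \<ge> 0})) F"
      unfolding F_def
    proof (rule continuous_on_cases_local)
      have *: "continuous_on UNIV Im" by (intro continuous_intros)
      show "closedin (top_of_set (B \<inter> {z. Im z \<le> 0} \<union> B \<inter> {z. 0 \<le> Im z})) (B \<inter> {z. Im z \<le> 0})"
        unfolding closedin_closed
        by (intro exI[of _ "{z. Im z \<le> 0}"]) (auto intro!: closed_Collect_le continuous_intros)
      show "closedin (top_of_set (B \<inter> {z. Im z \<le> 0} \<union> B \<inter> {z. 0 \<le> Im z})) (B \<inter> {z. 0 \<le> Im z})"
        unfolding closedin_closed
        by (intro exI[of _ "{z. Im z \<ge> 0}"]) (auto intro!: closed_Collect_le continuous_intros)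
      show "continuous_on (B \<inter> {z. Im z \<le> 0}) H"
        by (rule continuous_on_subset[OF cont]) auto
      show "H z = 0" if "z \<in> B \<inter> {z. Im z \<le> 0} \<and> \<not> Im z \<le> 0 \<or> z \<in> B \<inter> {z. 0 \<le> Im z} \<and> Im z \<le> 0" for z
        using that zero'[of z] by force
    qed simp
    moreover have "(B \<inter> {z. Im z \<le> 0}) \<union> (B \<inter> {z. Im z \<ge> 0}) = B" by auto
    ultimately show "continuous_on B F" by simp
    have "H holomorphic_on (B \<inter> {z. - \<i> \<bullet> z > 0})"
      using hol by (rule holomorphic_on_subset) (auto simp: inner_complex_def)
    then show "F holomorphic_on (B \<inter> {z. - \<i> \<bullet> z > 0})"
      by (rule holomorphic_transform) (auto simp: F_def inner_complex_def)
    have "(\<lambda>z. 0) holomorphic_on (B \<inter> {z. - \<i> \<bullet> z < 0})" by simp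
    then show "F holomorphic_on (B \<inter> {z. - \<i> \<bullet> z < 0})"
      by (rule holomorphic_transform) (auto simp: F_def inner_complex_def)
  qed (auto simp: B_def)
  have FB: "F z = 0" if "z \<in> B" for z
  proof (rule analytic_continuation_open[of "B \<inter> {z. Im z > 0}" B F "\<lambda>_. 0"])
    show "open (B \<inter> {z. Im z > 0})"
      unfolding B_def by (intro open_Int open_ball open_Collect_less continuous_intros)
    have "of_real c + \<i> * of_real (r / 2) \<in> B \<inter> {z. Im z > 0}"
      using r by (simp add: B_def dist_norm norm_mult)
    then show "B \<inter> {z. Im z > 0} \<noteq> {}" by blast
  qed (use \<open>F holomorphic_on B\<close> that in \<open>auto simp: B_def F_def\<close>)
  have low: "H z = 0" if "Im z < 0" for z
  proof (rule analytic_continuation_open[of "B \<inter> {z. Im z < 0}" "{z. Im z < 0}" H "\<lambda>_. 0"])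
    show "open (B \<inter> {z. Im z < 0})" "open {z. Im z < 0}"
      unfolding B_def by (intro open_Int open_ball open_Collect_less continuous_intros)+
    have "of_real c - \<i> * of_real (r / 2) \<in> B \<inter> {z. Im z < 0}"
      using r by (simp add: B_def dist_norm norm_mult)
    then show "B \<inter> {z. Im z < 0} \<noteq> {}" by blast
    show "connected {z. Im z < 0}"
      by (intro convex_connected convex_halfspace_Im_lt)
    show "H z = 0" if "z \<in> B \<inter> {z. Im z < 0}" for z
      using FB[of z] that by (simp add: F_def)
  qed (use hol that in auto)
  show ?thesis
  proof (rule continuous_constant_on_closure[of "{z. Im z < 0}" H 0 z])
    have "closure {z. Im z < 0} = {z. Im z \<le> 0}"
      using closure_halfspace_lt[of \<i> 0] by (simp add: inner_complex_def)
    then show "continuous_on (closure {z. Im z < 0}) H" "z \<in> closure {z. Im z < 0}"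
      using cont z by auto
  qed (use low in auto)
qed

section \<open>Test functions and their plane wave transforms\<close>

lemma frechet_eqI: "(f has_derivative f') (at x) \<Longrightarrow> frechet_derivative f (at x) = f'"
  using frechet_derivative_at by metis

lemma cont_diff_SucI:
  assumes "\<And>x. (f has_derivative f' x) (at x)" "\<And>e. e \<in> Basis \<Longrightarrow> cont_diff k (\<lambda>x. f' x e)"
  shows "cont_diff (Suc k) f"
proof -
  have "frechet_derivative f (at x) = f' x" for x
    using assms(1) by (rule frechet_eqI)
  moreover have "f differentiable_on UNIV"
    using assms(1) by (auto simp: differentiable_on_def differentiable_def)
  ultimately show ?thesis using assms(2) by simp
qed

lemma cont_diff_Suc_has_derivative:
  assumes "cont_diff (Suc k) f"
  shows "(f has_derivative frechet_derivative f (at x)) (at x)"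
  using assms frechet_derivative_works by (auto simp: differentiable_on_def)

lemma cont_diff_continuous: "cont_diff k f \<Longrightarrow> continuous_on UNIV f"
  by (cases k) (auto intro: differentiable_imp_continuous_on)

text \<open>Wanted for the product rule, where an undifferentiated factor must be lowered by one
  order to enter the induction.\<close>

lemma cont_diff_SucD: "cont_diff (Suc k) f \<Longrightarrow> cont_diff k f"
proof (induction k arbitrary: f)
  case 0
  then show ?case by (auto intro: differentiable_imp_continuous_on)
next
  case (Suc k)
  show ?case
    unfolding cont_diff.simps(2)
  proof (intro conjI ballI Suc.IH)
    show "f differentiable_on UNIV" using Suc.prems by simp
    show "cont_diff (Suc k) (\<lambda>x. frechet_derivative f (at x) e)" if "e \<in> Basis" for e
      using Suc.prems that unfolding cont_diff.simps(2)[of "Suc k"] by blast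
  qed
qed

lemma cont_diff_const [simp]: "cont_diff k (\<lambda>x. c)"
proof (induction k arbitrary: c)
  case (Suc k)
  show ?case by (rule cont_diff_SucI[where f' = "\<lambda>_ _. 0"]) (auto simp: Suc.IH)
qed simp

lemma cont_diff_add: "cont_diff k f \<Longrightarrow> cont_diff k g \<Longrightarrow> cont_diff k (\<lambda>x. f x + g x)"
proof (induction k arbitrary: f g)
  case 0
  then show ?case by (auto intro: continuous_on_add)
next
  case (Suc k)
  show ?case
  proof (rule cont_diff_SucI)
    show "((\<lambda>x. f x + g x) has_derivative
        (\<lambda>h. frechet_derivative f (at x) h + frechet_derivative g (at x) h)) (at x)" for x
      by (rule has_derivative_add[OF Suc.prems[THEN cont_diff_Suc_has_derivative]])
  qed (use Suc in auto)
qed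

lemma cont_diff_mult:
  fixes f g :: "'a::euclidean_space \<Rightarrow> 'b::real_normed_algebra"
  shows "cont_diff k f \<Longrightarrow> cont_diff k g \<Longrightarrow> cont_diff k (\<lambda>x. f x * g x)"
proof (induction k arbitrary: f g)
  case 0
  then show ?case by (auto intro: continuous_on_mult)
next
  case (Suc k)
  show ?case
  proof (rule cont_diff_SucI)
    show "((\<lambda>x. f x * g x) has_derivative
        (\<lambda>h. f x * frechet_derivative g (at x) h + frechet_derivative f (at x) h * g x)) (at x)" for x
      by (rule has_derivative_mult[OF Suc.prems[THEN cont_diff_Suc_has_derivative]])
  next
    fix e :: 'a assume e: "e \<in> Basis"
    show "cont_diff k (\<lambda>x. f x * frechet_derivative g (at x) e + frechet_derivative f (at x) e * g x)"
      using Suc.prems e by (intro cont_diff_add Suc.IH cont_diff_SucD[OF Suc.prems(1)]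
          cont_diff_SucD[OF Suc.prems(2)]) auto
  qed
qed

lemma cont_diff_bounded_linear:
  assumes L: "bounded_linear L"
  shows "cont_diff k f \<Longrightarrow> cont_diff k (\<lambda>x. L (f x))"
proof (induction k arbitrary: f)
  case 0
  then show ?case using bounded_linear.continuous_on[OF L] by auto
next
  case (Suc k)
  show ?case
  proof (rule cont_diff_SucI)
    show "((\<lambda>x. L (f x)) has_derivative (\<lambda>h. L (frechet_derivative f (at x) h))) (at x)" for x
      by (rule bounded_linear.has_derivative[OF L Suc.prems[THEN cont_diff_Suc_has_derivative]])
  qed (use Suc in auto)
qed

lemma cont_diff_shift:
  fixes f :: "'a::euclidean_space \<Rightarrow> 'b::real_normed_vector"
  shows "cont_diff k f \<Longrightarrow> cont_diff k (\<lambda>x. f (x - a))"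
proof (induction k arbitrary: f)
  case 0
  then show ?case by (auto intro!: continuous_on_compose2[of UNIV f] continuous_intros)
next
  case (Suc k)
  show ?case
  proof (rule cont_diff_SucI)
    have 1: "((\<lambda>x. x - a) has_derivative (\<lambda>h. h)) (at x)" for x
      by (auto intro!: derivative_eq_intros)
    show "((\<lambda>x. f (x - a)) has_derivative frechet_derivative f (at (x - a))) (at x)" for x
      by (rule has_derivative_compose[OF 1 cont_diff_Suc_has_derivative[OF Suc.prems]])
  qed (use Suc in auto)
qed

lemma test_function_support: "x \<notin> supp f \<Longrightarrow> f x = 0"
  using closure_subset[of "{x. f x \<noteq> 0}"] by (auto simp: supp_def)

lemma test_functionI:
  assumes "\<And>k. cont_diff k f" "compact K" "\<And>x. x \<notin> K \<Longrightarrow> f x = 0"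
  shows "test_function f"
proof -
  have "supp f \<subseteq> K"
    unfolding supp_def using assms(3) compact_imp_closed[OF assms(2)]
    by (intro closure_minimal) auto
  then have "compact (supp f)"
    using compact_Int_closed[OF assms(2), of "supp f"] by (simp add: supp_def Int_absorb1)
  then show ?thesis using assms(1) by (simp add: test_function_def)
qed

lemma test_function_has_derivative:
  "test_function f \<Longrightarrow> (f has_derivative frechet_derivative f (at x)) (at x)"
  by (intro cont_diff_Suc_has_derivative[of 0]) (simp add: test_function_def del: cont_diff.simps)

lemma test_function_derivative:
  assumes "test_function f" "e \<in> Basis"
  shows "test_function (\<lambda>x. frechet_derivative f (at x) e)"
proof (rule test_functionI[of _ "supp f"])
  show "cont_diff k (\<lambda>x. frechet_derivative f (at x) e)" for k
  proof -
    have "cont_diff (Suc k) f" using assms(1) unfolding test_function_def by blast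
    then show ?thesis using assms(2) by simp
  qed
  show "compact (supp f)" using assms by (simp add: test_function_def)
  show "frechet_derivative f (at x) e = 0" if x: "x \<notin> supp f" for x
  proof -
    have "((\<lambda>_. 0) has_derivative (\<lambda>_. 0)) (at x)" by simp
    then have "(f has_derivative (\<lambda>_. 0)) (at x)"
    proof (rule has_derivative_transform_within_open)
      show "open (- supp f)" unfolding supp_def by (simp add: open_Compl)
      show "0 = f y" if "y \<in> - supp f" for y
        using that test_function_support[of y f] by simp
    qed (use x in auto)
    then show ?thesis by (simp add: frechet_eqI)
  qed
qed

section \<open>Integration by parts for compactly supported functions\<close>

lemma continuous_compact_support_integrable:
  fixes F :: "'a::euclidean_space \<Rightarrow> complex"
  assumes "continuous_on UNIV F" "compact K" "\<And>x. x \<notin> K \<Longrightarrow> F x = 0"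
  shows "integrable lborel F"
proof -
  have "integrable lborel (\<lambda>x. indicator K x *\<^sub>R F x)"
    by (intro borel_integrable_compact assms continuous_on_subset[OF assms(1)]) auto
  also have "(\<lambda>x. indicator K x *\<^sub>R F x) = F"
    using assms(3) by (auto simp: indicator_def)
  finally show ?thesis .
qed

lemma continuous_compact_support_bounded:
  fixes F :: "'a::euclidean_space \<Rightarrow> complex"
  assumes "continuous_on UNIV F" "compact K" "\<And>x. x \<notin> K \<Longrightarrow> F x = 0"
  shows "\<exists>B\<ge>0. \<forall>x. cmod (F x) \<le> B"
proof -
  have "compact (F ` K)"
    by (intro compact_continuous_image assms continuous_on_subset[OF assms(1)]) auto
  then obtain B where B: "\<And>x. x \<in> K \<Longrightarrow> cmod (F x) \<le> B"
    using compact_imp_bounded[of "F ` K"] by (auto simp: bounded_iff)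
  have "cmod (F x) \<le> max B 0" for x
    using B[of x] assms(3)[of x] by (cases "x \<in> K") auto
  then show ?thesis by (intro exI[of _ "max B 0"]) auto
qed

lemma lborel_integral_shift:
  fixes f :: "'a::euclidean_space \<Rightarrow> 'b::{banach, second_countable_topology}"
  assumes "f \<in> borel_measurable borel"
  shows "(LINT x|lborel. f (x + a)) = (LINT x|lborel. f x)"
proof -
  have "(LINT x|lborel. f x) = (LINT x|distr lborel borel ((+) a). f x)"
    by (simp add: lborel_distr_plus)
  also have "\<dots> = (LINT x|lborel. f (x + a))"
    using assms by (subst integral_distr) (auto simp: add.commute)
  finally show ?thesis by simp
qed

text \<open>Every difference quotient of \<open>F\<close> along \<open>e\<close> integrates to 0 by
  translation invariance. A bounded derivative bounds these quotients uniformly, their supports lie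
  in one ball, and dominated convergence passes to the derivative without iterated
  integrals.\<close>

lemma integral_directional_derivative_eq_0:
  fixes F :: "'a::euclidean_space \<Rightarrow> complex"
  assumes der: "\<And>x. (F has_derivative F' x) (at x)"
    and cont: "continuous_on UNIV (\<lambda>x. F' x e)"
    and K: "compact K" "\<And>x. x \<notin> K \<Longrightarrow> F x = 0" "\<And>x. x \<notin> K \<Longrightarrow> F' x e = 0"
  shows "(LINT x|lborel. F' x e) = 0"
proof -
  have Fc: "continuous_on UNIV F"
    by (intro continuous_at_imp_continuous_on ballI has_derivative_continuous[OF der])
  have Fi: "integrable lborel F"
    by (rule continuous_compact_support_integrable[OF Fc K(1,2)])
  have Fm: "F \<in> borel_measurable borel"
    using Fc by (rule borel_measurable_continuous_onI)
  obtain B where B: "B \<ge> 0" "\<And>x. cmod (F' x e) \<le> B"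
    using continuous_compact_support_bounded[OF cont K(1,3)] by blast
  obtain R where R: "\<And>x. x \<in> K \<Longrightarrow> norm x \<le> R"
    using compact_imp_bounded[OF K(1)] by (auto simp: bounded_iff)
  have line: "((\<lambda>t. F (x + t *\<^sub>R e)) has_derivative (\<lambda>h. h *\<^sub>R F' (x + t *\<^sub>R e) e)) (at t within S)" for x t S
  proof -
    have "((\<lambda>t. x + t *\<^sub>R e) has_derivative (\<lambda>h. h *\<^sub>R e)) (at t within S)"
      by (auto intro!: derivative_eq_intros)
    from has_derivative_compose[OF this der]
    have "((\<lambda>t. F (x + t *\<^sub>R e)) has_derivative (\<lambda>h. F' (x + t *\<^sub>R e) (h *\<^sub>R e))) (at t within S)" .
    moreover have "F' (x + t *\<^sub>R e) (h *\<^sub>R e) = h *\<^sub>R F' (x + t *\<^sub>R e) e" for h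
      by (rule linear_scale[OF has_derivative_linear[OF der]])
    ultimately show ?thesis by simp
  qed
  have lip: "cmod (F (x + h *\<^sub>R e) - F x) \<le> B * \<bar>h\<bar>" for x h
  proof -
    have "norm (F (x + h *\<^sub>R e) - F (x + 0 *\<^sub>R e)) \<le> B * norm (h - 0)"
    proof (rule differentiable_bound[of UNIV "\<lambda>t. F (x + t *\<^sub>R e)"])
      show "onorm (\<lambda>h. h *\<^sub>R F' (x + t *\<^sub>R e) e) \<le> B" for t
        using B(2)[of "x + t *\<^sub>R e"] by (intro onorm_le) (auto simp: mult.commute[of B] intro!: mult_left_mono)
    qed (use line in auto)
    then show ?thesis by simp
  qed
  define h where "h n = 1 / (real n + 1)" for n
  have h: "h n > 0" "h n \<le> 1" for n by (auto simp: h_def)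
  have h0: "h \<longlonglongrightarrow> 0"
    unfolding h_def using LIMSEQ_inverse_real_of_nat by (simp add: inverse_eq_divide add.commute)
  define X where "X n x = (F (x + h n *\<^sub>R e) - F x) /\<^sub>R h n" for n x
  \<comment> \<open>The steps have length at most \<open>norm e\<close>, so the supports of all
    difference quotients stay within this enlarged ball.\<close>
  define w where "w x = B * indicator (cball 0 (R + norm e)) x" for x :: 'a
  have "(\<lambda>n. LINT x|lborel. X n x) \<longlonglongrightarrow> (LINT x|lborel. F' x e)"
  proof (rule integral_dominated_convergence[where w = w])
    show "(\<lambda>x. F' x e) \<in> borel_measurable lborel"
      using borel_measurable_continuous_onI[OF cont] by simp
    show "X n \<in> borel_measurable lborel" for n
      unfolding X_def using Fm by simp
    show "integrable lborel w"
      unfolding w_def using emeasure_bounded_finite[OF bounded_cball, of "0 :: 'a" "R + norm e"]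
      by (intro integrable_mult_right integrable_real_indicator) simp_all
    show "AE x in lborel. (\<lambda>n. X n x) \<longlonglongrightarrow> F' x e"
    proof (rule AE_I2)
      fix x
      have "(\<lambda>k. norm (F (x + (0 + k) *\<^sub>R e) - F (x + 0 *\<^sub>R e) - k *\<^sub>R F' (x + 0 *\<^sub>R e) e) / norm k) \<midarrow>0\<rightarrow> 0"
        using line[of x 0 UNIV] unfolding has_derivative_at by blast
      then have "(\<lambda>n. norm (F (x + h n *\<^sub>R e) - F x - h n *\<^sub>R F' x e) / norm (h n)) \<longlonglongrightarrow> 0"
        using h(1) h0 unfolding tendsto_at_iff_sequentially o_def
        by (auto simp: less_imp_neq[symmetric] dest!: spec[of _ h])
      moreover have "norm (F (x + h n *\<^sub>R e) - F x - h n *\<^sub>R F' x e) / norm (h n) = norm (X n x - F' x e)" for n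
      proof -
        have "X n x - F' x e = (F (x + h n *\<^sub>R e) - F x - h n *\<^sub>R F' x e) /\<^sub>R h n"
          unfolding X_def using h(1)[of n] by (simp add: scaleR_diff_right)
        then show ?thesis using h(1)[of n] by (simp add: divide_inverse mult.commute)
      qed
      ultimately have "(\<lambda>n. norm (X n x - F' x e)) \<longlonglongrightarrow> 0" by simp
      then show "(\<lambda>n. X n x) \<longlonglongrightarrow> F' x e"
        by (rule LIM_zero_cancel[OF tendsto_norm_zero_cancel])
    qed
    show "AE x in lborel. norm (X n x) \<le> w x" for n
    proof (rule AE_I2)
      fix x
      show "norm (X n x) \<le> w x"
      proof (cases "x \<in> cball 0 (R + norm e)")
        case True
        have "norm (X n x) \<le> B"
        proof -
          have "norm (X n x) = cmod (F (x + h n *\<^sub>R e) - F x) / h n"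
            using h(1)[of n] by (simp add: X_def divide_inverse mult.commute)
          then show ?thesis
            using lip[of x "h n"] h(1)[of n] by (simp add: pos_divide_le_eq)
        qed
        then show ?thesis using True by (simp add: w_def)
      next
        case False
        then have n: "norm x > R + norm e" by simp
        have "norm x \<le> norm (x + h n *\<^sub>R e) + norm (h n *\<^sub>R e)"
          using norm_triangle_ineq4[of "x + h n *\<^sub>R e" "h n *\<^sub>R e"] by simp
        also have "norm (h n *\<^sub>R e) \<le> norm e"
          using h[of n] by (simp add: mult_left_le_one_le)
        finally have "norm (x + h n *\<^sub>R e) > R" using n by simp
        then have "x + h n *\<^sub>R e \<notin> K" "x \<notin> K"
          using R[of "x + h n *\<^sub>R e"] R[of x] n norm_ge_zero[of e] by linarith+
        then show ?thesis using False K(2) by (simp add: X_def w_def)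
      qed
    qed
  qed
  moreover have "(LINT x|lborel. X n x) = 0" for n
  proof -
    have "integrable lborel (\<lambda>x. F (x + h n *\<^sub>R e))"
    proof (rule continuous_compact_support_integrable[where K = "(\<lambda>x. x - h n *\<^sub>R e) ` K"])
      show "F (x + h n *\<^sub>R e) = 0" if "x \<notin> (\<lambda>x. x - h n *\<^sub>R e) ` K" for x
      proof (rule K(2))
        show "x + h n *\<^sub>R e \<notin> K"
          using that by (metis add_diff_cancel_right' image_eqI)
      qed
    qed (use K(1) in \<open>auto intro!: continuous_on_compose2[OF Fc] compact_continuous_image continuous_intros\<close>)
    then have "(LINT x|lborel. F (x + h n *\<^sub>R e) - F x) = 0"
      using Fi by (simp add: Bochner_Integration.integral_diff lborel_integral_shift[OF Fm])
    then show ?thesis unfolding X_def by simp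
  qed
  ultimately show ?thesis
    by (simp add: LIMSEQ_const_iff)
qed

section \<open>Smooth bump functions\<close>

lemma power_le_fact_exp: "x \<ge> 0 \<Longrightarrow> x ^ n \<le> fact n * exp (x :: real)"
proof -
  assume x: "x \<ge> 0"
  have "(\<Sum>k\<in>{n}. x ^ k /\<^sub>R fact k) \<le> (\<Sum>k. x ^ k /\<^sub>R fact k)"
    using x summable_exp_generic[of x] by (intro sum_le_suminf) auto
  then have "x ^ n / fact n \<le> exp x"
    by (simp add: exp_def divide_inverse mult.commute)
  then show ?thesis by (simp add: field_simps)
qed

text \<open>The standard flat function \<open>exp (- 1 / s)\<close> together with its quotients by
  powers of \<open>s\<close>. The derivative of one member is a linear combination of the next two,
  so the smoothness of the whole family is a single induction.\<close>

definition flat :: "nat \<Rightarrow> real \<Rightarrow> real" where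
  "flat n s = (if s > 0 then exp (- 1 / s) / s ^ n else 0)"

lemma flat_bound: "\<bar>flat n s\<bar> \<le> fact (Suc n) * \<bar>s\<bar>"
proof (cases "s > 0")
  case True
  have "(1 / s) ^ Suc n \<le> fact (Suc n) * exp (1 / s)"
    using True by (intro power_le_fact_exp) auto
  then have "(1 / s) ^ Suc n * exp (- 1 / s) \<le> fact (Suc n) * exp (1 / s) * exp (- 1 / s)"
    by (intro mult_right_mono) auto
  also have "\<dots> = fact (Suc n)"
    by (simp add: mult.assoc flip: exp_add)
  finally have *: "(1 / s) ^ Suc n * exp (- 1 / s) \<le> fact (Suc n)" .
  have "flat n s = (1 / s) ^ Suc n * exp (- 1 / s) * s"
    using True by (simp add: flat_def field_simps)
  also have "\<dots> \<le> fact (Suc n) * s"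
    using True by (intro mult_right_mono *) auto
  finally show ?thesis using True by (simp add: flat_def)
qed (simp add: flat_def mult_nonneg_nonpos del: fact_Suc)

lemma flat_has_derivative:
  "(flat n has_field_derivative flat (n + 2) s - real n * flat (n + 1) s) (at s)"
proof -
  consider "s > 0" | "s < 0" | "s = 0" by linarith
  then show ?thesis
  proof cases
    case 1
    have "((\<lambda>s. exp (- 1 / s) / s ^ n) has_field_derivative flat (n + 2) s - real n * flat (n + 1) s) (at s)"
    proof -
      have "((\<lambda>s. exp (- 1 / s) / s ^ n) has_field_derivative
          (exp (- 1 / s) * (1 / s ^ 2) * s ^ n - exp (- 1 / s) * (real n * s ^ (n - 1))) / (s ^ n * s ^ n)) (at s)"
        using 1 by (auto intro!: derivative_eq_intros simp: power2_eq_square)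
      moreover have "(exp (- 1 / s) * (1 / s ^ 2) * s ^ n - exp (- 1 / s) * (real n * s ^ (n - 1))) / (s ^ n * s ^ n) =
          flat (n + 2) s - real n * flat (n + 1) s"
        using 1 by (cases n) (simp_all add: flat_def field_simps power2_eq_square)
      ultimately show ?thesis by simp
    qed
    then show ?thesis
      by (rule has_field_derivative_transform_within_open[where S = "{0<..}"])
        (use 1 in \<open>auto simp: flat_def\<close>)
  next
    case 2
    have "((\<lambda>_. 0) has_field_derivative 0) (at s)" by simp
    then have "(flat n has_field_derivative 0) (at s)"
      by (rule has_field_derivative_transform_within_open[where S = "{..<0}"])
        (use 2 in \<open>auto simp: flat_def\<close>)
    then show ?thesis using 2 by (simp add: flat_def)
  next
    case 3
    have "(\<lambda>h. flat n h / h) \<midarrow>0\<rightarrow> 0"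
    proof (rule Lim_null_comparison)
      show "\<forall>\<^sub>F h in at 0. norm (flat n h / h) \<le> fact (Suc (Suc n)) * \<bar>h\<bar>"
      proof (rule always_eventually, rule allI)
        fix h :: real
        \<comment> \<open>Division by \<open>h\<close> moves one step up in the family, so
          differentiability at 0 is \<open>flat_bound\<close> for the next index.\<close>
        have "flat n h / h = flat (Suc n) h" by (simp add: flat_def mult.commute)
        then show "norm (flat n h / h) \<le> fact (Suc (Suc n)) * \<bar>h\<bar>"
          using flat_bound[of "Suc n" h] by (simp del: fact_Suc)
      qed
      show "(\<lambda>h :: real. fact (Suc (Suc n)) * \<bar>h\<bar>) \<midarrow>0\<rightarrow> 0"
        by (intro tendsto_mult_right_zero tendsto_rabs_zero tendsto_ident_at)
    qed
    then show ?thesis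
      using 3 by (simp add: has_field_derivative_iff flat_def[of _ 0])
  qed
qed

lemma cont_diff_flat_bump:
  fixes z :: "'a::euclidean_space"
  shows "cont_diff k (\<lambda>x. flat n (r - (x - z) \<bullet> (x - z)))"
proof (induction k arbitrary: n)
  case 0
  have "continuous_on UNIV (flat n)"
    by (rule DERIV_continuous_on[OF has_field_derivative_at_within[OF flat_has_derivative]])
  then show ?case
    by (auto intro!: continuous_on_compose2[of UNIV "flat n"] continuous_intros)
next
  case (Suc k)
  have lin: "cont_diff k (\<lambda>x. - 2 * ((x - z) \<bullet> e))" for e :: 'a
  proof (cases k)
    case (Suc k')
    show ?thesis
      unfolding Suc
      by (rule cont_diff_SucI[where f' = "\<lambda>_ h. - 2 * (h \<bullet> e)"]) (auto intro!: derivative_eq_intros)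
  qed (auto intro!: continuous_intros)
  show ?case
  proof (rule cont_diff_SucI)
    fix x :: 'a
    let ?q = "\<lambda>x. r - (x - z) \<bullet> (x - z)"
    let ?d = "\<lambda>x. flat (n + 2) (?q x) - real n * flat (n + 1) (?q x)"
    have "(?q has_derivative (\<lambda>h. - 2 * ((x - z) \<bullet> h))) (at x)"
      by (auto intro!: derivative_eq_intros simp: inner_commute)
    from has_derivative_compose[OF this flat_has_derivative[unfolded has_field_derivative_def]]
    show "((\<lambda>x. flat n (?q x)) has_derivative (\<lambda>h. ?d x * (- 2 * ((x - z) \<bullet> h)))) (at x)" .
  next
    fix e :: 'a
    have "cont_diff k (\<lambda>x. (flat (n + 2) (r - (x - z) \<bullet> (x - z)) +
        (- real n) * flat (n + 1) (r - (x - z) \<bullet> (x - z))) * (- 2 * ((x - z) \<bullet> e)))"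
      by (intro cont_diff_mult cont_diff_add Suc.IH cont_diff_const lin)
    then show "cont_diff k (\<lambda>x. (flat (n + 2) (r - (x - z) \<bullet> (x - z)) -
        real n * flat (n + 1) (r - (x - z) \<bullet> (x - z))) * (- 2 * ((x - z) \<bullet> e)))"
      by simp
  qed
qed

lemma bump_exists:
  assumes "r > 0"
  obtains f :: "four_vector \<Rightarrow> real"
  where "test_function (\<lambda>x. complex_of_real (f x))" "\<And>x. f x \<ge> 0" "f 0 > 0"
    "\<And>x. norm x \<ge> r \<Longrightarrow> f x = 0"
proof
  let ?f = "\<lambda>x :: four_vector. flat 0 (r\<^sup>2 - (x - 0) \<bullet> (x - 0))"
  have z: "?f x = 0" if "norm x \<ge> r" for x
    using power_mono[OF that, of 2] assms by (simp add: flat_def power2_norm_eq_inner)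
  then show "\<And>x. norm x \<ge> r \<Longrightarrow> ?f x = 0" .
  show "test_function (\<lambda>x. complex_of_real (?f x))"
  proof (rule test_functionI[of _ "cball 0 r"])
    show "cont_diff k (\<lambda>x. complex_of_real (?f x))" for k
      by (intro cont_diff_bounded_linear[OF bounded_linear_of_real] cont_diff_flat_bump)
    show "complex_of_real (?f x) = 0" if "x \<notin> cball 0 r" for x
      using that z[of x] by simp
  qed simp
  show "?f 0 > 0" using assms by (simp add: flat_def)
qed (simp add: flat_def)

section \<open>The energy, and rapid decay of plane wave transforms\<close>

lemma energy_pos: "m > 0 \<Longrightarrow> energy m p > 0"
  by (simp add: energy_def add_nonneg_pos)

lemma energy_ge: "m > 0 \<Longrightarrow> energy m p \<ge> m"
  unfolding energy_def by (rule real_le_rsqrt) simp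

lemma energy_sq: "(energy m p)\<^sup>2 = (norm p)\<^sup>2 + m\<^sup>2"
  by (simp add: energy_def)

lemma norm_less_energy: "m > 0 \<Longrightarrow> norm p < energy m p"
  unfolding energy_def by (rule real_less_rsqrt) simp

lemma energy_le: "m > 0 \<Longrightarrow> energy m p \<le> norm p + m"
  unfolding energy_def by (rule real_le_lsqrt) (auto simp: power2_sum)

lemma continuous_on_energy [continuous_intros]:
  "continuous_on S f \<Longrightarrow> continuous_on S (\<lambda>x. energy m (f x))"
  unfolding energy_def by (intro continuous_intros)

lemma test_function_continuous: "test_function f \<Longrightarrow> continuous_on UNIV f"
  using cont_diff_continuous[of 0 f] by (simp add: test_function_def)

lemma test_function_measurable: "test_function f \<Longrightarrow> f \<in> borel_measurable borel"
  by (intro borel_measurable_continuous_onI test_function_continuous)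

lemma test_function_integrable: "test_function f \<Longrightarrow> integrable lborel f"
  by (rule continuous_compact_support_integrable[of f "supp f"])
    (auto simp: test_function_continuous test_function_support, simp add: test_function_def)

lemma plane_wave_transform_continuous:
  assumes f: "test_function f"
  shows "continuous_on UNIV (plane_wave_transform m s f)"
  unfolding continuous_on_sequentially
proof (intro allI ballI impI)
  fix X :: "nat \<Rightarrow> real ^ 3" and p
  assume X: "(\<forall>n. X n \<in> UNIV) \<and> X \<longlonglongrightarrow> p"
  have meas: "(\<lambda>x. f x * exp (\<i> * of_real (s * mink q x))) \<in> borel_measurable lborel" for q
    using test_function_measurable[OF f]
    by (intro borel_measurable_times) (auto simp: mink_def intro!: borel_measurable_continuous_onI continuous_intros)
  have "(\<lambda>n. plane_wave_transform m s f (X n)) \<longlonglongrightarrow> plane_wave_transform m s f p"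
    unfolding plane_wave_transform_def
  proof (rule integral_dominated_convergence[where w = "\<lambda>x. cmod (f x)"])
    show "integrable lborel (\<lambda>x. cmod (f x))"
      using test_function_integrable[OF f] by simp
    show "AE x in lborel. (\<lambda>n. f x * exp (\<i> * of_real (s * mink (on_shell m (X n)) x))) \<longlonglongrightarrow>
        f x * exp (\<i> * of_real (s * mink (on_shell m p) x))"
      using X unfolding mink_def on_shell_def energy_def by (intro AE_I2) (auto intro!: tendsto_intros)
    show "(\<lambda>x. f x * exp (\<i> * of_real (s * mink (on_shell m p) x))) \<in> borel_measurable lborel"
      "\<And>n. (\<lambda>x. f x * exp (\<i> * of_real (s * mink (on_shell m (X n)) x))) \<in> borel_measurable lborel"
      by (rule meas)+
    show "AE x in lborel. norm (f x * exp (\<i> * of_real (s * mink (on_shell m (X n)) x))) \<le> cmod (f x)" for n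
      by (simp add: norm_mult)
  qed
  then show "(plane_wave_transform m s f \<circ> X) \<longlonglongrightarrow> plane_wave_transform m s f p"
    by (simp add: o_def)
qed

lemma plane_wave_transform_le:
  "cmod (plane_wave_transform m s f p) \<le> (LINT x|lborel. cmod (f x))"
  unfolding plane_wave_transform_def
  by (rule order_trans[OF integral_norm_bound]) (simp add: norm_mult)

text \<open>Integration by parts against the plane wave. Spatial directions are the right ones:
  decay is wanted in the momentum components, and on the shell the energy is a function of
  them.\<close>

lemma plane_wave_transform_derivative:
  assumes f: "test_function f"
  shows "plane_wave_transform m s (\<lambda>x. frechet_derivative f (at x) (axis i 1, 0)) p =
    - \<i> * of_real (s * p $ i) * plane_wave_transform m s f p"
proof -
  let ?e = "(axis i 1, 0) :: four_vector"
  let ?E = "\<lambda>x. exp (\<i> * of_real (s * mink (on_shell m p) x))"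
  let ?D = "\<lambda>x h. f x * (?E x * (\<i> * of_real (s * mink (on_shell m p) h))) + frechet_derivative f (at x) h * ?E x"
  have e: "?e \<in> Basis" by (simp add: Basis_prod_def axis_in_Basis_iff)
  have df: "test_function (\<lambda>x. frechet_derivative f (at x) ?e)"
    by (rule test_function_derivative[OF f e])
  have dE: "(?E has_derivative (\<lambda>h. ?E x * (\<i> * of_real (s * mink (on_shell m p) h)))) (at x)" for x
  proof -
    have "((\<lambda>x. \<i> * complex_of_real (s * mink (on_shell m p) x)) has_derivative
        (\<lambda>h. \<i> * of_real (s * mink (on_shell m p) h))) (at x)"
      unfolding mink_def by (auto intro!: derivative_eq_intros)
    from has_derivative_compose[OF this DERIV_exp[THEN has_field_derivative_imp_has_derivative]]
    show ?thesis .
  qed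
  have cE: "continuous_on UNIV ?E"
    unfolding mink_def by (intro continuous_intros)
  have me: "mink (on_shell m p) ?e = p $ i"
    by (simp add: mink_def on_shell_def inner_axis)
  have "(LINT x|lborel. ?D x ?e) = 0"
  proof (rule integral_directional_derivative_eq_0[where K = "supp f" and F = "\<lambda>x. f x * ?E x" and F' = ?D and e = ?e])
    show "((\<lambda>x. f x * ?E x) has_derivative ?D x) (at x)" for x
      by (rule has_derivative_mult[OF test_function_has_derivative[OF f] dE])
    show "continuous_on UNIV (\<lambda>x. ?D x ?e)"
      by (intro continuous_on_add continuous_on_mult continuous_on_const cE test_function_continuous f df)
    show "compact (supp f)" using f by (simp add: test_function_def)
    show "f x * ?E x = 0" if "x \<notin> supp f" for x
      using that by (simp add: test_function_support)
    show "?D x ?e = 0" if "x \<notin> supp f" for x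
    proof -
      have "((\<lambda>_. 0) has_derivative (\<lambda>_. 0)) (at x)" by simp
      then have "(f has_derivative (\<lambda>_. 0)) (at x)"
      proof (rule has_derivative_transform_within_open)
        show "open (- supp f)" unfolding supp_def by (simp add: open_Compl)
        show "0 = f y" if "y \<in> - supp f" for y
          using that test_function_support[of y f] by simp
      qed (use that in auto)
      then have "frechet_derivative f (at x) = (\<lambda>_. 0)" by (rule frechet_eqI)
      then show ?thesis using that by (simp add: test_function_support)
    qed
  qed
  moreover have "?D x ?e = (\<i> * of_real (s * p $ i)) * (f x * ?E x) + frechet_derivative f (at x) ?e * ?E x" for x
    unfolding me by (simp add: mult_ac)
  moreover have int: "integrable lborel (\<lambda>x. g x * ?E x)" if "test_function g" for g
    using that continuous_on_mult[OF test_function_continuous[OF that] cE]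
    by (intro continuous_compact_support_integrable[of _ "supp g"])
      (auto simp: test_function_support, simp add: test_function_def)
  ultimately have "(\<i> * of_real (s * p $ i)) * plane_wave_transform m s f p +
      plane_wave_transform m s (\<lambda>x. frechet_derivative f (at x) ?e) p = 0"
    unfolding plane_wave_transform_def using int[OF f] int[OF df]
    by (simp add: Bochner_Integration.integral_add del: of_real_mult)
  then show ?thesis by (simp add: add_eq_0_iff2)
qed

text \<open>A factor \<open>norm p\<close> is at most the sum of the
  \<open>\<bar>p $ i\<bar>\<close>, and each component is traded for a derivative of the test
  function. The induction runs over all test functions, since it passes from \<open>f\<close> to its
  derivatives.\<close>

lemma rapid_plane_wave_transform:
  assumes f: "test_function f" and s: "\<bar>s\<bar> = 1"
  shows "rapid (plane_wave_transform m s f)"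
proof -
  have "\<exists>C. \<forall>p. (1 + norm p) ^ N * cmod (plane_wave_transform m s f p) \<le> C" for N
    using f
  proof (induction N arbitrary: f)
    case 0
    show ?case using plane_wave_transform_le[of m s f] by auto
  next
    case (Suc N)
    let ?d = "\<lambda>i x. frechet_derivative f (at x) (axis i 1, 0)"
    have d: "test_function (?d i)" for i
      by (rule test_function_derivative[OF Suc.prems]) (simp add: Basis_prod_def axis_in_Basis_iff)
    obtain C where C: "\<And>p. (1 + norm p) ^ N * cmod (plane_wave_transform m s f p) \<le> C"
      using Suc.IH[OF Suc.prems] by blast
    obtain D where D: "\<And>i p. (1 + norm p) ^ N * cmod (plane_wave_transform m s (?d i) p) \<le> D i"
      using Suc.IH[OF d] by metis
    have "(1 + norm p) ^ Suc N * cmod (plane_wave_transform m s f p) \<le> C + (\<Sum>i\<in>UNIV. D i)" for p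
    proof -
      let ?P = "cmod (plane_wave_transform m s f p)"
      have "norm p * ?P \<le> (\<Sum>i\<in>UNIV. \<bar>p $ i\<bar>) * ?P"
        by (intro mult_right_mono norm_le_l1_cart) auto
      also have "\<dots> = (\<Sum>i\<in>UNIV. cmod (plane_wave_transform m s (?d i) p))"
        unfolding sum_distrib_right
        by (intro sum.cong refl, subst plane_wave_transform_derivative[OF Suc.prems])
          (simp add: norm_mult abs_mult s)
      finally have *: "norm p * ?P \<le> (\<Sum>i\<in>UNIV. cmod (plane_wave_transform m s (?d i) p))" .
      have "(1 + norm p) ^ Suc N * ?P = (1 + norm p) ^ N * ?P + (1 + norm p) ^ N * (norm p * ?P)"
        by (simp add: algebra_simps)
      also have "\<dots> \<le> C + (1 + norm p) ^ N * (\<Sum>i\<in>UNIV. cmod (plane_wave_transform m s (?d i) p))"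
        by (intro add_mono C mult_left_mono *) auto
      also have "\<dots> \<le> C + (\<Sum>i\<in>UNIV. D i)"
        unfolding sum_distrib_left by (intro add_left_mono sum_mono D)
      finally show ?thesis .
    qed
    then show ?case by blast
  qed
  then show ?thesis
    unfolding rapid_def using plane_wave_transform_continuous[OF f] by blast
qed

lemma test_function_shift:
  assumes f: "test_function f"
  shows "test_function (\<lambda>x. f (x - a))"
proof (rule test_functionI[of _ "(\<lambda>x. x + a) ` supp f"])
  show "cont_diff k (\<lambda>x. f (x - a))" for k
    using f by (intro cont_diff_shift) (simp add: test_function_def)
  show "compact ((\<lambda>x. x + a) ` supp f)"
    using f by (intro compact_continuous_image continuous_intros) (simp add: test_function_def)
  show "f (x - a) = 0" if "x \<notin> (\<lambda>x. x + a) ` supp f" for x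
  proof (rule test_function_support)
    show "x - a \<notin> supp f"
      using that by (metis diff_add_cancel image_eqI)
  qed
qed

lemma plane_wave_transform_shift:
  assumes f: "test_function f"
  shows "plane_wave_transform m s (\<lambda>x. f (x - a)) p =
    exp (\<i> * of_real (s * mink (on_shell m p) a)) * plane_wave_transform m s f p"
proof -
  let ?E = "\<lambda>x. exp (\<i> * of_real (s * mink (on_shell m p) x))"
  have "(\<lambda>x. f (x - a) * ?E x) \<in> borel_measurable borel"
    using test_function_continuous[OF test_function_shift[OF f], of a]
    by (intro borel_measurable_continuous_onI continuous_intros) (auto simp: mink_def intro!: continuous_intros)
  from lborel_integral_shift[OF this, of a]
  have "(LINT x|lborel. f (x - a) * ?E x) = (LINT x|lborel. f x * ?E (x + a))" by simp
  also have "\<dots> = (LINT x|lborel. ?E a * (f x * ?E x))"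
  proof (rule Bochner_Integration.integral_cong)
    fix x
    have "mink q (x + a) = mink q x + mink q a" for q
      by (simp add: mink_def inner_add_right algebra_simps)
    then have "?E (x + a) = ?E a * ?E x"
      by (simp add: exp_add[symmetric] algebra_simps)
    then show "f x * ?E (x + a) = ?E a * (f x * ?E x)" by simp
  qed simp
  also have "\<dots> = ?E a * (LINT x|lborel. f x * ?E x)" by (rule integral_mult_right_zero)
  finally show ?thesis by (simp add: plane_wave_transform_def)
qed

section \<open>Spin representations\<close>

definition spin_poly :: "nat \<Rightarrow> complex ^ 2 ^ 2 \<Rightarrow> nat \<Rightarrow> complex poly" where
  "spin_poly n M k = [:M $ 1 $ 1, M $ 2 $ 1:] ^ (n - k) * [:M $ 1 $ 2, M $ 2 $ 2:] ^ k"

text \<open>Undoes the normalisation of the first basis vector to 1: \<open>p\<close> is read as a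
  form of degree \<open>n\<close>, and \<open>u\<close>, \<open>v\<close> are substituted for its
  two variables. Composition of matrices becomes such a substitution.\<close>

definition homogenise :: "nat \<Rightarrow> complex poly \<Rightarrow> complex poly \<Rightarrow> complex poly \<Rightarrow> complex poly" where
  "homogenise n p u v = (\<Sum>i\<le>n. smult (coeff p i) (u ^ (n - i) * v ^ i))"

lemma homogenise_linear_mult:
  assumes "degree p \<le> n"
  shows "homogenise (Suc n) ([:a, b:] * p) u v = (smult a u + smult b v) * homogenise n p u v"
proof -
  have c: "coeff ([:a, b:] * p) i = a * coeff p i + (case i of 0 \<Rightarrow> 0 | Suc j \<Rightarrow> b * coeff p j)" for i
    by (cases i) simp_all
  have "homogenise (Suc n) ([:a, b:] * p) u v =
      (\<Sum>i\<le>Suc n. smult (a * coeff p i) (u ^ (Suc n - i) * v ^ i)) +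
      (\<Sum>i\<le>Suc n. smult (case i of 0 \<Rightarrow> 0 | Suc j \<Rightarrow> b * coeff p j) (u ^ (Suc n - i) * v ^ i))"
    unfolding homogenise_def c smult_add_left sum.distrib ..
  also have "(\<Sum>i\<le>Suc n. smult (a * coeff p i) (u ^ (Suc n - i) * v ^ i)) =
      (\<Sum>i\<le>n. smult (a * coeff p i) (u ^ (Suc n - i) * v ^ i))"
    using coeff_eq_0[of p "Suc n"] assms by simp
  also have "\<dots> = smult a u * homogenise n p u v"
    unfolding homogenise_def sum_distrib_left
    by (intro sum.cong refl) (simp add: Suc_diff_le mult_ac)
  also have "(\<Sum>i\<le>Suc n. smult (case i of 0 \<Rightarrow> 0 | Suc j \<Rightarrow> b * coeff p j) (u ^ (Suc n - i) * v ^ i)) =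
      smult b v * homogenise n p u v"
    unfolding homogenise_def sum_distrib_left sum.atMost_Suc_shift
    by (simp add: mult_ac)
  finally show ?thesis by (simp add: distrib_right)
qed

lemma degree_linear_power: "degree ([:a, b:] ^ k) \<le> (k :: nat)"
  using degree_power_le[of "[:a, b:]" k] by (simp split: if_splits)

lemma homogenise_powers:
  "homogenise (k + l) ([:a, b:] ^ k * [:c, d:] ^ l) u v =
    (smult a u + smult b v) ^ k * (smult c u + smult d v) ^ l"
proof (induction k)
  case 0
  show ?case
  proof (induction l)
    case (Suc l)
    have "homogenise (Suc l) ([:c, d:] * [:c, d:] ^ l) u v =
        (smult c u + smult d v) * homogenise l ([:c, d:] ^ l) u v"
      by (rule homogenise_linear_mult) (rule degree_linear_power)
    then show ?case using Suc by simp
  qed (simp add: homogenise_def)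
next
  case (Suc k)
  have "degree ([:a, b:] ^ k * [:c, d:] ^ l) \<le> k + l"
    by (rule order_trans[OF degree_mult_le]) (intro add_mono degree_linear_power)
  from homogenise_linear_mult[OF this, of a b u v] show ?case
    by (simp only: power_Suc add_Suc mult.assoc Suc)
qed

text \<open>Functoriality of the symmetric power: the columns of \<open>M ** N\<close> are
  combinations of the columns of \<open>M\<close> with coefficients from \<open>N\<close>, so its
  polynomial arises by substituting the linear forms of \<open>M\<close> into the form of
  \<open>N\<close>.\<close>

lemma spin_poly_mult:
  assumes "k \<le> n"
  shows "spin_poly n (M ** N) k = (\<Sum>i\<le>n. smult (coeff (spin_poly n N k) i) (spin_poly n M i))"
proof -
  have 1: "[:(M ** N) $ 1 $ j, (M ** N) $ 2 $ j:] =
      smult (N $ 1 $ j) [:M $ 1 $ 1, M $ 2 $ 1:] + smult (N $ 2 $ j) [:M $ 1 $ 2, M $ 2 $ 2:]" for j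
    by (simp add: matrix_matrix_mult_def sum_2 mult.commute)
  show ?thesis
    using homogenise_powers[of "n - k" k "N $ 1 $ 1" "N $ 2 $ 1" "N $ 1 $ 2" "N $ 2 $ 2"
        "[:M $ 1 $ 1, M $ 2 $ 1:]" "[:M $ 1 $ 2, M $ 2 $ 2:]"] assms
    unfolding spin_poly_def[of n "M ** N"] 1 by (simp add: homogenise_def spin_poly_def)
qed

lemma spin_rep_eq:
  "spin_rep n M i k = of_real (sqrt (n choose k) / sqrt (n choose i)) * coeff (spin_poly n M k) i"
  unfolding spin_rep_def spin_poly_def by (simp add: real_sqrt_divide)

lemma spin_rep_mult:
  assumes "k \<le> n"
  shows "spin_rep n (M ** N) i k = (\<Sum>l\<le>n. spin_rep n M i l * spin_rep n N l k)"
proof -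
  have "spin_rep n (M ** N) i k =
      (\<Sum>l\<le>n. of_real (sqrt (n choose k) / sqrt (n choose i)) *
        (coeff (spin_poly n N k) l * coeff (spin_poly n M l) i))"
    unfolding spin_rep_eq spin_poly_mult[OF assms] by (simp add: coeff_sum sum_distrib_left)
  also have "\<dots> = (\<Sum>l\<le>n. spin_rep n M i l * spin_rep n N l k)"
    unfolding spin_rep_eq by (intro sum.cong refl) (simp add: field_simps)
  finally show ?thesis .
qed

lemma spin_rep_mat_1: "k \<le> n \<Longrightarrow> spin_rep n (mat 1) i k = (if i = k then 1 else 0)"
proof -
  assume "k \<le> n"
  have "[:0, 1 :: complex:] ^ k = monom 1 k"
    by (simp add: monom_altdef)
  then show ?thesis
    using \<open>k \<le> n\<close> by (simp add: spin_rep_def mat_def flip: one_pCons)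
qed

text \<open>Homogeneity of degree \<open>n\<close> in the matrix; the resulting sign becomes the
  parity of the Gram matrix.\<close>

lemma spin_rep_uminus:
  assumes "k \<le> n"
  shows "spin_rep n (- M) i k = (- 1) ^ n * spin_rep n M i k"
proof -
  have *: "[:- a, - b:] = - [:a, b :: complex:]" for a b by simp
  have "spin_poly n (- M) k = (- 1) ^ (n - k) * (- 1) ^ k * spin_poly n M k"
    unfolding spin_poly_def vector_uminus_component * power_minus[of "[:_, _:]"] by (simp only: mult_ac)
  also have "(- 1) ^ (n - k) * (- 1) ^ k = ((- 1) ^ n :: complex poly)"
    using assms by (simp flip: power_add)
  finally show ?thesis by (cases "even n") (simp_all add: spin_rep_eq)
qed

text \<open>Two expansions of the generating function ((a + b x) + y (c + d x))^n: powers of y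
  collect the columns of \<open>dagger M\<close> up to conjugation, powers of x those of
  \<open>M\<close>. Comparing the coefficients of x^i y^k leaves a ratio of binomial coefficients,
  which the square roots in \<open>spin_rep\<close> are made to absorb.\<close>

lemma spin_rep_dagger:
  assumes i: "i \<le> n" and k: "k \<le> n"
  shows "spin_rep n (dagger M) i k = cnj (spin_rep n M k i)"
proof -
  define a b c d where "a = M $ 1 $ 1" "b = M $ 1 $ 2" "c = M $ 2 $ 1" "d = M $ 2 $ 2"
  note M = this
  let ?p = "\<lambda>k. [:a, b:] ^ (n - k) * [:c, d:] ^ k" and ?q = "\<lambda>i. [:a, c:] ^ (n - i) * [:b, d:] ^ i"
  have gen: "(\<Sum>k\<le>n. smult (of_nat (n choose k) * y ^ k) (?p k)) =
      (\<Sum>i\<le>n. monom (of_nat (n choose i) * poly (?q i) y) i)" for y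
  proof -
    have "(\<Sum>k\<le>n. smult (of_nat (n choose k) * y ^ k) (?p k)) = (smult y [:c, d:] + [:a, b:]) ^ n"
      unfolding binomial_ring
      by (intro sum.cong refl) (simp add: smult_power of_nat_poly mult_ac del: smult_pCons)
    also have "smult y [:c, d:] + [:a, b:] = monom (b + y * d) 1 + [:a + y * c:]"
      by (simp add: monom_altdef add_ac)
    also have "\<dots> ^ n = (\<Sum>i\<le>n. monom (of_nat (n choose i) * poly (?q i) y) i)"
      unfolding binomial_ring
      by (intro sum.cong refl)
        (simp add: monom_power of_nat_poly poly_power mult_ac smult_monom poly_const_pow)
    finally show ?thesis .
  qed
  have co: "of_nat (n choose k) * coeff (?p k) i = of_nat (n choose i) * coeff (?q i) k"
  proof -
    have "(\<Sum>k\<le>n. (of_nat (n choose k) * coeff (?p k) i) * y ^ k) =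
        (\<Sum>k\<le>n. (of_nat (n choose i) * coeff (?q i) k) * y ^ k)" for y
    proof -
      have "(\<Sum>k\<le>n. (of_nat (n choose k) * coeff (?p k) i) * y ^ k) =
          coeff (\<Sum>k\<le>n. smult (of_nat (n choose k) * y ^ k) (?p k)) i"
        by (simp add: coeff_sum mult_ac)
      also have "\<dots> = of_nat (n choose i) * poly (?q i) y"
        unfolding gen coeff_sum coeff_monom using i by simp
      also have "poly (?q i) y = (\<Sum>k\<le>n. coeff (?q i) k * y ^ k)"
      proof -
        have "degree (?q i) \<le> n"
          using i by (intro order_trans[OF degree_mult_le])
            (metis add_mono degree_linear_power le_add_diff_inverse2)
        from arg_cong[OF poly_as_sum_of_monoms'[OF this], of "\<lambda>p. poly p y"] show ?thesis
          by (simp add: poly_sum poly_monom)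
      qed
      finally show ?thesis by (simp add: sum_distrib_left mult.assoc)
    qed
    then show ?thesis
      using polyfun_eq_coeffs[of "\<lambda>k. of_nat (n choose k) * coeff (?p k) i" n
          "\<lambda>k. of_nat (n choose i) * coeff (?q i) k"] k by blast
  qed
  have cp: "coeff (spin_poly n (dagger M) k) i = cnj (coeff (?p k) i)"
  proof -
    have cm: "map_poly cnj (p * q) = map_poly cnj p * map_poly cnj q" for p q
      by (intro poly_eqI) (simp add: coeff_map_poly coeff_mult cnj_sum)
    have cpow: "map_poly cnj (p ^ l) = map_poly cnj p ^ l" for p l
      by (induction l) (simp_all add: cm)
    have "spin_poly n (dagger M) k = map_poly cnj (?p k)"
      unfolding spin_poly_def cm cpow by (simp add: dagger_def M map_poly_pCons)
    then show ?thesis by (simp add: coeff_map_poly)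
  qed
  have cq: "spin_poly n M i = ?q i" by (simp add: spin_poly_def M)
  define C where "C k = sqrt (real (n choose k))" for k
  have C: "C k > 0" "C i > 0" "real (n choose k) = C k * C k" "real (n choose i) = C i * C i"
    using i k by (simp_all add: C_def)
  have "complex_of_real (C k / C i) * coeff (?p k) i = of_real (C i / C k) * coeff (?q i) k"
  proof -
    have "complex_of_real (C k * C k) * coeff (?p k) i = of_real (C i * C i) * coeff (?q i) k"
      using co unfolding C(3,4)[symmetric] by simp
    moreover have "complex_of_real (C k) \<noteq> 0" "complex_of_real (C i) \<noteq> 0" using C by auto
    ultimately show ?thesis by (simp add: field_simps)
  qed
  then have "cnj (complex_of_real (C k / C i) * coeff (?p k) i) = cnj (of_real (C i / C k) * coeff (?q i) k)"
    by (rule arg_cong)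
  then show ?thesis
    unfolding spin_rep_eq cp cq C_def by simp
qed

text \<open>The entries of \<open>spin_rep\<close> are polynomials in the matrix entries, so they
  inherit membership in any such class. One lemma thus serves entire functions of an angle, tempered
  functions of the momentum, and functions affine in the energy on the mass shell.\<close>

definition function_algebra :: "('x \<Rightarrow> complex) set \<Rightarrow> bool" where
  "function_algebra F \<longleftrightarrow> (\<forall>c. (\<lambda>_. c) \<in> F) \<and>
     (\<forall>f\<in>F. \<forall>g\<in>F. (\<lambda>x. f x + g x) \<in> F \<and> (\<lambda>x. f x * g x) \<in> F)"

lemma function_algebra_sum:
  assumes "function_algebra F" "\<And>i. i \<in> I \<Longrightarrow> f i \<in> F"
  shows "(\<lambda>x. \<Sum>i\<in>I. f i x) \<in> F"
  using assms(2)
proof (induction I rule: infinite_finite_induct)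
  case (insert i I)
  then show ?case using assms(1) by (simp add: function_algebra_def)
qed (use assms(1) in \<open>auto simp: function_algebra_def\<close>)

lemma spin_rep_in_function_algebra:
  fixes M :: "'x \<Rightarrow> complex ^ 2 ^ 2"
  assumes F: "function_algebra F" and M: "\<And>i j. (\<lambda>x. M x $ i $ j) \<in> F"
  shows "(\<lambda>x. spin_rep n (M x) i k) \<in> F"
proof -
  define P where "P p \<longleftrightarrow> (\<forall>i. (\<lambda>x. coeff (p x) i) \<in> F)" for p :: "'x \<Rightarrow> complex poly"
  have const: "(\<lambda>_. c) \<in> F" for c using F by (simp add: function_algebra_def)
  have mult: "f \<in> F \<Longrightarrow> g \<in> F \<Longrightarrow> (\<lambda>x. f x * g x) \<in> F" for f g using F by (simp add: function_algebra_def)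
  have lin: "P (\<lambda>x. [:f x, g x:])" if "f \<in> F" "g \<in> F" for f g
    unfolding P_def
  proof
    fix i show "(\<lambda>x. coeff [:f x, g x:] i) \<in> F"
    proof (cases i)
      case (Suc j)
      then show ?thesis using that const[of 0] by (cases j) simp_all
    qed (use that in simp)
  qed
  have times: "P (\<lambda>x. p x * q x)" if "P p" "P q" for p q
    unfolding P_def coeff_mult
    by (intro allI function_algebra_sum[OF F] mult) (use that in \<open>auto simp: P_def\<close>)
  have pow: "P (\<lambda>x. p x ^ l)" if "P p" for p l
  proof (induction l)
    case 0
    show ?case unfolding P_def by (auto simp: const)
  qed (auto intro: times that)
  have "P (\<lambda>x. [:M x $ 1 $ 1, M x $ 2 $ 1:] ^ (n - k) * [:M x $ 1 $ 2, M x $ 2 $ 2:] ^ k)"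
    by (intro times pow lin M)
  then show ?thesis
    unfolding spin_rep_def by (intro mult const) (simp add: P_def)
qed

section \<open>Boosts\<close>

definition cvec :: "real ^ 3 \<Rightarrow> complex ^ 3" where
  "cvec p = (\<chi> i. of_real (p $ i))"

text \<open>\<open>herm_of\<close> for complex momenta: the matrix $e - \mathbf{q}\cdot\sigma$.\<close>

definition cherm :: "complex ^ 3 \<Rightarrow> complex \<Rightarrow> complex ^ 2 ^ 2" where
  "cherm q e = vector [vector [e - q $ 3, - (q $ 1 - \<i> * q $ 2)], vector [- (q $ 1 + \<i> * q $ 2), e + q $ 3]]"

lemma cherm_entries [simp]:
  "cherm q e $ 1 $ 1 = e - q $ 3" "cherm q e $ 1 $ 2 = - (q $ 1 - \<i> * q $ 2)"
  "cherm q e $ 2 $ 1 = - (q $ 1 + \<i> * q $ 2)" "cherm q e $ 2 $ 2 = e + q $ 3"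
  by (simp_all add: cherm_def)

lemma cvec_component [simp]: "cvec p $ i = of_real (p $ i)"
  by (simp add: cvec_def)

lemma cvec_uminus: "cvec (- p) = - cvec p"
  by (simp add: vec_eq_iff)

lemma herm_of_eq_cherm: "herm_of (p, e) = cherm (cvec p) (of_real e)"
  by (simp add: vec_eq_iff forall_2 herm_of_def sum_3 pauli_def mat_def)
    (simp add: scaleR_conv_of_real)

lemma dagger_cherm: "dagger (cherm q e) = cherm (\<chi> i. cnj (q $ i)) (cnj e)"
  by (simp add: vec_eq_iff forall_2 dagger_def)

lemma dagger_cherm_real: "dagger (cherm (cvec p) (of_real e)) = cherm (cvec p) (of_real e)"
  by (simp add: vec_eq_iff forall_2 dagger_def)

lemma det_cherm: "det (cherm q e) = e\<^sup>2 - (\<Sum>i\<in>UNIV. (q $ i)\<^sup>2)"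
  by (simp add: det_2 sum_3 power2_eq_square algebra_simps)

text \<open>\<open>cherm (- q) e\<close> is the adjugate of \<open>cherm q e\<close>, so at
  determinant 1 reversing the momentum inverts the matrix.\<close>

lemma cherm_mult_uminus:
  "cherm q e ** cherm (- q) e = mat (e\<^sup>2 - (\<Sum>i\<in>UNIV. (q $ i)\<^sup>2))"
  by (simp add: vec_eq_iff forall_2 matrix_matrix_mult_def sum_2 sum_3 mat_def power2_eq_square algebra_simps)

lemma cherm_square:
  "cherm q e ** cherm q e = cherm (\<chi> i. 2 * e * q $ i) (e\<^sup>2 + (\<Sum>i\<in>UNIV. (q $ i)\<^sup>2))"
  by (simp add: vec_eq_iff forall_2 matrix_matrix_mult_def sum_2 sum_3 power2_eq_square algebra_simps)

lemma norm_sq_vec3: "(norm (p :: real ^ 3))\<^sup>2 = (\<Sum>i\<in>UNIV. (p $ i)\<^sup>2)"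
  unfolding power2_norm_eq_inner inner_vec_def by (simp add: power2_eq_square)

lemma sum_cvec_sq: "(\<Sum>i\<in>UNIV. (cvec p $ i)\<^sup>2) = of_real ((norm p)\<^sup>2)"
  by (simp add: norm_sq_vec3)

lemma dagger_mult: "dagger (M ** N) = dagger N ** dagger M"
  by (simp add: vec_eq_iff forall_2 matrix_matrix_mult_def sum_2 dagger_def mult.commute)

lemma dagger_dagger: "dagger (dagger M) = M"
  by (simp add: dagger_def vec_eq_iff)

lemma inj_herm_of: "herm_of p = herm_of q \<Longrightarrow> p = q"
proof -
  assume h: "herm_of p = herm_of q"
  obtain a e b f where pq: "p = (a, e)" "q = (b, f)" by (cases p, cases q)
  have "complex_of_real (e - a $ 3) = of_real (f - b $ 3)" "complex_of_real (e + a $ 3) = of_real (f + b $ 3)"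
    using arg_cong[OF h, of "\<lambda>M. M $ 1 $ 1"] arg_cong[OF h, of "\<lambda>M. M $ 2 $ 2"]
    unfolding pq herm_of_eq_cherm by simp_all
  then have 1: "e - a $ 3 = f - b $ 3" "e + a $ 3 = f + b $ 3"
    unfolding of_real_eq_iff by simp_all
  have "a $ 1 = b $ 1 \<and> a $ 2 = b $ 2"
    using arg_cong[OF h, of "\<lambda>M. M $ 1 $ 2"]
    unfolding pq herm_of_eq_cherm by (simp add: complex_eq_iff)
  with 1 show ?thesis
    unfolding pq by (simp add: vec_eq_iff forall_3)
qed

lemma herm_of_exists:
  assumes "dagger M = M"
  shows "\<exists>q. herm_of q = M"
proof -
  have M: "cnj (M $ j $ i) = M $ i $ j" for i j
    using arg_cong[OF assms, of "\<lambda>M. M $ i $ j"] by (simp add: dagger_def)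
  let ?p = "vector [- Re (M $ 1 $ 2), Im (M $ 1 $ 2), (Re (M $ 2 $ 2) - Re (M $ 1 $ 1)) / 2] :: real ^ 3"
  have "herm_of (?p, (Re (M $ 1 $ 1) + Re (M $ 2 $ 2)) / 2) = M"
    unfolding herm_of_eq_cherm
    using M[of 1 1] M[of 2 2] M[of 1 2]
    by (simp add: vec_eq_iff forall_2 complex_eq_iff vector_3) (auto simp: field_simps)
  then show ?thesis by blast
qed

text \<open>The right-hand side is Hermitian, and four-vectors correspond bijectively to Hermitian
  matrices, so the definite description in \<open>lorentz\<close> denotes.\<close>

lemma herm_of_lorentz: "herm_of (lorentz \<Lambda> p) = \<Lambda> ** herm_of p ** dagger \<Lambda>"
proof -
  have "dagger (herm_of p) = herm_of p"
    by (cases p) (simp add: herm_of_eq_cherm dagger_cherm_real)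
  then have "dagger (\<Lambda> ** herm_of p ** dagger \<Lambda>) = \<Lambda> ** herm_of p ** dagger \<Lambda>"
    by (simp add: dagger_mult dagger_dagger matrix_mul_assoc)
  then obtain q where "herm_of q = \<Lambda> ** herm_of p ** dagger \<Lambda>"
    using herm_of_exists by blast
  then show ?thesis
    unfolding lorentz_def by (rule theI) (metis inj_herm_of \<open>herm_of q = \<Lambda> ** herm_of p ** dagger \<Lambda>\<close>)
qed

lemma pos_def_herm_diagonal:
  assumes "pos_def_herm M"
  shows "\<exists>a>0. M $ i $ i = of_real a"
proof -
  have "cnj (M $ i $ i) = M $ i $ i"
  proof -
    have "dagger M = M" using assms by (simp only: pos_def_herm_def)
    from arg_cong[OF this, of "\<lambda>M. M $ i $ i"] show ?thesis by (simp add: dagger_def)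
  qed
  then have re: "M $ i $ i = of_real (Re (M $ i $ i))"
    by (simp add: complex_eq_iff)
  have "Re (\<Sum>k\<in>UNIV. cnj (axis i 1 $ k) * (M *v axis i 1) $ k) > 0"
    using assms unfolding pos_def_herm_def by (metis axis_eq_0_iff one_neq_zero)
  also have "(\<Sum>k\<in>UNIV. cnj (axis i 1 $ k) * (M *v axis i 1) $ k) = M $ i $ i"
    using exhaust_2[of i] by (auto simp: axis_def matrix_vector_mult_def sum_2)
  finally show ?thesis using re by blast
qed

text \<open>Cayley-Hamilton at determinant 1 reads M tr(M) = M^2 + 1, so the square determines the
  matrix once the trace is known. Its trace gives tr(M)^2 = tr(M^2) + 2, and positivity selects the
  root.\<close>

lemma pos_def_herm_square_root_unique:
  assumes L: "L \<in> SL2C" "pos_def_herm L" and K: "K \<in> SL2C" "pos_def_herm K"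
    and eq: "L ** L = K ** K"
  shows "L = K"
proof -
  have ch: "M $ 1 $ 1 * (M $ 1 $ 1 + M $ 2 $ 2) = (M ** M) $ 1 $ 1 + 1"
    "M $ 1 $ 2 * (M $ 1 $ 1 + M $ 2 $ 2) = (M ** M) $ 1 $ 2"
    "M $ 2 $ 1 * (M $ 1 $ 1 + M $ 2 $ 2) = (M ** M) $ 2 $ 1"
    "M $ 2 $ 2 * (M $ 1 $ 1 + M $ 2 $ 2) = (M ** M) $ 2 $ 2 + 1" if "M \<in> SL2C" for M
    using that by (simp_all add: SL2C_def det_2 matrix_matrix_mult_def sum_2 algebra_simps)
  obtain a d where a: "a > 0" "d > 0" "L $ 1 $ 1 = of_real a" "L $ 2 $ 2 = of_real d"
    using pos_def_herm_diagonal[OF L(2)] by metis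
  obtain a' d' where a': "a' > 0" "d' > 0" "K $ 1 $ 1 = of_real a'" "K $ 2 $ 2 = of_real d'"
    using pos_def_herm_diagonal[OF K(2)] by metis
  have tr: "complex_of_real ((x + y)\<^sup>2) = (M ** M) $ 1 $ 1 + (M ** M) $ 2 $ 2 + 2"
    if "M \<in> SL2C" "M $ 1 $ 1 = of_real x" "M $ 2 $ 2 = of_real y" for M x y
  proof -
    have "complex_of_real ((x + y)\<^sup>2) = M $ 1 $ 1 * (M $ 1 $ 1 + M $ 2 $ 2) + M $ 2 $ 2 * (M $ 1 $ 1 + M $ 2 $ 2)"
      by (simp add: that(2,3) power2_eq_square algebra_simps)
    then show ?thesis unfolding ch(1,4)[OF that(1)] by simp
  qed
  have "complex_of_real ((a + d)\<^sup>2) = of_real ((a' + d')\<^sup>2)"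
    unfolding tr[OF L(1) a(3,4)] tr[OF K(1) a'(3,4)] eq ..
  then have "(a + d)\<^sup>2 = (a' + d')\<^sup>2"
    by (simp only: of_real_eq_iff)
  then have "a + d = a' + d'"
    using a a' by (simp add: power2_eq_iff_nonneg)
  then have t: "L $ 1 $ 1 + L $ 2 $ 2 = K $ 1 $ 1 + K $ 2 $ 2"
    unfolding a a' by (simp flip: of_real_add)
  have nz: "K $ 1 $ 1 + K $ 2 $ 2 \<noteq> 0"
    unfolding a' using a'(1,2) by (simp flip: of_real_add)
  have "L $ i $ k * (K $ 1 $ 1 + K $ 2 $ 2) = K $ i $ k * (K $ 1 $ 1 + K $ 2 $ 2)" for i k
  proof -
    have "i = 1 \<or> i = 2" "k = 1 \<or> k = 2" using exhaust_2 by blast+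
    then show ?thesis
      using ch[OF L(1)] ch[OF K(1)] unfolding t eq by (elim disjE) (simp_all only:)
  qed
  then show ?thesis
    using nz by (simp add: vec_eq_iff)
qed

text \<open>The normalised sum of the rest momentum \<open>(0, m)\<close> and the shell momentum
  \<open>(p, energy m p)\<close>: the unit vector halfway between their directions on the
  hyperboloid. The radicand is the squared time component of that sum minus its squared spatial
  norm. The matrix of this vector turns out to be the boost.\<close>

definition half_boost :: "real \<Rightarrow> real ^ 3 \<Rightarrow> four_vector" where
  "half_boost m p = (p /\<^sub>R sqrt (2 * m * (m + energy m p)), (m + energy m p) / sqrt (2 * m * (m + energy m p)))"

lemma half_boost_norm:
  assumes "m > 0"
  shows "(snd (half_boost m p))\<^sup>2 - (norm (fst (half_boost m p)))\<^sup>2 = 1"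
    "snd (half_boost m p) > 0"
proof -
  let ?E = "energy m p"
  have E: "?E > 0" "?E\<^sup>2 = (norm p)\<^sup>2 + m\<^sup>2" using assms by (simp_all add: energy_pos energy_sq)
  define N where "N = 2 * m * (m + ?E)"
  have N: "N > 0" using assms E by (simp add: N_def)
  have "(snd (half_boost m p))\<^sup>2 - (norm (fst (half_boost m p)))\<^sup>2 = ((m + ?E)\<^sup>2 - (norm p)\<^sup>2) / N"
    using N by (simp add: half_boost_def N_def[symmetric] power_mult_distrib power_divide divide_simps)
  also have "(m + ?E)\<^sup>2 - (norm p)\<^sup>2 = N"
    using E(2) by (simp add: N_def power2_eq_square algebra_simps)
  finally show "(snd (half_boost m p))\<^sup>2 - (norm (fst (half_boost m p)))\<^sup>2 = 1" using N by simp
  show "snd (half_boost m p) > 0" using assms E N by (simp add: half_boost_def N_def[symmetric])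
qed

text \<open>Squaring doubles the rapidity, and the half boost sits at half the rapidity of the unit
  vector in the direction of the shell momentum.\<close>

lemma herm_of_half_boost_square:
  assumes "m > 0"
  shows "herm_of (half_boost m p) ** herm_of (half_boost m p) = herm_of (p /\<^sub>R m, energy m p / m)"
proof -
  let ?E = "energy m p" and ?h = "half_boost m p"
  define N where "N = 2 * m * (m + ?E)"
  have E: "?E > 0" "?E\<^sup>2 = (norm p)\<^sup>2 + m\<^sup>2" using assms by (simp_all add: energy_pos energy_sq)
  have N: "N > 0" using assms E by (simp add: N_def)
  have 1: "2 * snd ?h * fst ?h $ i = p $ i / m" for i
  proof -
    have "2 * snd ?h * fst ?h $ i = 2 * (m + ?E) * p $ i / (sqrt N * sqrt N)"
      unfolding half_boost_def N_def[symmetric] by (simp add: divide_inverse mult_ac del: real_sqrt_mult_self)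
    also have "sqrt N * sqrt N = N" using N by simp
    also have "2 * (m + ?E) * p $ i / N = p $ i / m"
    proof -
      have "(2 * (m + ?E)) * p $ i / ((2 * (m + ?E)) * m) = p $ i / m"
        using assms E by (intro mult_divide_mult_cancel_left) simp
      then show ?thesis by (simp only: N_def mult_ac)
    qed
    finally show ?thesis .
  qed
  have 2: "(snd ?h)\<^sup>2 + (norm (fst ?h))\<^sup>2 = ?E / m"
  proof -
    have 3: "(snd ?h)\<^sup>2 + (norm (fst ?h))\<^sup>2 = 2 * (snd ?h)\<^sup>2 - 1"
      using half_boost_norm[OF assms, of p] by simp
    have "(snd ?h)\<^sup>2 = (m + ?E)\<^sup>2 / N"
      using N by (simp add: half_boost_def N_def[symmetric] power_divide)
    also have "\<dots> = (m + ?E) / (2 * m)"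
      using assms E by (simp add: N_def power2_eq_square)
    finally have 4: "(snd ?h)\<^sup>2 = (m + ?E) / (2 * m)" .
    have "2 * ((m + ?E) / (2 * m)) - 1 = ?E / m"
      using assms by (simp add: field_simps)
    then show ?thesis by (subst 3) (simp only: 4)
  qed
  have "herm_of ?h ** herm_of ?h =
      cherm (\<chi> i. of_real (2 * snd ?h * fst ?h $ i)) (of_real ((snd ?h)\<^sup>2 + (norm (fst ?h))\<^sup>2))"
    using herm_of_eq_cherm[of "fst ?h" "snd ?h"] cherm_square[of "cvec (fst ?h)" "of_real (snd ?h)", unfolded sum_cvec_sq]
    by (simp add: sum_cvec_sq)
  also have "\<dots> = herm_of (p /\<^sub>R m, ?E / m)"
    unfolding 1 2 herm_of_eq_cherm by (simp add: vec_eq_iff forall_2 divide_inverse mult.commute)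
  finally show ?thesis .
qed

text \<open>Completing the square in the first component of \<open>z\<close>, with the positive
  leading coefficient \<open>e - p $ 3\<close>: the remainder is the determinant, here 1, times the
  squared modulus of the second component.\<close>

lemma pos_def_herm_of:
  assumes e: "e > 0" "e\<^sup>2 - (norm p)\<^sup>2 = 1"
  shows "pos_def_herm (herm_of (p, e))"
  unfolding pos_def_herm_def
proof (intro conjI allI impI)
  show "dagger (herm_of (p, e)) = herm_of (p, e)"
    by (simp add: herm_of_eq_cherm dagger_cherm_real)
  fix z :: "complex ^ 2"
  assume z: "z \<noteq> 0"
  define x1 y1 x2 y2 where "x1 = Re (z $ 1)" "y1 = Im (z $ 1)" "x2 = Re (z $ 2)" "y2 = Im (z $ 2)"
  note xy = this
  define a where "a = e - p $ 3"
  define S where "S = a * (x1\<^sup>2 + y1\<^sup>2) + (e + p $ 3) * (x2\<^sup>2 + y2\<^sup>2)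
      - 2 * p $ 1 * (x1 * x2 + y1 * y2) - 2 * p $ 2 * (x1 * y2 - y1 * x2)"
  have S: "Re (\<Sum>i\<in>UNIV. cnj (z $ i) * (herm_of (p, e) *v z) $ i) = S"
    by (simp add: herm_of_eq_cherm matrix_vector_mult_def sum_2 S_def xy a_def power2_eq_square algebra_simps)
  have n: "(norm p)\<^sup>2 = (p $ 1)\<^sup>2 + (p $ 2)\<^sup>2 + (p $ 3)\<^sup>2"
    by (simp add: norm_sq_vec3 sum_3)
  have "\<bar>p $ 3\<bar> < e"
  proof -
    have "norm p < e"
      by (rule power2_less_imp_less) (use e in linarith)+
    then show ?thesis using component_le_norm_cart[of p 3] by linarith
  qed
  then have a: "a > 0" by (simp add: a_def)
  have "a * S = (a * x1 - p $ 1 * x2 - p $ 2 * y2)\<^sup>2 + (a * y1 - p $ 1 * y2 + p $ 2 * x2)\<^sup>2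
      + (e\<^sup>2 - (norm p)\<^sup>2) * (x2\<^sup>2 + y2\<^sup>2)"
    unfolding n S_def a_def by (simp add: power2_eq_square algebra_simps)
  then have aS: "a * S = (a * x1 - p $ 1 * x2 - p $ 2 * y2)\<^sup>2 + (a * y1 - p $ 1 * y2 + p $ 2 * x2)\<^sup>2
      + (x2\<^sup>2 + y2\<^sup>2)" using e by simp
  have "a * S > 0"
  proof (cases "x2 = 0 \<and> y2 = 0")
    case True
    then have "x1 \<noteq> 0 \<or> y1 \<noteq> 0"
      using z by (auto simp: xy vec_eq_iff forall_2 complex_eq_iff)
    then show ?thesis
      unfolding aS using True a by (simp add: sum_power2_gt_zero_iff)
  next
    case False
    then have "x2\<^sup>2 + y2\<^sup>2 > 0" by (simp add: sum_power2_gt_zero_iff)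
    then show ?thesis unfolding aS by (simp add: add_nonneg_pos)
  qed
  then show "Re (\<Sum>i\<in>UNIV. cnj (z $ i) * (herm_of (p, e) *v z) $ i) > 0"
    unfolding S using a by (simp add: zero_less_mult_iff)
qed

text \<open>The matrix of the rest momentum is \<open>m\<close> times the identity, so a Hermitian
  \<open>L\<close> takes it to \<open>m\<close> times \<open>L ** L\<close>. Finding a boost is
  therefore extracting a square root.\<close>

lemma lorentz_rest_eq_iff:
  assumes "m > 0" "dagger L = L"
  shows "lorentz L (on_shell m 0) = on_shell m p \<longleftrightarrow> L ** L = herm_of (p /\<^sub>R m, energy m p / m)"
proof -
  have "L ** herm_of (on_shell m 0) ** dagger L = (\<chi> i k. of_real m * (L ** L) $ i $ k)"
    using assms by (simp add: on_shell_def herm_of_eq_cherm energy_def vec_eq_iff forall_2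
        matrix_matrix_mult_def sum_2 algebra_simps)
  moreover have "herm_of (on_shell m p) = (\<chi> i k. of_real m * herm_of (p /\<^sub>R m, energy m p / m) $ i $ k)"
    using assms by (simp add: on_shell_def herm_of_eq_cherm vec_eq_iff forall_2 field_simps)
  ultimately show ?thesis
    using herm_of_lorentz[of L "on_shell m 0"] inj_herm_of[of "lorentz L (on_shell m 0)" "on_shell m p"] assms
    by (auto simp: vec_eq_iff)
qed

lemma boost_eq:
  assumes "m > 0"
  shows "boost m p = herm_of (half_boost m p)"
proof -
  let ?L = "herm_of (half_boost m p)"
  have c: "?L = cherm (cvec (fst (half_boost m p))) (of_real (snd (half_boost m p)))"
    using herm_of_eq_cherm[of "fst (half_boost m p)" "snd (half_boost m p)"] by simp
  have "det ?L = of_real ((snd (half_boost m p))\<^sup>2 - (norm (fst (half_boost m p)))\<^sup>2)"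
    unfolding c det_cherm sum_cvec_sq by simp
  then have SL: "?L \<in> SL2C"
    using half_boost_norm(1)[OF assms, of p] by (simp add: SL2C_def)
  have pd: "pos_def_herm ?L"
    using pos_def_herm_of[OF half_boost_norm(2,1)[OF assms, of p]] by simp
  have "dagger ?L = ?L" unfolding c by (rule dagger_cherm_real)
  then have lor: "lorentz ?L (on_shell m 0) = on_shell m p"
    using lorentz_rest_eq_iff[OF assms] herm_of_half_boost_square[OF assms] by blast
  show ?thesis
    unfolding boost_def
  proof (rule the_equality)
    show "?L \<in> SL2C \<and> pos_def_herm ?L \<and> lorentz ?L (on_shell m 0) = on_shell m p"
      using SL pd lor by blast
    fix L assume L: "L \<in> SL2C \<and> pos_def_herm L \<and> lorentz L (on_shell m 0) = on_shell m p"
    then have eq: "L ** L = ?L ** ?L"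
      using lorentz_rest_eq_iff[OF assms, of L p] herm_of_half_boost_square[OF assms, of p]
      by (simp add: pos_def_herm_def)
    show "L = ?L"
      by (rule pos_def_herm_square_root_unique[OF conjunct1[OF L] conjunct1[OF conjunct2[OF L]] SL pd eq])
  qed
qed

lemma matrix_inv_eqI:
  fixes M N :: "complex ^ 2 ^ 2"
  assumes "M ** N = mat 1"
  shows "matrix_inv M = N"
proof -
  have NM: "N ** M = mat 1" using assms by (simp add: matrix_left_right_inverse)
  have "M ** matrix_inv M = mat 1 \<and> matrix_inv M ** M = mat 1"
    unfolding matrix_inv_def by (rule someI[of _ N]) (use assms NM in simp)
  then show ?thesis
    using assms by (metis matrix_mul_assoc matrix_mul_lid matrix_mul_rid)
qed

section \<open>Gram matrices\<close>

text \<open>On \<open>SU2\<close> this is \<open>rep_AB\<close>, since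
  \<open>matrix_inv (dagger W) = W\<close> there. Without the inverse adjoint it is polynomial in
  the entries of \<open>W\<close>, so identities on \<open>SU2\<close> can be continued
  analytically; at a boost \<open>L\<close> the second factor then carries \<open>L\<close> in place
  of its inverse.\<close>

definition spin_pair :: "nat \<Rightarrow> nat \<Rightarrow> complex ^ 2 ^ 2 \<Rightarrow> nat \<times> nat \<Rightarrow> nat \<times> nat \<Rightarrow> complex" where
  "spin_pair A B W r s = spin_rep A W (fst r) (fst s) * spin_rep B W (snd r) (snd s)"

definition rest_gram ::
  "nat \<Rightarrow> coefficients \<Rightarrow> nat \<Rightarrow> nat \<Rightarrow> nat \<Rightarrow> nat \<Rightarrow> nat \<times> nat \<Rightarrow> nat \<times> nat \<Rightarrow> complex" where
  "rest_gram j u A B C D r t = (\<Sum>\<sigma>\<le>j. u A B r \<sigma> * cnj (u C D t \<sigma>))"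

text \<open>The factor \<open>m / energy m p\<close> is left out, so that what remains is polynomial
  in momentum and energy.\<close>

definition gram ::
  "real \<Rightarrow> nat \<Rightarrow> coefficients \<Rightarrow> nat \<Rightarrow> nat \<Rightarrow> nat \<Rightarrow> nat \<Rightarrow> nat \<times> nat \<Rightarrow> nat \<times> nat \<Rightarrow> real ^ 3 \<Rightarrow> complex" where
  "gram m j u A B C D r t p =
     (\<Sum>\<sigma>\<le>j. (\<Sum>s\<in>components A B. rep_AB A B (boost m p) r s * u A B s \<sigma>) *
       cnj (\<Sum>s\<in>components C D. rep_AB C D (boost m p) t s * u C D s \<sigma>))"

lemma components_simps [simp]: "r \<in> components A B \<longleftrightarrow> fst r \<le> A \<and> snd r \<le> B" "finite (components A B)"
  by (auto simp: components_def mem_Times_iff)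

lemma dagger_SU2: "W \<in> SU2 \<Longrightarrow> dagger W \<in> SU2"
proof -
  assume W: "W \<in> SU2"
  have "det (dagger W) = cnj (det W)" by (simp add: det_2 dagger_def)
  then show ?thesis
    using W by (auto simp: SU2_def SL2C_def dagger_dagger matrix_left_right_inverse)
qed

lemma rep_AB_SU2: "W \<in> SU2 \<Longrightarrow> rep_AB A B W r s = spin_pair A B W r s"
  using matrix_inv_eqI[of "dagger W" W] by (simp add: rep_AB_def spin_pair_def SU2_def)

lemma spin_pair_dagger:
  assumes "r \<in> components A B" "s \<in> components A B"
  shows "spin_pair A B (dagger W) r s = cnj (spin_pair A B W s r)"
  using assms by (simp add: spin_pair_def spin_rep_dagger)

text \<open>Both coefficient matrices intertwine with the same spin-\<open>j\<close> matrix of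
  \<open>W\<close>: acting on the left it passes through the first of them to the middle and then,
  as the adjoint of the action of \<open>dagger W\<close>, out through the second to the
  right.\<close>

lemma rest_gram_intertwines_SU2:
  assumes uv: "rest_coefficients j u v" and AB: "admissible j A B" and CD: "admissible j C D"
    and W: "W \<in> SU2" and r: "r \<in> components A B" and t: "t \<in> components C D"
  shows "(\<Sum>s\<in>components A B. spin_pair A B W r s * rest_gram j u A B C D s t) =
    (\<Sum>s\<in>components C D. rest_gram j u A B C D r s * spin_pair C D W s t)"
proof -
  have inv: "(\<Sum>\<tau>\<le>j. u A B r \<tau> * spin_rep j W \<tau> \<sigma>) = (\<Sum>s\<in>components A B. spin_pair A B W r s * u A B s \<sigma>)"
    if "admissible j A B" "W \<in> SU2" "r \<in> components A B" "\<sigma> \<le> j" for A B W r \<sigma>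
  proof -
    have "(\<Sum>\<tau>\<le>j. u A B r \<tau> * spin_rep j W \<tau> \<sigma>) = (\<Sum>s\<in>components A B. rep_AB A B W r s * u A B s \<sigma>)"
      using uv that unfolding rest_coefficients_def by blast
    then show ?thesis using that by (simp add: rep_AB_SU2)
  qed
  have "(\<Sum>s\<in>components C D. rest_gram j u A B C D r s * spin_pair C D W s t) =
      (\<Sum>s\<in>components C D. \<Sum>\<sigma>\<le>j. u A B r \<sigma> * cnj (spin_pair C D (dagger W) t s * u C D s \<sigma>))"
    unfolding rest_gram_def sum_distrib_right
    by (intro sum.cong refl) (use t in \<open>simp add: spin_pair_dagger\<close>)
  also have "\<dots> = (\<Sum>\<sigma>\<le>j. u A B r \<sigma> * cnj (\<Sum>s\<in>components C D. spin_pair C D (dagger W) t s * u C D s \<sigma>))"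
    by (subst sum.swap) (simp add: sum_distrib_left)
  also have "\<dots> = (\<Sum>\<sigma>\<le>j. u A B r \<sigma> * cnj (\<Sum>\<tau>\<le>j. u C D t \<tau> * spin_rep j (dagger W) \<tau> \<sigma>))"
    by (intro sum.cong refl) (simp add: inv[OF CD dagger_SU2[OF W] t])
  also have "\<dots> = (\<Sum>\<sigma>\<le>j. \<Sum>\<tau>\<le>j. u A B r \<sigma> * spin_rep j W \<sigma> \<tau> * cnj (u C D t \<tau>))"
    by (intro sum.cong refl) (simp add: sum_distrib_left spin_rep_dagger mult_ac)
  also have "\<dots> = (\<Sum>\<tau>\<le>j. (\<Sum>\<sigma>\<le>j. u A B r \<sigma> * spin_rep j W \<sigma> \<tau>) * cnj (u C D t \<tau>))"
    by (subst sum.swap) (simp add: sum_distrib_right)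
  also have "\<dots> = (\<Sum>\<tau>\<le>j. (\<Sum>s\<in>components A B. spin_pair A B W r s * u A B s \<tau>) * cnj (u C D t \<tau>))"
    by (intro sum.cong refl) (simp add: inv[OF AB W r])
  also have "\<dots> = (\<Sum>s\<in>components A B. spin_pair A B W r s * rest_gram j u A B C D s t)"
    unfolding sum_distrib_right rest_gram_def sum_distrib_left
    by (subst sum.swap) (simp add: mult.assoc)
  finally show ?thesis ..
qed

text \<open>
  The one-parameter groups $\cos\theta + i \sin\theta\, \mathbf{n}\cdot\sigma$ lie in $SU(2)$ for real
  $\theta$, and contain every boost along $\mathbf{n}$ for imaginary $\theta$.
\<close>

lemma rest_gram_intertwines_boost:
  assumes uv: "rest_coefficients j u v" and AB: "admissible j A B" and CD: "admissible j C D"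
    and r: "r \<in> components A B" and t: "t \<in> components C D"
    and e: "e > 0" "e\<^sup>2 - (norm p)\<^sup>2 = 1"
  defines "L \<equiv> herm_of (p, e)"
  shows "(\<Sum>s\<in>components A B. spin_pair A B L r s * rest_gram j u A B C D s t) =
    (\<Sum>s\<in>components C D. rest_gram j u A B C D r s * spin_pair C D L s t)"
proof -
  obtain n where n: "norm n = 1" "p = norm p *\<^sub>R n"
  proof (cases "p = 0")
    case True
    then show ?thesis using that[of "axis 1 1"] by simp
  next
    case False
    then show ?thesis using that[of "p /\<^sub>R norm p"] by simp
  qed
  define W where "W \<theta> = cherm (\<chi> i. - \<i> * sin \<theta> * of_real (n $ i)) (cos \<theta>)" for \<theta>
  have n2: "(\<Sum>i\<in>UNIV. (complex_of_real (n $ i))\<^sup>2) = 1"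
    using sum_cvec_sq[of n] n(1) by simp
  have SU: "W (of_real x) \<in> SU2" for x :: real
  proof -
    have s: "(\<Sum>i\<in>UNIV. ((\<chi> i. - \<i> * sin (of_real x) * of_real (n $ i)) $ i)\<^sup>2) = - ((sin (complex_of_real x))\<^sup>2)"
    proof -
      have "(\<Sum>i\<in>UNIV. ((\<chi> i. - \<i> * sin (of_real x) * of_real (n $ i)) $ i)\<^sup>2) =
          (\<Sum>i\<in>UNIV. - ((sin (complex_of_real x))\<^sup>2) * (of_real (n $ i))\<^sup>2)"
        by (simp add: power_mult_distrib)
      also have "\<dots> = - ((sin (complex_of_real x))\<^sup>2) * (\<Sum>i\<in>UNIV. (of_real (n $ i))\<^sup>2)"
        by (simp only: sum_distrib_left)
      finally show ?thesis by (simp only: n2 mult_1_right)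
    qed
    have "dagger (W (of_real x)) = cherm (- (\<chi> i. - \<i> * sin (of_real x) * of_real (n $ i))) (cos (of_real x))"
      unfolding W_def dagger_cherm
      by (simp add: vec_eq_iff forall_2 sin_of_real cos_of_real)
    then have "W (of_real x) ** dagger (W (of_real x)) = mat 1"
      unfolding W_def using cherm_mult_uminus[of "\<chi> i. - \<i> * sin (of_real x) * of_real (n $ i)" "cos (of_real x)"]
      unfolding s by simp
    then show ?thesis
      unfolding SU2_def SL2C_def
      by (simp add: matrix_left_right_inverse W_def det_cherm s[simplified])
  qed
  have alg: "function_algebra {f. f holomorphic_on UNIV}"
    unfolding function_algebra_def by (auto intro!: holomorphic_intros)
  have hW: "(\<lambda>\<theta>. W \<theta> $ i $ k) holomorphic_on UNIV" for i k
    using exhaust_2[of i] exhaust_2[of k] unfolding W_def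
    by (auto intro!: holomorphic_intros)
  have hs: "(\<lambda>\<theta>. spin_rep N (W \<theta>) i k) holomorphic_on UNIV" for N i k
    using spin_rep_in_function_algebra[OF alg, of W N i k] hW by simp
  define F where "F \<theta> = (\<Sum>s\<in>components A B. spin_pair A B (W \<theta>) r s * rest_gram j u A B C D s t) -
    (\<Sum>s\<in>components C D. rest_gram j u A B C D r s * spin_pair C D (W \<theta>) s t)" for \<theta>
  have hF: "F holomorphic_on UNIV"
    unfolding F_def spin_pair_def by (intro holomorphic_intros hs)
  have F0: "F \<theta> = 0" for \<theta>
  proof (rule analytic_continuation[OF hF])
    show "(0 :: complex) islimpt \<real>"
      unfolding islimpt_approachable
    proof (intro allI impI)
      fix d :: real assume "d > 0"
      then show "\<exists>x'\<in>\<real>. x' \<noteq> 0 \<and> dist x' (0 :: complex) < d"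
        by (intro bexI[of _ "of_real (d / 2)"]) auto
    qed
    show "F z = 0" if "z \<in> \<real>" for z
      using that rest_gram_intertwines_SU2[OF uv AB CD SU r t] unfolding F_def by (auto elim!: Reals_cases)
  qed auto
  have pos: "e - norm p > 0"
  proof -
    have "norm p < e" by (rule power2_less_imp_less) (use e in linarith)+
    then show ?thesis by simp
  qed
  \<comment> \<open>The angle with exp(i \<theta>) equal to \<open>e - norm p\<close>, the smaller
    eigenvalue of \<open>L\<close>; its inverse is the larger one, whence cos \<theta> is
    \<open>e\<close> and -i sin \<theta> is \<open>norm p\<close>.\<close>
  define \<theta> where "\<theta> = - \<i> * of_real (ln (e - norm p))"
  have ex: "exp (\<i> * \<theta>) = of_real (e - norm p)" "exp (- (\<i> * \<theta>)) = of_real (e + norm p)"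
  proof -
    show *: "exp (\<i> * \<theta>) = of_real (e - norm p)"
      using pos unfolding \<theta>_def by (simp add: exp_of_real flip: of_real_diff)
    have "(e - norm p) * (e + norm p) = 1" using e by (simp add: power2_eq_square algebra_simps)
    then have "inverse (e - norm p) = e + norm p" by (rule inverse_unique)
    then show "exp (- (\<i> * \<theta>)) = of_real (e + norm p)"
      unfolding exp_minus * by (simp only: of_real_inverse[symmetric])
  qed
  have "cos \<theta> = of_real e"
    unfolding cos_exp_eq ex minus_mult_left[symmetric] by simp
  moreover have "- \<i> * sin \<theta> = of_real (norm p)"
    unfolding sin_exp_eq ex minus_mult_left[symmetric] by simp
  ultimately have "W \<theta> = cherm (\<chi> i. of_real (norm p * n $ i)) (of_real e)"
    unfolding W_def by simp
  also have "(\<chi> i. complex_of_real (norm p * n $ i)) = cvec p"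
  proof -
    have "norm p * n $ i = p $ i" for i
      using arg_cong[OF n(2), of "\<lambda>v. v $ i"] by simp
    then show ?thesis by (simp only: cvec_def)
  qed
  finally have "W \<theta> = L" by (simp add: L_def herm_of_eq_cherm)
  with F0[of \<theta>] show ?thesis by (simp add: F_def)
qed

lemma sum_components:
  "(\<Sum>s\<in>components A B. f (fst s) * g (snd s)) = (\<Sum>a\<le>A. f a) * (\<Sum>b\<le>B. g b :: complex)"
  unfolding components_def sum_product sum.cartesian_product by (simp add: case_prod_unfold)

lemma sum_components_pair:
  "(\<Sum>s\<in>components A B. f s) = (\<Sum>a\<le>A. \<Sum>b\<le>B. f (a, b))"
  unfolding components_def sum.cartesian_product by simp

text \<open>
  Since the rest-frame Gram matrix intertwines $D^{(A)} \otimes D^{(B)}$ with $D^{(C)} \otimes D^{(D)}$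
  at the boost $L$, the boosts acting on it combine into $L^2$ and $L^{-2}$, whose entries are linear
  in the momentum and the energy.
\<close>

lemma gram_eq:
  assumes m: "m > 0" and uv: "rest_coefficients j u v" and AB: "admissible j A B" and CD: "admissible j C D"
    and r: "r \<in> components A B" and t: "t \<in> components C D"
  shows "gram m j u A B C D r t p =
    (\<Sum>a\<le>A. \<Sum>d\<le>D. spin_rep A (herm_of (p /\<^sub>R m, energy m p / m)) (fst r) a *
      rest_gram j u A B C D (a, snd r) (fst t, d) *
      spin_rep D (herm_of (- p /\<^sub>R m, energy m p / m)) d (snd t))"
proof -
  define q e where "q = fst (half_boost m p)" and "e = snd (half_boost m p)"
  have qe: "half_boost m p = (q, e)" by (simp add: q_def e_def)
  have e: "e > 0" "e\<^sup>2 - (norm q)\<^sup>2 = 1" using half_boost_norm[OF m, of p] by (simp_all add: q_def e_def)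
  define L M Q Q' where "L = herm_of (q, e)" and "M = herm_of (- q, e)"
    and "Q = herm_of (p /\<^sub>R m, energy m p / m)"
    and "Q' = herm_of (- p /\<^sub>R m, energy m p / m)"
  have bL: "boost m p = L" by (simp add: boost_eq[OF m] qe L_def)
  have LL: "L ** L = Q"
    using herm_of_half_boost_square[OF m, of p] by (simp add: qe L_def Q_def)
  have hm: "half_boost m (- p) = (- q, e)"
    using qe by (simp add: half_boost_def energy_def)
  have MM: "M ** M = Q'"
    using herm_of_half_boost_square[OF m, of "- p"] by (simp add: hm M_def Q'_def energy_def)
  have LM: "L ** M = mat 1"
    using cherm_mult_uminus[of "cvec q" "of_real e"] e
    by (simp add: L_def M_def herm_of_eq_cherm cvec_uminus flip: of_real_power of_real_sum of_real_diff norm_sq_vec3)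
  have LM_inv: "M ** L = mat 1" using LM by (simp add: matrix_left_right_inverse)
  have dL: "dagger L = L" and dM: "dagger M = M"
    by (simp_all add: L_def M_def herm_of_eq_cherm dagger_cherm_real)
  have inv: "matrix_inv (dagger L) = M" using LM dL by (simp add: matrix_inv_eqI)
  have LQ': "L ** Q' = M" unfolding MM[symmetric] matrix_mul_assoc LM by simp
  let ?K = "components A B" and ?K' = "components C D"
  let ?P = "rest_gram j u A B C D"
  let ?c = "fst t" and ?d = "snd t"
  \<comment> \<open>The inverse of \<open>L\<close> in the second factor is written as
    \<open>L\<close> times the inverse square, so that a complete \<open>spin_pair\<close> at
    \<open>L\<close> splits off, which can be moved through the Gram matrix.\<close>
  have c1: "cnj (rep_AB C D L t s) = (\<Sum>d\<le>D. spin_pair C D L s (?c, d) * spin_rep D Q' d ?d)" if "s \<in> ?K'" for s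
  proof -
    have "cnj (rep_AB C D L t s) = spin_rep C (dagger L) (fst s) ?c * spin_rep D (dagger M) (snd s) ?d"
      using that t by (simp add: rep_AB_def inv spin_rep_dagger)
    also have "\<dots> = spin_rep C L (fst s) ?c * spin_rep D (L ** Q') (snd s) ?d"
      by (simp only: dL dM LQ')
    also have "\<dots> = (\<Sum>d\<le>D. spin_pair C D L s (?c, d) * spin_rep D Q' d ?d)"
      using t by (simp add: spin_rep_mult spin_pair_def sum_distrib_left mult_ac)
    finally show ?thesis .
  qed
  \<comment> \<open>After the move, the factors of spin \<open>A\<close> combine to
    \<open>L ** L\<close>, while those of spin \<open>B\<close> cancel.\<close>
  have c2: "(\<Sum>s\<in>?K. rep_AB A B L r s * spin_pair A B L s s') =
      spin_rep A Q (fst r) (fst s') * (if snd r = snd s' then 1 else 0)" if "s' \<in> ?K" for s'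
  proof -
    have "(\<Sum>s\<in>?K. rep_AB A B L r s * spin_pair A B L s s') =
        (\<Sum>s\<in>?K. (spin_rep A L (fst r) (fst s) * spin_rep A L (fst s) (fst s')) *
          (spin_rep B M (snd r) (snd s) * spin_rep B L (snd s) (snd s')))"
      by (simp add: rep_AB_def inv spin_pair_def mult_ac)
    also have "\<dots> = spin_rep A (L ** L) (fst r) (fst s') * spin_rep B (M ** L) (snd r) (snd s')"
      unfolding sum_components[of "\<lambda>a. spin_rep A L (fst r) a * spin_rep A L a (fst s')"
          "\<lambda>b. spin_rep B M (snd r) b * spin_rep B L b (snd s')"]
      using that by (simp add: spin_rep_mult)
    also have "\<dots> = spin_rep A Q (fst r) (fst s') * (if snd r = snd s' then 1 else 0)"
      using that by (simp add: LL LM_inv spin_rep_mat_1)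
    finally show ?thesis .
  qed
  have int: "(\<Sum>s\<in>?K'. ?P r' s * spin_pair C D L s (?c, d)) = (\<Sum>s\<in>?K. spin_pair A B L r' s * ?P s (?c, d))"
    if "r' \<in> ?K" "d \<le> D" for r' d
    unfolding L_def
    by (rule rest_gram_intertwines_boost[OF uv AB CD that(1) _ e, symmetric]) (use that t in simp)
  have "gram m j u A B C D r t p =
      (\<Sum>\<sigma>\<le>j. \<Sum>s\<in>?K. \<Sum>s'\<in>?K'. rep_AB A B L r s * cnj (rep_AB C D L t s') * (u A B s \<sigma> * cnj (u C D s' \<sigma>)))"
    unfolding gram_def bL by (simp add: cnj_sum sum_product mult_ac)
  also have "\<dots> = (\<Sum>s\<in>?K. \<Sum>s'\<in>?K'. rep_AB A B L r s * cnj (rep_AB C D L t s') * ?P s s')"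
    unfolding rest_gram_def sum_distrib_left
    by (subst sum.swap, rule sum.cong[OF refl], rule sum.swap)
  also have "\<dots> = (\<Sum>s\<in>?K. \<Sum>s'\<in>?K'. \<Sum>d\<le>D. spin_rep D Q' d ?d * (rep_AB A B L r s * (?P s s' * spin_pair C D L s' (?c, d))))"
    by (intro sum.cong refl) (simp add: c1 sum_distrib_left sum_distrib_right mult_ac)
  also have "\<dots> = (\<Sum>s\<in>?K. \<Sum>d\<le>D. spin_rep D Q' d ?d * (rep_AB A B L r s * (\<Sum>s'\<in>?K'. ?P s s' * spin_pair C D L s' (?c, d))))"
    unfolding sum_distrib_left by (intro sum.cong refl sum.swap)
  also have "\<dots> = (\<Sum>s\<in>?K. \<Sum>d\<le>D. spin_rep D Q' d ?d * (rep_AB A B L r s * (\<Sum>s'\<in>?K. spin_pair A B L s s' * ?P s' (?c, d))))"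
    by (intro sum.cong refl) (simp add: int)
  also have "\<dots> = (\<Sum>d\<le>D. \<Sum>s\<in>?K. \<Sum>s'\<in>?K. spin_rep D Q' d ?d * (rep_AB A B L r s * (spin_pair A B L s s' * ?P s' (?c, d))))"
    unfolding sum_distrib_left by (rule sum.swap)
  also have "\<dots> = (\<Sum>d\<le>D. \<Sum>s'\<in>?K. spin_rep D Q' d ?d * (?P s' (?c, d) * (\<Sum>s\<in>?K. rep_AB A B L r s * spin_pair A B L s s')))"
    unfolding sum_distrib_left
    by (rule sum.cong[OF refl], rule trans[OF sum.swap]) (simp add: mult_ac)
  also have "\<dots> = (\<Sum>d\<le>D. \<Sum>a\<le>A. \<Sum>b\<le>B. spin_rep D Q' d ?d * (?P (a, b) (?c, d) * (spin_rep A Q (fst r) a * (if snd r = b then 1 else 0))))"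
    by (intro sum.cong refl) (simp add: sum_components_pair[symmetric] c2, simp add: sum_components_pair c2)
  also have "\<dots> = (\<Sum>d\<le>D. \<Sum>a\<le>A. spin_rep D Q' d ?d * (?P (a, snd r) (?c, d) * spin_rep A Q (fst r) a))"
    using r by (intro sum.cong refl) (simp add: if_distrib cong: if_cong)
  also have "\<dots> = (\<Sum>a\<le>A. \<Sum>d\<le>D. spin_rep A Q (fst r) a * ?P (a, snd r) (?c, d) * spin_rep D Q' d ?d)"
    by (subst sum.swap) (simp add: mult_ac)
  finally show ?thesis by (simp add: Q_def Q'_def)
qed

section \<open>Complexified momenta: parity and growth of the Gram matrix\<close>

text \<open>Holomorphy is asked along complex lines only, since contours are shifted in one
  direction at a time; polynomial growth is what the Gaussian can absorb.\<close>

definition moderate :: "(complex ^ 3 \<Rightarrow> complex) \<Rightarrow> bool" where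
  "moderate R \<longleftrightarrow> continuous_on UNIV R \<and>
     (\<forall>q n. (\<lambda>w. R (\<chi> i. q $ i + w * n $ i)) holomorphic_on UNIV) \<and>
     (\<exists>N C. C \<ge> 0 \<and> (\<forall>q. cmod (R q) \<le> C * (1 + norm q) ^ N))"

lemma moderate_component: "moderate (\<lambda>q. q $ i)"
  unfolding moderate_def
proof (intro conjI allI)
  show "\<exists>N C. C \<ge> 0 \<and> (\<forall>q :: complex ^ 3. cmod (q $ i) \<le> C * (1 + norm q) ^ N)"
    by (rule exI[of _ 1], rule exI[of _ 1]) (auto intro!: add_increasing[OF zero_le_one] Finite_Cartesian_Product.norm_nth_le)
qed (auto intro!: continuous_intros holomorphic_intros)

lemma moderate_algebra: "function_algebra {R. moderate R}"
  unfolding function_algebra_def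
proof (intro conjI allI ballI)
  show "(\<lambda>_. c) \<in> {R. moderate R}" for c
    unfolding moderate_def by (auto intro!: exI[of _ "0 :: nat"] exI[of _ "cmod c"])
next
  fix f g assume fg: "f \<in> {R. moderate R}" "g \<in> {R. moderate R}"
  then obtain N C M D where
    1: "C \<ge> 0" "\<And>q. cmod (f q) \<le> C * (1 + norm q) ^ N" and
    2: "D \<ge> 0" "\<And>q. cmod (g q) \<le> D * (1 + norm q) ^ M"
    unfolding moderate_def mem_Collect_eq by blast
  have "cmod (f q + g q) \<le> (C + D) * (1 + norm q) ^ (N + M)" for q
  proof -
    have "cmod (f q) \<le> C * (1 + norm q) ^ (N + M)"
      using 1(2)[of q] by (rule order_trans) (intro mult_left_mono power_increasing, use 1 in auto)
    moreover have "cmod (g q) \<le> D * (1 + norm q) ^ (N + M)"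
      using 2(2)[of q] by (rule order_trans) (intro mult_left_mono power_increasing, use 2 in auto)
    ultimately show ?thesis
      using norm_triangle_ineq[of "f q" "g q"] by (simp add: algebra_simps)
  qed
  moreover have "C + D \<ge> 0" using 1 2 by simp
  ultimately have "\<exists>N C. C \<ge> 0 \<and> (\<forall>q. cmod (f q + g q) \<le> C * (1 + norm q) ^ N)" by blast
  then show "(\<lambda>x. f x + g x) \<in> {R. moderate R}"
    using fg unfolding moderate_def mem_Collect_eq by (auto intro!: continuous_on_add holomorphic_on_add)
  have "cmod (f q * g q) \<le> (C * D) * (1 + norm q) ^ (N + M)" for q
    using mult_mono[OF 1(2)[of q] 2(2)[of q]] 1 2
    by (simp add: norm_mult power_add mult_ac)
  moreover have "C * D \<ge> 0" using 1 2 by simp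
  ultimately have "\<exists>N C. C \<ge> 0 \<and> (\<forall>q. cmod (f q * g q) \<le> C * (1 + norm q) ^ N)" by blast
  then show "(\<lambda>x. f x * g x) \<in> {R. moderate R}"
    using fg unfolding moderate_def mem_Collect_eq by (auto intro!: continuous_on_mult holomorphic_on_mult)
qed

lemma moderate_const: "moderate (\<lambda>_. c)"
  and moderate_add: "moderate f \<Longrightarrow> moderate g \<Longrightarrow> moderate (\<lambda>q. f q + g q)"
  and moderate_mult: "moderate f \<Longrightarrow> moderate g \<Longrightarrow> moderate (\<lambda>q. f q * g q)"
  using moderate_algebra by (auto simp: function_algebra_def)

lemma moderate_sum: "(\<And>i. i \<in> I \<Longrightarrow> moderate (f i)) \<Longrightarrow> moderate (\<lambda>q. \<Sum>i\<in>I. f i q)"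
  using function_algebra_sum[OF moderate_algebra, of I f] by simp

text \<open>
  On the complexified mass shell $e^2 = m^2 + \mathbf{q}^2$, polynomials in $(\mathbf{q}, e)$ are
  affine in $e$ with coefficients polynomial in $\mathbf{q}$.
\<close>

definition shell_affine :: "real \<Rightarrow> ((complex ^ 3) \<times> complex \<Rightarrow> complex) \<Rightarrow> bool" where
  "shell_affine m f \<longleftrightarrow> (\<exists>R S. moderate R \<and> moderate S \<and>
     (\<forall>q e. e\<^sup>2 = of_real (m\<^sup>2) + (\<Sum>i\<in>UNIV. (q $ i)\<^sup>2) \<longrightarrow> f (q, e) = R q + e * S q))"

lemma shell_affine_algebra: "function_algebra {f. shell_affine m f}"
  unfolding function_algebra_def
proof (intro conjI allI ballI)
  have "moderate (\<lambda>_. c)" for c by (rule moderate_const)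
  then show "(\<lambda>_. c) \<in> {f. shell_affine m f}" for c
    unfolding shell_affine_def mem_Collect_eq by (intro exI[of _ "\<lambda>_. c"] exI[of _ "\<lambda>_. 0"]) simp
next
  fix f g assume "f \<in> {f. shell_affine m f}" "g \<in> {f. shell_affine m f}"
  then obtain R S R' S' where R: "moderate R" "moderate S" "moderate R'" "moderate S'"
    and f: "\<And>q e. e\<^sup>2 = of_real (m\<^sup>2) + (\<Sum>i\<in>UNIV. (q $ i)\<^sup>2) \<Longrightarrow> f (q, e) = R q + e * S q"
    and g: "\<And>q e. e\<^sup>2 = of_real (m\<^sup>2) + (\<Sum>i\<in>UNIV. (q $ i)\<^sup>2) \<Longrightarrow> g (q, e) = R' q + e * S' q"
    unfolding shell_affine_def mem_Collect_eq by blast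
  show "(\<lambda>x. f x + g x) \<in> {f. shell_affine m f}"
    unfolding shell_affine_def mem_Collect_eq
    by (intro exI[of _ "\<lambda>q. R q + R' q"] exI[of _ "\<lambda>q. S q + S' q"] conjI moderate_add R)
      (auto simp: f g algebra_simps)
  show "(\<lambda>x. f x * g x) \<in> {f. shell_affine m f}"
    unfolding shell_affine_def mem_Collect_eq
  proof (intro exI conjI)
    \<comment> \<open>The product of the two terms linear in \<open>e\<close> contributes a square,
      replaced here by its value on the mass shell.\<close>
    show "moderate (\<lambda>q. R q * R' q + (of_real (m\<^sup>2) + (\<Sum>i\<in>UNIV. q $ i * q $ i)) * (S q * S' q))"
      by (intro moderate_add moderate_mult moderate_const moderate_sum moderate_component R)
    show "moderate (\<lambda>q. R q * S' q + S q * R' q)"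
      by (intro moderate_add moderate_mult R)
    show "\<forall>q e. e\<^sup>2 = of_real (m\<^sup>2) + (\<Sum>i\<in>UNIV. (q $ i)\<^sup>2) \<longrightarrow> f (q, e) * g (q, e) =
        (R q * R' q + (of_real (m\<^sup>2) + (\<Sum>i\<in>UNIV. q $ i * q $ i)) * (S q * S' q)) + e * (R q * S' q + S q * R' q)"
    proof (intro allI impI)
      fix q :: "complex ^ 3" and e
      assume e: "e\<^sup>2 = of_real (m\<^sup>2) + (\<Sum>i\<in>UNIV. (q $ i)\<^sup>2)"
      then have e': "of_real (m\<^sup>2) + (\<Sum>i\<in>UNIV. q $ i * q $ i) = e * e"
        by (simp add: power2_eq_square)
      show "f (q, e) * g (q, e) =
        (R q * R' q + (of_real (m\<^sup>2) + (\<Sum>i\<in>UNIV. q $ i * q $ i)) * (S q * S' q)) + e * (R q * S' q + S q * R' q)"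
        unfolding f[OF e] g[OF e] e' by (simp add: algebra_simps)
    qed
  qed
qed

lemma shell_affine_intros:
  "shell_affine m (\<lambda>x. c)" "shell_affine m (\<lambda>x. fst x $ i)" "shell_affine m snd"
  "shell_affine m f \<Longrightarrow> shell_affine m g \<Longrightarrow> shell_affine m (\<lambda>x. f x + g x)"
  "shell_affine m f \<Longrightarrow> shell_affine m g \<Longrightarrow> shell_affine m (\<lambda>x. f x * g x)"
proof -
  show "shell_affine m (\<lambda>x. fst x $ i)"
    unfolding shell_affine_def
    by (intro exI[of _ "\<lambda>q. q $ i"] exI[of _ "\<lambda>_. 0"]) (simp add: moderate_component moderate_const)
  show "shell_affine m snd"
    unfolding shell_affine_def
    by (intro exI[of _ "\<lambda>_. 1"] exI[of _ "\<lambda>_. 0"]) (simp add: moderate_const)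
qed (use shell_affine_algebra[of m] in \<open>auto simp: function_algebra_def\<close>)

text \<open>Momentum and energy are independent variables here, so the energy may change its sign;
  \<open>gram\<close> is the restriction to the real shell of positive energy.\<close>

definition gram_poly ::
  "real \<Rightarrow> nat \<Rightarrow> coefficients \<Rightarrow> nat \<Rightarrow> nat \<Rightarrow> nat \<Rightarrow> nat \<Rightarrow> nat \<times> nat \<Rightarrow> nat \<times> nat \<Rightarrow>
     (complex ^ 3) \<times> complex \<Rightarrow> complex" where
  "gram_poly m j u A B C D r t x =
    (\<Sum>a\<le>A. \<Sum>d\<le>D. spin_rep A (cherm (\<chi> i. fst x $ i / of_real m) (snd x / of_real m)) (fst r) a *
      rest_gram j u A B C D (a, snd r) (fst t, d) *
      spin_rep D (cherm (\<chi> i. - fst x $ i / of_real m) (snd x / of_real m)) d (snd t))"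

lemma gram_eq_gram_poly:
  assumes "m > 0" "rest_coefficients j u v" "admissible j A B" "admissible j C D"
    and "r \<in> components A B" "t \<in> components C D"
  shows "gram m j u A B C D r t p = gram_poly m j u A B C D r t (cvec p, of_real (energy m p))"
proof -
  have *: "cvec (q /\<^sub>R m) = (\<chi> i. cvec q $ i / of_real m)" for q
    by (simp add: vec_eq_iff divide_inverse mult.commute)
  show ?thesis
    unfolding gram_eq[OF assms] gram_poly_def herm_of_eq_cherm * by (simp add: cvec_uminus)
qed

text \<open>One representation matrix is homogeneous of degree \<open>A\<close>, the other of degree
  \<open>D\<close>, in momentum and energy together.\<close>

lemma gram_poly_uminus:
  assumes "r \<in> components A B" "t \<in> components C D"
  shows "gram_poly m j u A B C D r t (- q, - e) = (- 1) ^ (A + D) * gram_poly m j u A B C D r t (q, e)"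
proof -
  have ch: "cherm (\<chi> i. - f i) (- e) = - cherm (\<chi> i. f i) e" for f e
    by (simp add: vec_eq_iff forall_2)
  have 1: "cherm (\<chi> i. (- q) $ i / of_real m) (- e / of_real m) = - cherm (\<chi> i. q $ i / of_real m) (e / of_real m)"
    using ch[of "\<lambda>i. q $ i / of_real m" "e / of_real m"] by simp
  have 2: "cherm (\<chi> i. - (- q) $ i / of_real m) (- e / of_real m) = - cherm (\<chi> i. - q $ i / of_real m) (e / of_real m)"
    using ch[of "\<lambda>i. - q $ i / of_real m" "e / of_real m"] by simp
  show ?thesis
    unfolding gram_poly_def sum_distrib_left fst_conv snd_conv 1 2
    using assms by (intro sum.cong refl) (simp add: spin_rep_uminus power_add)
qed

lemma shell_affine_gram_poly: "shell_affine m' (gram_poly m j u A B C D r t)"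
proof -
  note intros = shell_affine_intros[of m']
  have sum: "shell_affine m' (\<lambda>x. \<Sum>i\<in>I. f i x)" if "\<And>i. i \<in> I \<Longrightarrow> shell_affine m' (f i)" for I and f :: "nat \<Rightarrow> _"
    using function_algebra_sum[OF shell_affine_algebra, of I f m'] that by simp
  have neg: "shell_affine m' (\<lambda>x. - f x)" if "shell_affine m' f" for f
    using intros(5)[OF intros(1)[of "-1"] that] by simp
  have diff: "shell_affine m' (\<lambda>x. f x - g x)" if "shell_affine m' f" "shell_affine m' g" for f g
    using intros(4)[OF that(1) neg[OF that(2)]] by simp
  have div: "shell_affine m' (\<lambda>x. f x / c)" if "shell_affine m' f" for f c
    using intros(5)[OF intros(1)[of "1 / c"] that] by simp
  have ch: "shell_affine m' (\<lambda>x. cherm (\<chi> i. Q i x) (e x) $ k $ l)"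
    if "\<And>i. shell_affine m' (Q i)" "shell_affine m' e" for Q e k l
    using exhaust_2[of k] exhaust_2[of l] that
    by (elim disjE) (simp_all, (intro neg diff intros that)+)
  have rep: "shell_affine m' (\<lambda>x. spin_rep n (cherm (\<chi> i. Q i x) (e x)) k l)"
    if "\<And>i. shell_affine m' (Q i)" "shell_affine m' e" for Q e n k l
    using spin_rep_in_function_algebra[OF shell_affine_algebra, of "\<lambda>x. cherm (\<chi> i. Q i x) (e x)" m' n k l]
      ch[OF that] by simp
  have s: "shell_affine m' (\<lambda>x. snd x)" using intros(3) by simp
  show ?thesis
    unfolding gram_poly_def by (intro sum intros(1,4,5) rep div neg intros(2) s)
qed

text \<open>Reversing the momentum at fixed energy is the same as reversing both and then changing
  the sign of the energy. The first operation costs the parity, the second flips the term linear in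
  the energy, so one pair \<open>R\<close>, \<open>S\<close> serves both momentum integrals.\<close>

lemma gram_shell_form:
  assumes "m > 0" "rest_coefficients j u v" "admissible j A B" "admissible j C D"
    and "r \<in> components A B" "t \<in> components C D"
  obtains R S where "moderate R" "moderate S"
    "\<And>p. gram m j u A B C D r t p = R (cvec p) + of_real (energy m p) * S (cvec p)"
    "\<And>p. gram m j u A B C D r t (- p) = (- 1) ^ (A + D) * (R (cvec p) - of_real (energy m p) * S (cvec p))"
proof -
  obtain R S where RS: "moderate R" "moderate S" and
    eq: "\<And>q e. e\<^sup>2 = of_real (m\<^sup>2) + (\<Sum>i\<in>UNIV. (q $ i)\<^sup>2) \<Longrightarrow> gram_poly m j u A B C D r t (q, e) = R q + e * S q"
    using shell_affine_gram_poly[of m m j u A B C D r t] unfolding shell_affine_def by blast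
  have sh: "(complex_of_real (energy m p))\<^sup>2 = of_real (m\<^sup>2) + (\<Sum>i\<in>UNIV. (cvec p $ i)\<^sup>2)" for p
    unfolding sum_cvec_sq by (simp add: energy_sq flip: of_real_power of_real_add)
  show thesis
  proof (rule that[OF RS])
    fix p
    show "gram m j u A B C D r t p = R (cvec p) + of_real (energy m p) * S (cvec p)"
      unfolding gram_eq_gram_poly[OF assms] by (rule eq[OF sh])
    have "energy m (- p) = energy m p" by (simp add: energy_def)
    then have "gram m j u A B C D r t (- p) = gram_poly m j u A B C D r t (- cvec p, - (- of_real (energy m p)))"
      unfolding gram_eq_gram_poly[OF assms] by (simp add: cvec_uminus)
    also have "\<dots> = (- 1) ^ (A + D) * gram_poly m j u A B C D r t (cvec p, - of_real (energy m p))"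
      using assms(5,6) by (rule gram_poly_uminus)
    also have "gram_poly m j u A B C D r t (cvec p, - of_real (energy m p)) = R (cvec p) - of_real (energy m p) * S (cvec p)"
      using eq[of "- of_real (energy m p)" "cvec p"] sh[of p] by simp
    finally show "gram m j u A B C D r t (- p) = (- 1) ^ (A + D) * (R (cvec p) - of_real (energy m p) * S (cvec p))" .
  qed
qed

section \<open>Polynomial bounds at real momenta\<close>

lemma tempered_moderate:
  assumes "moderate R"
  shows "tempered (\<lambda>p. R (cvec p))"
proof -
  have n: "norm (cvec p) = norm p" for p
    by (simp add: norm_vec_def)
  have "continuous_on UNIV cvec"
    unfolding cvec_def by (intro continuous_intros)
  then have "continuous_on UNIV (\<lambda>p. R (cvec p))"
    using assms unfolding moderate_def by (auto intro: continuous_on_compose2[of UNIV R])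
  moreover obtain N C where "\<And>q. cmod (R q) \<le> C * (1 + norm q) ^ N"
    using assms unfolding moderate_def by blast
  then have "cmod (R (cvec p)) \<le> C * (1 + norm p) ^ N" for p
    unfolding n[of p, symmetric] .
  ultimately show ?thesis
    unfolding tempered_def by blast
qed

lemma tempered_energy: "m > 0 \<Longrightarrow> tempered (\<lambda>p. of_real (energy m p))"
  unfolding tempered_def
proof (intro conjI exI allI)
  assume m: "m > 0"
  show "continuous_on UNIV (\<lambda>p. complex_of_real (energy m p))"
    by (intro continuous_intros)
  show "cmod (of_real (energy m p)) \<le> (1 + m) * (1 + norm p) ^ 1" for p
  proof -
    have "0 \<le> m * norm p" using m by simp
    then show ?thesis
      using energy_le[OF m, of p] energy_pos[OF m, of p] by (simp add: distrib_right distrib_left add.assoc)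
  qed
qed

lemma tempered_inverse_energy: "m > 0 \<Longrightarrow> tempered (\<lambda>p. of_real (1 / energy m p))"
  unfolding tempered_def
proof (intro conjI exI allI)
  assume m: "m > 0"
  have "energy m p \<noteq> 0" for p using energy_pos[OF m, of p] by simp
  then show "continuous_on UNIV (\<lambda>p. complex_of_real (1 / energy m p))"
    by (intro continuous_intros) auto
  show "cmod (of_real (1 / energy m p)) \<le> 1 / m * (1 + norm p) ^ 0" for p
    using energy_ge[OF m, of p] energy_pos[OF m, of p] m unfolding norm_of_real by (simp add: field_simps)
qed

lemma tempered_gram:
  assumes "m > 0" "rest_coefficients j u v" "admissible j A B" "admissible j C D"
    and "r \<in> components A B" "t \<in> components C D"
  shows "tempered (gram m j u A B C D r t)"
proof -
  obtain R S where RS: "moderate R" "moderate S"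
    and eq: "\<And>p. gram m j u A B C D r t p = R (cvec p) + of_real (energy m p) * S (cvec p)"
    using gram_shell_form[OF assms] by metis
  have "tempered (\<lambda>p. R (cvec p) + of_real (energy m p) * S (cvec p))"
    by (intro tempered_add tempered_mult tempered_energy[OF assms(1)] tempered_moderate RS)
  then show ?thesis
    by (simp only: eq[symmetric])
qed

text \<open>The modes must be bounded one by one, because the brackets of creation and annihilation
  operators are evaluated before the sum over spin components produces the Gram matrix.\<close>

lemma tempered_boosted:
  assumes m: "m > 0"
  shows "tempered (\<lambda>p. boosted m w A B p r \<sigma>)"
proof -
  have alg: "function_algebra {f. tempered f}"
    unfolding function_algebra_def by auto
  have E: "energy m p > 0" for p using m by (rule energy_pos)
  let ?N = "\<lambda>p. sqrt (2 * m * (m + energy m p))"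
  have N: "?N p \<ge> m" for p
  proof (rule real_le_rsqrt)
    have "m * m \<le> m * (m + energy m p)" using m E[of p] by (intro mult_left_mono) auto
    also have "\<dots> \<le> 2 * (m * (m + energy m p))" using m E[of p] by simp
    finally show "m\<^sup>2 \<le> 2 * m * (m + energy m p)" by (simp add: power2_eq_square)
  qed
  have iN: "tempered (\<lambda>p. of_real (1 / ?N p))"
    unfolding tempered_def
  proof (intro conjI exI allI)
    have "?N p \<noteq> 0" for p using N[of p] m by linarith
    then show "continuous_on UNIV (\<lambda>p. complex_of_real (1 / ?N p))"
      by (intro continuous_intros) auto
    show "cmod (of_real (1 / ?N p)) \<le> 1 / m * (1 + norm p) ^ 0" for p
    proof -
      have "0 < ?N p" using N[of p] m by linarith
      then have "1 / ?N p \<le> 1 / m" using N[of p] m by (intro divide_left_mono) auto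
      then show ?thesis using \<open>0 < ?N p\<close> unfolding norm_of_real by (simp del: real_sqrt_mult real_sqrt_gt_0_iff)
    qed
  qed
  have comp: "tempered (\<lambda>p. of_real (p $ i))" for i
    using tempered_moderate[OF moderate_component[of i]] by simp
  have q: "tempered (\<lambda>p. of_real (fst (half_boost m p) $ i))" for i
  proof -
    have "(\<lambda>p. complex_of_real (fst (half_boost m p) $ i)) = (\<lambda>p. of_real (p $ i) * of_real (1 / ?N p))"
      by (simp add: half_boost_def divide_inverse mult.commute)
    then show ?thesis using tempered_mult[OF comp iN] by simp
  qed
  have e: "tempered (\<lambda>p. of_real (snd (half_boost m p)))"
  proof -
    have "(\<lambda>p. complex_of_real (snd (half_boost m p))) = (\<lambda>p. (of_real m + of_real (energy m p)) * of_real (1 / ?N p))"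
      by (simp add: half_boost_def divide_inverse)
    then show ?thesis using tempered_mult[OF tempered_add[OF tempered_const tempered_energy[OF m]] iN] by simp
  qed
  have neg: "tempered (\<lambda>p. - f p)" if "tempered f" for f
    using tempered_mult[OF tempered_const[of "-1"] that] by simp
  have inv: "matrix_inv (dagger (boost m p)) = herm_of (- fst (half_boost m p), snd (half_boost m p))" for p
  proof (rule matrix_inv_eqI)
    let ?q = "fst (half_boost m p)" and ?e = "snd (half_boost m p)"
    have "(of_real ?e)\<^sup>2 - (\<Sum>i\<in>UNIV. (cvec ?q $ i)\<^sup>2) = (1 :: complex)"
      unfolding sum_cvec_sq using half_boost_norm(1)[OF m, of p] by (simp flip: of_real_power of_real_diff)
    then show "dagger (boost m p) ** herm_of (- ?q, ?e) = mat 1"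
      using cherm_mult_uminus[of "cvec ?q" "of_real ?e"] dagger_cherm_real[of ?q ?e] herm_of_eq_cherm[of ?q ?e]
      by (simp add: boost_eq[OF m] herm_of_eq_cherm cvec_uminus)
  qed
  have b1: "tempered (\<lambda>p. boost m p $ k $ l)" for k l
  proof -
    have "boost m p = cherm (cvec (fst (half_boost m p))) (of_real (snd (half_boost m p)))" for p
      using herm_of_eq_cherm[of "fst (half_boost m p)" "snd (half_boost m p)"] by (simp add: boost_eq[OF m])
    then show ?thesis
      using exhaust_2[of k] exhaust_2[of l]
      by (elim disjE) (simp_all, (intro neg tempered_diff tempered_add tempered_mult tempered_const q e)+)
  qed
  have b2: "tempered (\<lambda>p. matrix_inv (dagger (boost m p)) $ k $ l)" for k l
    using exhaust_2[of k] exhaust_2[of l]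
    unfolding inv herm_of_eq_cherm cvec_uminus
    by (elim disjE) (simp_all, (intro neg tempered_diff tempered_add tempered_mult tempered_const q e)+)
  have r1: "tempered (\<lambda>p. spin_rep n (boost m p) i k)"
    and r2: "tempered (\<lambda>p. spin_rep n (matrix_inv (dagger (boost m p))) i k)" for n i k
    using spin_rep_in_function_algebra[OF alg, of "boost m" n i k]
      spin_rep_in_function_algebra[OF alg, of "\<lambda>p. matrix_inv (dagger (boost m p))" n i k] b1 b2 by simp_all
  have "tempered (\<lambda>p. of_real (sqrt (m / energy m p)))"
    unfolding tempered_def
  proof (intro conjI exI allI)
    have "energy m p \<noteq> 0" for p using E[of p] by simp
    then show "continuous_on UNIV (\<lambda>p. complex_of_real (sqrt (m / energy m p)))"
      by (intro continuous_intros) auto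
    show "cmod (of_real (sqrt (m / energy m p))) \<le> 1 * (1 + norm p) ^ 0" for p
      using energy_ge[OF m, of p] E[of p] m by simp
  qed
  then show ?thesis
    unfolding boosted_def rep_AB_def by (intro tempered_mult tempered_sum tempered_const r1 r2)
qed

lemma boosted_gram:
  assumes m: "m > 0"
  shows "(\<Sum>\<sigma>\<le>j. boosted m u A B p r \<sigma> * cnj (boosted m u C D p t \<sigma>)) =
    of_real (m / energy m p) * gram m j u A B C D r t p"
proof -
  have "complex_of_real (sqrt (m / energy m p)) * of_real (sqrt (m / energy m p)) = of_real (m / energy m p)"
    using m energy_pos[OF m, of p] by (simp flip: of_real_mult)
  moreover have "cnj c = c \<Longrightarrow> c * x * cnj (c * y) = (c * c) * (x * cnj y)" for c x y
    by (simp add: mult_ac)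
  ultimately show ?thesis
    unfolding boosted_def gram_def sum_distrib_left[of _ _ "{..j}"] by (simp only: complex_cnj_complex_of_real)
qed

text \<open>The phase convention in \<open>rest_coefficients\<close> equates the rest-frame Gram
  matrices of particle and antiparticle, and the boosts act alike on both.\<close>

lemma gram_rest_coefficients:
  assumes "rest_coefficients j u v" "admissible j A B" "admissible j C D"
  shows "gram m j v A B C D r t p = gram m j u A B C D r t p"
proof -
  have exp: "gram m j w A B C D r t p =
      (\<Sum>s\<in>components A B. \<Sum>s'\<in>components C D. rep_AB A B (boost m p) r s * cnj (rep_AB C D (boost m p) t s') * (\<Sum>\<sigma>\<le>j. w A B s \<sigma> * cnj (w C D s' \<sigma>)))" for w
  proof -
    have "gram m j w A B C D r t p =
      (\<Sum>\<sigma>\<le>j. \<Sum>s\<in>components A B. \<Sum>s'\<in>components C D. rep_AB A B (boost m p) r s * cnj (rep_AB C D (boost m p) t s') * (w A B s \<sigma> * cnj (w C D s' \<sigma>)))"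
      unfolding gram_def by (simp add: cnj_sum sum_product mult_ac)
    also have "\<dots> = (\<Sum>s\<in>components A B. \<Sum>s'\<in>components C D. rep_AB A B (boost m p) r s * cnj (rep_AB C D (boost m p) t s') * (\<Sum>\<sigma>\<le>j. w A B s \<sigma> * cnj (w C D s' \<sigma>)))"
      unfolding sum_distrib_left
      by (subst sum.swap, rule sum.cong[OF refl], rule sum.swap)
    finally show ?thesis .
  qed
  have eq: "(\<Sum>\<sigma>\<le>j. u A B s \<sigma> * cnj (u C D s' \<sigma>)) = (\<Sum>\<sigma>\<le>j. v A B s \<sigma> * cnj (v C D s' \<sigma>))"
    if "s \<in> components A B" "s' \<in> components C D" for s s'
    using conjunct2[OF assms(1)[unfolded rest_coefficients_def], rule_format, OF assms(2,3) that] .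
  show ?thesis
    unfolding exp by (rule sum.cong[OF refl], rule sum.cong[OF refl]) (simp only: eq)
qed

section \<open>Decay at space-like separation\<close>

text \<open>With \<open>sinc_sqrt\<close>, the even functions of the energy rewritten as functions
  of its square. The principal root has a branch cut, but either root gives the same value, and the
  power series show both functions to be entire.\<close>

definition cos_sqrt :: "complex \<Rightarrow> complex" where
  "cos_sqrt z = cos (csqrt z)"

definition sinc_sqrt :: "complex \<Rightarrow> complex" where
  "sinc_sqrt z = (if z = 0 then 1 else sin (csqrt z) / csqrt z)"

lemma cos_sqrt_sq: "cos_sqrt (e\<^sup>2) = cos e"
  using power2_csqrt[of "e\<^sup>2"] unfolding power2_eq_iff by (auto simp: cos_sqrt_def)

lemma sinc_sqrt_sq: "e * sinc_sqrt (e\<^sup>2) = sin e"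
  using power2_csqrt[of "e\<^sup>2"] unfolding power2_eq_iff by (auto simp: sinc_sqrt_def)

lemma holomorphic_on_UNIV_power_series:
  assumes "\<And>z. (\<lambda>n. a n * z ^ n) sums f z"
  shows "f holomorphic_on UNIV"
proof -
  have "f holomorphic_on ball 0 r" for r
    by (rule power_series_holomorphic[of _ _ a]) (use assms in simp)
  then have "f field_differentiable (at z)" for z
    by (rule holomorphic_on_imp_differentiable_at[of _ "ball 0 (norm z + 1)"]) auto
  then show ?thesis by (simp add: holomorphic_on_def)
qed

lemma cos_sqrt_holomorphic: "cos_sqrt holomorphic_on UNIV"
proof (rule holomorphic_on_UNIV_power_series)
  fix z
  have grp: "{n * 2..<n * 2 + 2} = {2 * n, Suc (2 * n)}" for n :: nat by auto
  \<comment> \<open>Grouped in pairs, the series of the cosine keeps its even terms only, and these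
    are powers of \<open>z\<close>.\<close>
  have "(\<lambda>n. sum (\<lambda>n. cos_coeff n *\<^sub>R csqrt z ^ n) {n * 2..<n * 2 + 2}) sums cos (csqrt z)"
    by (rule sums_group[OF cos_converges]) simp
  then show "(\<lambda>n. of_real ((- 1) ^ n / fact (2 * n)) * z ^ n) sums cos_sqrt z"
    unfolding grp by (simp add: cos_coeff_def power_mult scaleR_conv_of_real cos_sqrt_def)
qed

lemma sinc_sqrt_holomorphic: "sinc_sqrt holomorphic_on UNIV"
proof (rule holomorphic_on_UNIV_power_series)
  fix z
  let ?a = "\<lambda>n. complex_of_real ((- 1) ^ n / fact (2 * n + 1))"
  show "(\<lambda>n. ?a n * z ^ n) sums sinc_sqrt z"
  proof (cases "z = 0")
    case True
    then show ?thesis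
      using sums_single[of 0 "\<lambda>n. ?a n * z ^ n"] by (simp add: sinc_sqrt_def sums_iff power_0_left mult_delta_right del: fact_Suc of_real_divide cong: if_cong)
  next
    case False
    let ?e = "csqrt z"
    have grp: "{n * 2..<n * 2 + 2} = {2 * n, Suc (2 * n)}" for n :: nat by auto
    have "(\<lambda>n. sum (\<lambda>n. sin_coeff n *\<^sub>R ?e ^ n) {n * 2..<n * 2 + 2}) sums sin ?e"
      by (rule sums_group[OF sin_converges]) simp
    then have "(\<lambda>n. ?a n * ?e ^ Suc (2 * n)) sums sin ?e"
      unfolding grp by (simp add: sin_coeff_def scaleR_conv_of_real del: power_Suc fact_Suc)
    then have "(\<lambda>n. ?a n * ?e ^ Suc (2 * n) / ?e) sums (sin ?e / ?e)"
      by (rule sums_divide)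
    moreover have "?a n * ?e ^ Suc (2 * n) / ?e = ?a n * z ^ n" for n
      using False by (simp add: power_mult)
    ultimately show ?thesis using False by (simp only: sinc_sqrt_def if_False)
  qed
qed

lemma norm_cos_le_exp_Im: "cmod (cos e) \<le> exp \<bar>Im e\<bar>"
proof -
  have "cmod (cos e) = cmod (exp (\<i> * e) + exp (- (\<i> * e))) / 2"
    by (simp add: cos_exp_eq norm_divide)
  also have "cmod (exp (\<i> * e) + exp (- (\<i> * e))) \<le> exp (- Im e) + exp (Im e)"
    using norm_triangle_ineq[of "exp (\<i> * e)" "exp (- (\<i> * e))"] by simp
  then have "cmod (exp (\<i> * e) + exp (- (\<i> * e))) / 2 \<le> (exp (- Im e) + exp (Im e)) / 2"
    by simp
  also have "\<dots> \<le> exp \<bar>Im e\<bar>"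
  proof -
    have "exp (- Im e) \<le> exp \<bar>Im e\<bar>" "exp (Im e) \<le> exp \<bar>Im e\<bar>" by simp_all
    from add_mono[OF this] show ?thesis by simp
  qed
  finally show ?thesis .
qed

text \<open>Dividing a bound on the sine by \<open>e\<close> would lose control near 0. The mean
  value inequality on the convex strip of bounded imaginary part yields the factor
  \<open>cmod e\<close> that cancels the division.\<close>

lemma norm_sinc_sqrt_le_exp_Im: "cmod (sinc_sqrt (e\<^sup>2)) \<le> exp \<bar>Im e\<bar>"
proof (cases "e = 0")
  case False
  have "cmod (sin e - sin 0) \<le> exp \<bar>Im e\<bar> * cmod (e - 0)"
  proof (rule field_differentiable_bound[of "{z. Im z \<le> \<bar>Im e\<bar>} \<inter> {z. Im z \<ge> - \<bar>Im e\<bar>}" sin cos])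
    show "convex ({z. Im z \<le> \<bar>Im e\<bar>} \<inter> {z. Im z \<ge> - \<bar>Im e\<bar>})"
      by (intro convex_Int convex_halfspace_Im_le convex_halfspace_Im_ge)
    show "cmod (cos z) \<le> exp \<bar>Im e\<bar>" if "z \<in> {z. Im z \<le> \<bar>Im e\<bar>} \<inter> {z. Im z \<ge> - \<bar>Im e\<bar>}" for z
      proof -
      have "\<bar>Im z\<bar> \<le> \<bar>Im e\<bar>" using that by (simp add: abs_le_iff)
      then show ?thesis using norm_cos_le_exp_Im[of z] exp_le_cancel_iff[of "\<bar>Im z\<bar>" "\<bar>Im e\<bar>"] by linarith
    qed
    show "(sin has_field_derivative cos z) (at z within {z. Im z \<le> \<bar>Im e\<bar>} \<inter> {z. Im z \<ge> - \<bar>Im e\<bar>})" for z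
      by (rule has_field_derivative_at_within[OF DERIV_sin])
    show "e \<in> {z. Im z \<le> \<bar>Im e\<bar>} \<inter> {z. Im z \<ge> - \<bar>Im e\<bar>}" by (simp add: abs_if)
    show "0 \<in> {z. Im z \<le> \<bar>Im e\<bar>} \<inter> {z. Im z \<ge> - \<bar>Im e\<bar>}" by simp
  qed
  then have "cmod (e * sinc_sqrt (e\<^sup>2)) \<le> exp \<bar>Im e\<bar> * cmod e"
    by (simp add: sinc_sqrt_sq)
  then show ?thesis using False by (simp add: norm_mult mult.commute)
qed (simp add: sinc_sqrt_def)

definition shell_sq :: "real \<Rightarrow> complex ^ 3 \<Rightarrow> complex" where
  "shell_sq m q = of_real (m\<^sup>2) + (\<Sum>i\<in>UNIV. (q $ i)\<^sup>2)"

lemma sum_line_sq: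
  assumes n: "norm (n :: real ^ 3) = 1"
  shows "(\<Sum>i\<in>UNIV. (complex_of_real (p $ i) + \<i> * of_real y * of_real (n $ i))\<^sup>2) =
    of_real ((norm p)\<^sup>2 - y\<^sup>2) + \<i> * of_real (2 * y * (p \<bullet> n))"
proof -
  have n2: "(n $ 1)\<^sup>2 + (n $ 2)\<^sup>2 + (n $ 3)\<^sup>2 = 1"
    using norm_sq_vec3[of n] n by (simp add: sum_3)
  have "y\<^sup>2 = y\<^sup>2 * ((n $ 1)\<^sup>2 + (n $ 2)\<^sup>2 + (n $ 3)\<^sup>2)" using n2 by simp
  then show ?thesis
    unfolding complex_eq_iff norm_sq_vec3
    by (simp add: sum_3 inner_vec_def power2_eq_square algebra_simps)
qed

text \<open>Moving a real momentum by \<open>iy\<close> in a unit direction changes the imaginary part of the energy by at most \<open>y\<close>.\<close>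

lemma abs_Im_shell_le:
  assumes n: "norm (n :: real ^ 3) = 1"
    and e: "e\<^sup>2 = shell_sq m (\<chi> i. of_real (p $ i) + \<i> * of_real y * of_real (n $ i))"
  shows "\<bar>Im e\<bar> \<le> \<bar>y\<bar>"
proof (rule ccontr)
  define a b where "a = Re e" "b = Im e"
  \<comment> \<open>The shell equation says a^2 - b^2 = m^2 + |p|^2 - y^2 and a b = y (p \<bullet>
    n). With b^2 > y^2 the first gives a^2 > |p|^2, and the product a b becomes larger than
    Cauchy-Schwarz allows in the second.\<close>
  assume "\<not> \<bar>Im e\<bar> \<le> \<bar>y\<bar>"
  then have b: "b\<^sup>2 > y\<^sup>2" by (simp add: a_b_def abs_le_square_iff)
  have "e\<^sup>2 = of_real (m\<^sup>2 + (norm p)\<^sup>2 - y\<^sup>2) + \<i> * of_real (2 * y * (p \<bullet> n))"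
    using e sum_line_sq[OF n, of p y] by (simp add: shell_sq_def)
  from arg_cong[OF this, of Re] arg_cong[OF this, of Im]
  have 1: "a\<^sup>2 - b\<^sup>2 = m\<^sup>2 + (norm p)\<^sup>2 - y\<^sup>2" and 2: "a * b = y * (p \<bullet> n)"
    by (simp_all add: a_b_def power2_eq_square mult.commute)
  have "\<bar>p \<bullet> n\<bar> \<le> \<bar>norm p\<bar>"
    using Cauchy_Schwarz_ineq2[of p n] n by simp
  then have "(p \<bullet> n)\<^sup>2 \<le> (norm p)\<^sup>2"
    unfolding abs_le_square_iff .
  then have "(a * b)\<^sup>2 \<le> (norm p)\<^sup>2 * y\<^sup>2"
    unfolding 2 power_mult_distrib by (subst mult.commute) (rule mult_right_mono, simp_all)
  moreover have a: "a\<^sup>2 > (norm p)\<^sup>2" using 1 b zero_le_power2[of m] by linarith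
  have "(norm p)\<^sup>2 * y\<^sup>2 < a\<^sup>2 * b\<^sup>2"
    by (rule mult_strict_mono'[OF a b]) simp_all
  then have "(norm p)\<^sup>2 * y\<^sup>2 < (a * b)\<^sup>2"
    unfolding power_mult_distrib .
  ultimately show False by linarith
qed

section \<open>Gaussian-regularised kernels and the contour shift\<close>

text \<open>The point is that the constant is polynomial in \<open>1 / \<epsilon>\<close>; the
  exponential gain of the contour shift has to beat it.\<close>

lemma gaussian_power_bound:
  fixes x :: real
  assumes "0 < \<epsilon>" "\<epsilon> \<le> 1" "x \<ge> 0"
  shows "(1 + x) ^ k * exp (- \<epsilon> * x\<^sup>2) \<le> (2 / \<epsilon>) ^ k * fact k * exp 1"
proof -
  have "1 + x \<le> 2 / \<epsilon> * (1 + \<epsilon> * x\<^sup>2)"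
  proof -
    have "x * 2 \<le> 1 + x\<^sup>2" using zero_le_power2[of "x - 1"] by (simp add: power2_eq_square algebra_simps)
    then have "1 + x \<le> 2 + 2 * x\<^sup>2" using zero_le_power2[of x] by linarith
    also have "2 + 2 * x\<^sup>2 \<le> 2 / \<epsilon> * (1 + \<epsilon> * x\<^sup>2)"
      using assms by (simp add: distrib_left field_simps)
    finally show ?thesis .
  qed
  then have "(1 + x) ^ k \<le> (2 / \<epsilon> * (1 + \<epsilon> * x\<^sup>2)) ^ k"
    using assms by (intro power_mono) auto
  also have "\<dots> \<le> (2 / \<epsilon>) ^ k * (fact k * exp (1 + \<epsilon> * x\<^sup>2))"
    unfolding power_mult_distrib using assms by (intro mult_left_mono power_le_fact_exp) auto
  finally have "(1 + x) ^ k * exp (- \<epsilon> * x\<^sup>2) \<le> (2 / \<epsilon>) ^ k * (fact k * exp (1 + \<epsilon> * x\<^sup>2)) * exp (- \<epsilon> * x\<^sup>2)"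
    by (intro mult_right_mono) auto
  also have "\<dots> = (2 / \<epsilon>) ^ k * fact k * exp 1"
    by (simp add: exp_add exp_minus mult.assoc)
  finally show ?thesis .
qed

text \<open>
  An entire integrand of rapid decay may be integrated over $\mathbb{R}^3 + w\,\mathbf{n}$ for any
  complex \<open>w\<close>: the integral is entire in \<open>w\<close> and, by translation, constant for real \<open>w\<close>.
\<close>

lemma integral_contour_shift:
  fixes F :: "complex ^ 3 \<Rightarrow> complex" and n :: "real ^ 3"
  defines "q \<equiv> \<lambda>w p. (\<chi> i. of_real (p $ i) + w * of_real (n $ i)) :: complex ^ 3"
  assumes cont: "continuous_on UNIV F"
    and hol: "\<And>p. (\<lambda>w. F (q w p)) holomorphic_on UNIV"
    and bound: "\<And>r. \<exists>C. \<forall>w p. cmod w \<le> r \<longrightarrow> cmod (F (q w p)) \<le> C * (1 / (1 + norm p) ^ 5)"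
  shows "(LINT p|lborel. F (q w p)) = (LINT p|lborel. F (cvec p))"
proof -
  have cq: "continuous_on UNIV (q w)" for w
    unfolding q_def by (intro continuous_intros)
  have cF: "continuous_on UNIV (\<lambda>p. F (q w p))" for w
    by (rule continuous_on_compose2[OF cont cq]) simp
  have hJ: "(\<lambda>w. LINT p|lborel. F (q w p)) holomorphic_on UNIV"
  proof (rule holomorphic_on_integral)
    show "(\<lambda>p. F (q w p)) \<in> borel_measurable lborel" for w
      using borel_measurable_continuous_onI[OF cF] by simp
    fix w :: complex
    obtain C where C: "\<And>v p. cmod v \<le> cmod w + 1 \<Longrightarrow> cmod (F (q v p)) \<le> C * (1 / (1 + norm p) ^ 5)"
      using bound[of "cmod w + 1"] by auto
    have "cmod v \<le> cmod w + 1" if "v \<in> ball w 1" for v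
      using that norm_triangle_ineq2[of v w] by (simp add: dist_norm norm_minus_commute)
    then show "\<exists>r>0. \<exists>B. integrable lborel B \<and> (\<forall>v\<in>ball w r \<inter> UNIV. \<forall>x\<in>space lborel. cmod (F (q v x)) \<le> B x)"
      using C integrable_mult_right[OF integrable_decay, of C]
      by (intro exI[of _ 1] conjI exI[of _ "\<lambda>p. C * (1 / (1 + norm p) ^ 5)"]) auto
  qed (use hol in auto)
  have q0: "cvec p = q 0 p" for p by (simp add: q_def cvec_def)
  have "(LINT p|lborel. F (q w p)) - (LINT p|lborel. F (q 0 p)) = 0"
  proof (rule analytic_continuation[of "\<lambda>w. (LINT p|lborel. F (q w p)) - (LINT p|lborel. F (q 0 p))" UNIV "\<real>" 0])
    show "(\<lambda>w. (LINT p|lborel. F (q w p)) - (LINT p|lborel. F (q 0 p))) holomorphic_on UNIV"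
      by (intro holomorphic_on_diff hJ holomorphic_on_const)
    show "(0 :: complex) islimpt \<real>"
      unfolding islimpt_approachable
    proof (intro allI impI)
      fix d :: real assume "d > 0"
      then show "\<exists>x'\<in>\<real>. x' \<noteq> 0 \<and> dist x' (0 :: complex) < d"
        by (intro bexI[of _ "of_real (d / 2)"]) auto
    qed
    fix z :: complex assume "z \<in> \<real>"
    then obtain a where a: "z = of_real a" by (auto elim: Reals_cases)
    have "q z p = q 0 (p + a *\<^sub>R n)" for p by (simp add: q_def a)
    then show "(LINT p|lborel. F (q z p)) - (LINT p|lborel. F (q 0 p)) = 0"
      using lborel_integral_shift[OF borel_measurable_continuous_onI[OF cF[of 0]], of "a *\<^sub>R n"] by simp
  qed auto
  then show ?thesis by (simp add: q0)
qed

text \<open>On the real shell this is ((R + E S) exp(-i E t) - (R - E S) exp(i E t)) / E, as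
  \<open>shell_kernel_real\<close> shows. In the present form the energy enters through its square
  only, so the expression makes sense, and is holomorphic, at complex momenta.\<close>

definition shell_kernel :: "real \<Rightarrow> (complex ^ 3 \<Rightarrow> complex) \<Rightarrow> (complex ^ 3 \<Rightarrow> complex) \<Rightarrow> real \<Rightarrow> complex ^ 3 \<Rightarrow> complex" where
  "shell_kernel m R S t q =
     - 2 * \<i> * R q * (of_real t * sinc_sqrt ((of_real t)\<^sup>2 * shell_sq m q)) +
     2 * S q * cos_sqrt ((of_real t)\<^sup>2 * shell_sq m q)"

definition gauss_kernel ::
  "real \<Rightarrow> real \<Rightarrow> (complex ^ 3 \<Rightarrow> complex) \<Rightarrow> (complex ^ 3 \<Rightarrow> complex) \<Rightarrow> real ^ 3 \<Rightarrow> real \<Rightarrow> complex ^ 3 \<Rightarrow> complex" where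
  "gauss_kernel \<epsilon> m R S x t q =
     exp (- of_real \<epsilon> * (\<Sum>i\<in>UNIV. (q $ i)\<^sup>2) + \<i> * (\<Sum>i\<in>UNIV. q $ i * of_real (x $ i))) * shell_kernel m R S t q"

lemma norm_cvec: "norm (cvec p) = norm p"
  by (simp add: norm_vec_def)

text \<open>The exponent collects the Gaussian at the shifted momentum
  (\<open>\<epsilon> * y\<^sup>2\<close>), the plane wave (\<open>- y * (n \<bullet> x)\<close>) and
  the growth of cosine and sine in the imaginary part of the energy (at most
  \<open>\<bar>t\<bar> * \<bar>y\<bar>\<close>). The remaining Gaussian in \<open>norm P\<close>
  pays for the growth of order \<open>N\<close> and for the five powers of
  \<open>integrable_decay\<close>.\<close>

lemma norm_gauss_kernel_le:
  fixes P n x :: "real ^ 3" and y t :: real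
  assumes R: "\<And>q. cmod (R q) \<le> C * (1 + norm q) ^ N" and S: "\<And>q. cmod (S q) \<le> C * (1 + norm q) ^ N"
    and C: "C \<ge> 0" and n: "norm n = 1" and \<epsilon>: "0 < \<epsilon>" "\<epsilon> \<le> 1"
  defines "q \<equiv> (\<chi> i. of_real (P $ i) + \<i> * of_real y * of_real (n $ i))"
  shows "cmod (gauss_kernel \<epsilon> m R S x t q) \<le>
    exp (\<epsilon> * y\<^sup>2 - y * (n \<bullet> x) + \<bar>t\<bar> * \<bar>y\<bar>) * (2 * C * (1 + \<bar>t\<bar>) * (1 + \<bar>y\<bar>) ^ N) *
      ((2 / \<epsilon>) ^ (N + 5) * fact (N + 5) * exp 1) * (1 / (1 + norm P) ^ 5)"
proof -
  define e where "e = csqrt (shell_sq m q)"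
  have e: "e\<^sup>2 = shell_sq m q" by (simp add: e_def)
  have im: "\<bar>Im e\<bar> \<le> \<bar>y\<bar>"
    using e unfolding q_def by (rule abs_Im_shell_le[OF n])
  have te: "(of_real t)\<^sup>2 * shell_sq m q = (of_real t * e)\<^sup>2"
    by (simp add: power_mult_distrib e)
  have imt: "\<bar>Im (of_real t * e)\<bar> \<le> \<bar>t\<bar> * \<bar>y\<bar>"
    using im by (simp add: abs_mult mult_left_mono)
  have exp_le: "exp \<bar>Im (of_real t * e)\<bar> \<le> exp (\<bar>t\<bar> * \<bar>y\<bar>)"
    using imt by simp
  have nq: "norm q \<le> norm P + \<bar>y\<bar>"
  proof -
    have "q = cvec P + (\<chi> i. \<i> * of_real y * of_real (n $ i))"
      by (simp add: q_def vec_eq_iff)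
    also have "norm \<dots> \<le> norm (cvec P) + norm ((\<chi> i. \<i> * of_real y * of_real (n $ i)) :: complex ^ 3)"
      by (rule norm_triangle_ineq)
    also have "norm ((\<chi> i. \<i> * of_real y * of_real (n $ i)) :: complex ^ 3) = norm (y *\<^sub>R n)"
      unfolding norm_vec_def by (simp add: norm_mult abs_mult)
    finally show ?thesis using n by (simp add: norm_cvec)
  qed
  have grow: "(1 + norm q) ^ N \<le> (1 + norm P) ^ N * (1 + \<bar>y\<bar>) ^ N"
  proof -
    have "0 \<le> norm P * \<bar>y\<bar>" by simp
    then have "1 + norm q \<le> (1 + norm P) * (1 + \<bar>y\<bar>)"
      using nq unfolding distrib_left distrib_right by linarith
    then show ?thesis
      unfolding power_mult_distrib[symmetric] by (intro power_mono) auto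
  qed
  define K where "K = C * ((1 + norm P) ^ N * (1 + \<bar>y\<bar>) ^ N)"
  have K: "cmod (R q) \<le> K" "cmod (S q) \<le> K" "K \<ge> 0"
    using order_trans[OF R[of q] mult_left_mono[OF grow C]] order_trans[OF S[of q] mult_left_mono[OF grow C]] C
    by (simp_all add: K_def)
  have k: "cmod (shell_kernel m R S t q) \<le> (2 * K * (1 + \<bar>t\<bar>)) * exp (\<bar>t\<bar> * \<bar>y\<bar>)"
  proof -
    have "cmod (- 2 * \<i> * R q * (of_real t * sinc_sqrt ((of_real t * e)\<^sup>2))) =
        2 * (cmod (R q) * (\<bar>t\<bar> * cmod (sinc_sqrt ((of_real t * e)\<^sup>2))))"
      by (simp add: norm_mult)
    also have "\<dots> \<le> 2 * (K * (\<bar>t\<bar> * exp (\<bar>t\<bar> * \<bar>y\<bar>)))"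
      by (intro mult_left_mono mult_mono K order_trans[OF norm_sinc_sqrt_le_exp_Im exp_le]) (use K in auto)
    finally have 1: "cmod (- 2 * \<i> * R q * (of_real t * sinc_sqrt ((of_real t * e)\<^sup>2))) \<le> 2 * (K * (\<bar>t\<bar> * exp (\<bar>t\<bar> * \<bar>y\<bar>)))" .
    have "cmod (2 * S q * cos_sqrt ((of_real t * e)\<^sup>2)) = 2 * (cmod (S q) * cmod (cos (of_real t * e)))"
      by (simp add: norm_mult cos_sqrt_sq)
    also have "\<dots> \<le> 2 * (K * exp (\<bar>t\<bar> * \<bar>y\<bar>))"
      by (intro mult_left_mono mult_mono K order_trans[OF norm_cos_le_exp_Im exp_le]) (use K in auto)
    finally have 2: "cmod (2 * S q * cos_sqrt ((of_real t * e)\<^sup>2)) \<le> 2 * (K * exp (\<bar>t\<bar> * \<bar>y\<bar>))" .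
    have "cmod (shell_kernel m R S t q) \<le> 2 * (K * (\<bar>t\<bar> * exp (\<bar>t\<bar> * \<bar>y\<bar>))) + 2 * (K * exp (\<bar>t\<bar> * \<bar>y\<bar>))"
      unfolding shell_kernel_def te by (rule order_trans[OF norm_triangle_ineq add_mono[OF 1 2]])
    then show ?thesis by (simp add: algebra_simps)
  qed
  have sq: "(\<Sum>i\<in>UNIV. (q $ i)\<^sup>2) = of_real ((norm P)\<^sup>2 - y\<^sup>2) + \<i> * of_real (2 * y * (P \<bullet> n))"
    using sum_line_sq[OF n, of P y] by (simp add: q_def)
  have Im_lin: "Im (\<Sum>i\<in>UNIV. q $ i * of_real (x $ i)) = y * (n \<bullet> x)"
    by (simp add: q_def inner_vec_def sum_distrib_left mult_ac)
  have ex: "cmod (exp (- of_real \<epsilon> * (\<Sum>i\<in>UNIV. (q $ i)\<^sup>2) + \<i> * (\<Sum>i\<in>UNIV. q $ i * of_real (x $ i)))) =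
      exp (\<epsilon> * y\<^sup>2 - y * (n \<bullet> x)) * exp (- \<epsilon> * (norm P)\<^sup>2)"
  proof -
    define Q L where "Q = (\<Sum>i\<in>UNIV. (q $ i)\<^sup>2)" and "L = (\<Sum>i\<in>UNIV. q $ i * of_real (x $ i))"
    have "Re (- of_real \<epsilon> * Q + \<i> * L) = - \<epsilon> * ((norm P)\<^sup>2 - y\<^sup>2) - y * (n \<bullet> x)"
      using sq Im_lin by (simp add: Q_def[symmetric] L_def[symmetric])
    also have "\<dots> = (\<epsilon> * y\<^sup>2 - y * (n \<bullet> x)) + (- \<epsilon> * (norm P)\<^sup>2)"
      by (simp add: algebra_simps)
    finally show ?thesis
      unfolding norm_exp_eq_Re exp_add[symmetric] Q_def L_def by (rule arg_cong)
  qed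
  have g: "(1 + norm P) ^ N * exp (- \<epsilon> * (norm P)\<^sup>2) \<le> ((2 / \<epsilon>) ^ (N + 5) * fact (N + 5) * exp 1) * (1 / (1 + norm P) ^ 5)"
  proof -
    have "(1 + norm P) ^ 5 > 0" by (intro zero_less_power) (simp add: add_pos_nonneg)
    moreover have "(1 + norm P) ^ (N + 5) * exp (- \<epsilon> * (norm P)\<^sup>2) \<le> (2 / \<epsilon>) ^ (N + 5) * fact (N + 5) * exp 1"
      by (rule gaussian_power_bound[OF \<epsilon>]) simp
    ultimately show ?thesis
      by (simp add: power_add pos_le_divide_eq mult_ac del: fact_Suc)
  qed
  have "cmod (gauss_kernel \<epsilon> m R S x t q) \<le>
      (exp (\<epsilon> * y\<^sup>2 - y * (n \<bullet> x)) * exp (- \<epsilon> * (norm P)\<^sup>2)) * ((2 * K * (1 + \<bar>t\<bar>)) * exp (\<bar>t\<bar> * \<bar>y\<bar>))"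
    unfolding gauss_kernel_def norm_mult ex by (intro mult_left_mono k) simp
  also have "\<dots> = (exp (\<epsilon> * y\<^sup>2 - y * (n \<bullet> x)) * exp (\<bar>t\<bar> * \<bar>y\<bar>)) * (2 * C * (1 + \<bar>t\<bar>) * (1 + \<bar>y\<bar>) ^ N) *
      ((1 + norm P) ^ N * exp (- \<epsilon> * (norm P)\<^sup>2))"
    by (simp only: K_def mult_ac)
  also have "\<dots> \<le> (exp (\<epsilon> * y\<^sup>2 - y * (n \<bullet> x)) * exp (\<bar>t\<bar> * \<bar>y\<bar>)) * (2 * C * (1 + \<bar>t\<bar>) * (1 + \<bar>y\<bar>) ^ N) *
      (((2 / \<epsilon>) ^ (N + 5) * fact (N + 5) * exp 1) * (1 / (1 + norm P) ^ 5))"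
    by (rule mult_left_mono[OF g]) (use C in simp)
  finally show ?thesis
    by (simp only: exp_add[symmetric] mult.assoc)
qed

text \<open>The shift goes in the direction of \<open>x\<close>, where the plane wave decays at the
  best rate, \<open>y * norm x\<close>; at space-like separation this outweighs the growth
  \<open>\<bar>t\<bar> * y\<close>.\<close>

lemma gauss_kernel_integral_le:
  fixes x :: "real ^ 3" and y t :: real
  assumes mR: "moderate R" and mS: "moderate S"
    and R: "\<And>q. cmod (R q) \<le> C * (1 + norm q) ^ N" and S: "\<And>q. cmod (S q) \<le> C * (1 + norm q) ^ N"
    and C: "C \<ge> 0" and \<epsilon>: "0 < \<epsilon>" "\<epsilon> \<le> 1" and y: "y \<ge> 0"
  shows "cmod (LINT p|lborel. gauss_kernel \<epsilon> m R S x t (cvec p)) \<le>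
    exp (\<epsilon> * y\<^sup>2 - y * norm x + \<bar>t\<bar> * y) * (2 * C * (1 + \<bar>t\<bar>) * (1 + y) ^ N) *
      ((2 / \<epsilon>) ^ (N + 5) * fact (N + 5) * exp 1) * (LINT p|lborel. 1 / (1 + norm (p :: real ^ 3)) ^ 5)"
proof -
  obtain n :: "real ^ 3" where n: "norm n = 1" "n \<bullet> x = norm x"
  proof (cases "x = 0")
    case True
    then show ?thesis using that[of "axis 1 1"] by simp
  next
    case False
    then show ?thesis using that[of "x /\<^sub>R norm x"] by (simp add: dot_square_norm power2_eq_square)
  qed
  let ?F = "gauss_kernel \<epsilon> m R S x t"
  let ?q = "\<lambda>w p. (\<chi> i. of_real (p $ i) + w * of_real (n $ i)) :: complex ^ 3"
  note b = norm_gauss_kernel_le[OF R S C n(1) \<epsilon>, where x = x and t = t and m = m]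
  have cos_c: "continuous_on UNIV cos_sqrt" and sin_c: "continuous_on UNIV sinc_sqrt"
    by (intro holomorphic_on_imp_continuous_on cos_sqrt_holomorphic sinc_sqrt_holomorphic)+
  have c: "continuous_on UNIV R" "continuous_on UNIV S" using mR mS by (auto simp: moderate_def)
  have shift: "(LINT p|lborel. ?F (cvec p)) = (LINT p|lborel. ?F (?q (\<i> * of_real y) p))"
  proof (rule integral_contour_shift[symmetric])
    show "continuous_on UNIV ?F"
      unfolding gauss_kernel_def shell_kernel_def shell_sq_def
      by (intro continuous_intros c continuous_on_compose2[OF cos_c] continuous_on_compose2[OF sin_c]) auto
    fix p :: "real ^ 3"
    have comp: "(\<lambda>w. f (g w)) holomorphic_on UNIV" if "f holomorphic_on UNIV" "g holomorphic_on UNIV" for f g :: "complex \<Rightarrow> complex"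
      using holomorphic_on_compose_gen[OF that(2,1)] by (simp add: o_def)
    have hR: "(\<lambda>w. R (?q w p)) holomorphic_on UNIV" and hS: "(\<lambda>w. S (?q w p)) holomorphic_on UNIV"
    proof -
      have "?q w p = (\<chi> i. cvec p $ i + w * cvec n $ i)" for w by (simp add: vec_eq_iff)
      moreover have "(\<lambda>w. R (\<chi> i. cvec p $ i + w * cvec n $ i)) holomorphic_on UNIV"
        "(\<lambda>w. S (\<chi> i. cvec p $ i + w * cvec n $ i)) holomorphic_on UNIV"
        using mR mS unfolding moderate_def by blast+
      ultimately show "(\<lambda>w. R (?q w p)) holomorphic_on UNIV" "(\<lambda>w. S (?q w p)) holomorphic_on UNIV"
        by (simp_all only:)
    qed
    show "(\<lambda>w. ?F (?q w p)) holomorphic_on UNIV"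
      unfolding gauss_kernel_def shell_kernel_def shell_sq_def
      by (intro holomorphic_intros hR hS comp[OF cos_sqrt_holomorphic] comp[OF sinc_sqrt_holomorphic]) (auto intro!: holomorphic_intros)
  next
    fix r :: real
    define D where "D = exp (\<epsilon> * r\<^sup>2 + r * norm x + \<bar>t\<bar> * r) * (2 * C * (1 + \<bar>t\<bar>) * (1 + r) ^ N) *
      ((2 / \<epsilon>) ^ (N + 5) * fact (N + 5) * exp 1)"
    have "cmod (?F (?q w p)) \<le> (D * (1 + r) ^ 5) * (1 / (1 + norm p) ^ 5)" if w: "cmod w \<le> r" for w p
    proof -
      define a z where "a = Re w" "z = Im w"
      have az: "\<bar>a\<bar> \<le> r" "\<bar>z\<bar> \<le> r" "r \<ge> 0"
        using w abs_Re_le_cmod[of w] abs_Im_le_cmod[of w] by (simp_all add: a_z_def)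
      \<comment> \<open>The real part of the shift is absorbed into the base point, so that only the
        imaginary part enters the kernel bound; comparing \<open>norm p\<close> with
        \<open>norm P\<close> costs a factor \<open>(1 + r) ^ 5\<close>.\<close>
      define P where "P = p + a *\<^sub>R n"
      have q: "?q w p = (\<chi> i. of_real (P $ i) + \<i> * of_real z * of_real (n $ i))"
      proof -
        have "w = of_real a + \<i> * of_real z" by (simp add: a_z_def complex_eq_iff)
        then show ?thesis by (simp add: P_def vec_eq_iff distrib_right)
      qed
      have e1: "exp (\<epsilon> * z\<^sup>2 - z * (n \<bullet> x) + \<bar>t\<bar> * \<bar>z\<bar>) \<le> exp (\<epsilon> * r\<^sup>2 + r * norm x + \<bar>t\<bar> * r)"
      proof -
        have "\<epsilon> * z\<^sup>2 \<le> \<epsilon> * r\<^sup>2" using az \<epsilon> by (intro mult_left_mono) (auto simp: abs_le_square_iff[symmetric])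
        moreover have "- z * norm x \<le> r * norm x" using az by (intro mult_right_mono) auto
        moreover have "\<bar>t\<bar> * \<bar>z\<bar> \<le> \<bar>t\<bar> * r" using az by (intro mult_left_mono) auto
        ultimately show ?thesis unfolding n(2) by simp
      qed
      have e2: "2 * C * (1 + \<bar>t\<bar>) * (1 + \<bar>z\<bar>) ^ N \<le> 2 * C * (1 + \<bar>t\<bar>) * (1 + r) ^ N"
        using az C by (intro mult_left_mono power_mono) auto
      have "exp (\<epsilon> * z\<^sup>2 - z * (n \<bullet> x) + \<bar>t\<bar> * \<bar>z\<bar>) * (2 * C * (1 + \<bar>t\<bar>) * (1 + \<bar>z\<bar>) ^ N) *
          ((2 / \<epsilon>) ^ (N + 5) * fact (N + 5) * exp 1) \<le> D"
        unfolding D_def by (rule mult_right_mono[OF mult_mono[OF e1 e2]]) (use C \<epsilon> in simp_all)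
      then have "cmod (?F (?q w p)) \<le> D * (1 / (1 + norm P) ^ 5)"
        unfolding q by (rule order_trans[OF b mult_right_mono]) simp
      also have "\<dots> \<le> D * ((1 + r) ^ 5 / (1 + norm p) ^ 5)"
      proof (rule mult_left_mono)
        have "norm p \<le> norm P + norm (a *\<^sub>R n)"
          using norm_triangle_ineq4[of P "a *\<^sub>R n"] by (simp add: P_def)
        then have "norm p \<le> norm P + r" using n az by simp
        moreover have "0 \<le> r * norm P" using az by simp
        ultimately have "1 + norm p \<le> (1 + r) * (1 + norm P)"
          unfolding distrib_left distrib_right by linarith
        then have "(1 + norm p) ^ 5 \<le> ((1 + r) * (1 + norm P)) ^ 5"
          by (intro power_mono) auto
        then have "(1 + norm p) ^ 5 \<le> (1 + r) ^ 5 * (1 + norm P) ^ 5"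
          unfolding power_mult_distrib .
        moreover have "(1 + norm P) ^ 5 > 0" "(1 + norm p) ^ 5 > 0"
          by (intro zero_less_power, simp add: add_pos_nonneg)+
        ultimately show "1 / (1 + norm P) ^ 5 \<le> (1 + r) ^ 5 / (1 + norm p) ^ 5"
          by (simp add: pos_le_divide_eq pos_divide_le_eq)
        show "0 \<le> D" unfolding D_def using C \<epsilon> az by auto
      qed
      finally show ?thesis by simp
    qed
    then show "\<exists>K. \<forall>w p. cmod w \<le> r \<longrightarrow> cmod (?F (?q w p)) \<le> K * (1 / (1 + norm p) ^ 5)"
      by blast
  qed
  show ?thesis
    unfolding shift integral_mult_right_zero[symmetric]
  proof (rule order_trans[OF integral_norm_bound integral_mono'])
    show "integrable lborel (\<lambda>p :: real ^ 3. exp (\<epsilon> * y\<^sup>2 - y * norm x + \<bar>t\<bar> * y) * (2 * C * (1 + \<bar>t\<bar>) * (1 + y) ^ N) *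
      ((2 / \<epsilon>) ^ (N + 5) * fact (N + 5) * exp 1) * (1 / (1 + norm p) ^ 5))"
      by (intro integrable_mult_right integrable_decay)
    show "cmod (?F (?q (\<i> * of_real y) p)) \<le> exp (\<epsilon> * y\<^sup>2 - y * norm x + \<bar>t\<bar> * y) * (2 * C * (1 + \<bar>t\<bar>) * (1 + y) ^ N) *
      ((2 / \<epsilon>) ^ (N + 5) * fact (N + 5) * exp 1) * (1 / (1 + norm p) ^ 5)" for p
      using b[of p y] unfolding n(2) abs_of_nonneg[OF y] .
    show "0 \<le> exp (\<epsilon> * y\<^sup>2 - y * norm x + \<bar>t\<bar> * y) * (2 * C * (1 + \<bar>t\<bar>) * (1 + y) ^ N) *
      ((2 / \<epsilon>) ^ (N + 5) * fact (N + 5) * exp 1) * (1 / (1 + norm (p :: real ^ 3)) ^ 5)" for p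
      using C \<epsilon> y by simp
  qed
qed

text \<open>With damping 1 / s, the shift y = \<delta> s / 2 minimises y^2 / s - \<delta> y. The
  exponent is then at most -\<delta>^2 s / 4, while all other factors are polynomial in s. Position
  and time enter only through the margin \<delta> and the bound \<open>T\<close>, so the decay is
  uniform.\<close>

lemma gauss_kernel_decay:
  assumes mR: "moderate R" and mS: "moderate S" and \<delta>: "\<delta> > 0" and T: "T \<ge> 0"
  obtains b :: "nat \<Rightarrow> real" where "b \<longlonglongrightarrow> 0"
    "\<And>k x t. \<bar>t\<bar> + \<delta> \<le> norm x \<Longrightarrow> \<bar>t\<bar> \<le> T \<Longrightarrow>
      cmod (LINT p|lborel. gauss_kernel (1 / real (Suc k)) m R S x t (cvec p)) \<le> b k"
proof -
  obtain N1 C1 where 1: "C1 \<ge> 0" "\<And>q. cmod (R q) \<le> C1 * (1 + norm q) ^ N1"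
    using mR unfolding moderate_def by blast
  obtain N2 C2 where 2: "C2 \<ge> 0" "\<And>q. cmod (S q) \<le> C2 * (1 + norm q) ^ N2"
    using mS unfolding moderate_def by blast
  define N C where "N = N1 + N2" and "C = C1 + C2"
  have C: "C \<ge> 0" using 1 2 by (simp add: C_def)
  have R: "cmod (R q) \<le> C * (1 + norm q) ^ N" for q
    using 1(2)[of q] by (rule order_trans) (intro mult_mono power_increasing, use 1 2 in \<open>auto simp: C_def N_def\<close>)
  have S: "cmod (S q) \<le> C * (1 + norm q) ^ N" for q
    using 2(2)[of q] by (rule order_trans) (intro mult_mono power_increasing, use 1 2 in \<open>auto simp: C_def N_def\<close>)
  define I where "I = (LINT p|lborel. 1 / (1 + norm (p :: real ^ 3)) ^ 5)"
  have I: "I \<ge> 0" unfolding I_def by (intro integral_nonneg_AE) auto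
  define K where "K = 2 * C * (1 + T) * (1 + \<delta>) ^ N * (2 ^ (N + 5) * fact (N + 5) * exp 1) * I"
  define c where "c = \<delta>\<^sup>2 / 4"
  have c: "c > 0" using \<delta> by (simp add: c_def)
  \<comment> \<open>\<open>N\<close> powers of the inverse damping come from
    \<open>(1 + y) ^ N\<close>, and \<open>N + 5\<close> more from the Gaussian constant.\<close>
  define M where "M = N + (N + 5)"
  define b where "b k = K * (real (Suc k) ^ M * exp (- (c * real (Suc k))))" for k
  show thesis
  proof
    have "(\<lambda>k. (c * real (Suc k)) ^ M / exp (c * real (Suc k))) \<longlonglongrightarrow> 0"
    proof (rule filterlim_compose[OF tendsto_power_div_exp_0])
      have "filterlim (\<lambda>k. c * real (Suc k)) at_top sequentially"
        using c by (intro filterlim_tendsto_pos_mult_at_top[OF tendsto_const]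
            filterlim_compose[OF filterlim_real_sequentially filterlim_Suc])
      then show "filterlim (\<lambda>k. c * real (Suc k)) at_top sequentially" .
    qed
    from tendsto_mult_left[OF this, of "K / c ^ M"]
    have "(\<lambda>k. K / c ^ M * ((c * real (Suc k)) ^ M / exp (c * real (Suc k)))) \<longlonglongrightarrow> 0" by simp
    moreover have "K / c ^ M * ((c * real (Suc k)) ^ M / exp (c * real (Suc k))) = b k" for k
      using c unfolding b_def exp_minus power_mult_distrib by (simp add: divide_inverse del: of_nat_Suc)
    ultimately show "b \<longlonglongrightarrow> 0" by (simp only:)
  next
    fix k :: nat and x :: "real ^ 3" and t :: real
    assume x: "\<bar>t\<bar> + \<delta> \<le> norm x" and t: "\<bar>t\<bar> \<le> T"
    define s where "s = real (Suc k)"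
    have s: "s \<ge> 1" by (simp add: s_def)
    define y where "y = \<delta> * s / 2"
    have y: "y \<ge> 0" using \<delta> s by (simp add: y_def)
    have \<epsilon>: "0 < 1 / s" "1 / s \<le> 1" using s by auto
    have "1 / s * y\<^sup>2 - y * norm x + \<bar>t\<bar> * y \<le> - (c * s)"
    proof -
      have "y * (\<bar>t\<bar> + \<delta>) \<le> y * norm x" by (rule mult_left_mono[OF x y])
      moreover have "1 / s * y\<^sup>2 - y * \<delta> = - (c * s)"
        using s by (simp add: y_def c_def power2_eq_square field_simps)
      ultimately show ?thesis by (simp add: distrib_left mult.commute)
    qed
    then have e1: "exp (1 / s * y\<^sup>2 - y * norm x + \<bar>t\<bar> * y) \<le> exp (- (c * s))" by simp
    have y1: "1 + y \<le> (1 + \<delta>) * s"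
      using s \<delta> mult_nonneg_nonneg[of \<delta> s] unfolding y_def distrib_right by linarith
    have e2: "2 * C * (1 + \<bar>t\<bar>) * (1 + y) ^ N \<le> 2 * C * (1 + T) * ((1 + \<delta>) * s) ^ N"
      by (intro mult_mono power_mono y1) (use C t y T in auto)
    have "cmod (LINT p|lborel. gauss_kernel (1 / s) m R S x t (cvec p)) \<le>
        exp (1 / s * y\<^sup>2 - y * norm x + \<bar>t\<bar> * y) * (2 * C * (1 + \<bar>t\<bar>) * (1 + y) ^ N) *
          ((2 / (1 / s)) ^ (N + 5) * fact (N + 5) * exp 1) * I"
      unfolding I_def by (rule gauss_kernel_integral_le[OF mR mS R S C \<epsilon> y])
    also have "\<dots> \<le> exp (- (c * s)) * (2 * C * (1 + T) * ((1 + \<delta>) * s) ^ N) * ((2 / (1 / s)) ^ (N + 5) * fact (N + 5) * exp 1) * I"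
      by (rule mult_right_mono[OF mult_right_mono[OF mult_mono[OF e1 e2]]]) (use C s I y in simp_all)
    also have "\<dots> = b k"
      unfolding b_def K_def M_def s_def[symmetric] divide_divide_eq_right div_by_1 power_mult_distrib power_add[of s N]
      by (simp only: mult_ac)
    finally show "cmod (LINT p|lborel. gauss_kernel (1 / real (Suc k)) m R S x t (cvec p)) \<le> b k"
      unfolding s_def .
  qed
qed

lemma shell_kernel_real:
  assumes m: "m > 0"
  defines "E \<equiv> \<lambda>p. complex_of_real (energy m p)"
  shows "shell_kernel m R S t (cvec p) =
    ((R (cvec p) + E p * S (cvec p)) * exp (- (\<i> * of_real (energy m p * t))) -
     (R (cvec p) - E p * S (cvec p)) * exp (\<i> * of_real (energy m p * t))) * of_real (1 / energy m p)"
proof -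
  define e \<tau> where "e = energy m p" and "\<tau> = complex_of_real t"
  have e: "e > 0" using m by (simp add: e_def energy_pos)
  have sq: "shell_sq m (cvec p) = (of_real e)\<^sup>2"
    unfolding shell_sq_def sum_cvec_sq e_def by (simp add: energy_sq flip: of_real_power of_real_add)
  define \<theta> where "\<theta> = \<tau> * of_real e"
  have \<theta>: "\<tau>\<^sup>2 * shell_sq m (cvec p) = \<theta>\<^sup>2" "\<i> * of_real (e * t) = \<i> * \<theta>"
    by (simp_all add: sq power_mult_distrib \<theta>_def \<tau>_def mult.commute)
  have sinc: "\<tau> * sinc_sqrt (\<theta>\<^sup>2) = sin \<theta> / of_real e"
    unfolding sinc_sqrt_sq[symmetric] using e by (simp add: \<theta>_def)
  define V W where "V = exp (\<i> * \<theta>)" and "W = exp (- (\<i> * \<theta>))"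
  have VW: "sin \<theta> = (V - W) / (2 * \<i>)" "cos \<theta> = (V + W) / 2"
    by (simp_all add: sin_exp_eq cos_exp_eq V_def W_def)
  show ?thesis
    unfolding shell_kernel_def E_def e_def[symmetric] \<tau>_def[symmetric] \<theta> sinc cos_sqrt_sq VW
      V_def[symmetric] W_def[symmetric]
    using e by (simp add: field_simps)
qed

section \<open>Exchange of integrals, and separation of supports\<close>

lemma lborel_integral_uminus:
  fixes f :: "'a::euclidean_space \<Rightarrow> complex"
  assumes "f \<in> borel_measurable borel"
  shows "(LINT x|lborel. f (- x)) = (LINT x|lborel. f x)"
proof -
  have "lborel = distr lborel borel (uminus :: 'a \<Rightarrow> 'a)"
    using lborel_affine[of "-1" "0 :: 'a"] by (simp add: density_1)
  then have "(LINT x|lborel. f x) = (LINT x|distr lborel borel uminus. f x)" by simp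
  also have "\<dots> = (LINT x|lborel. f (- x))"
    using assms by (subst integral_distr) auto
  finally show ?thesis by simp
qed

text \<open>The product \<open>h p * cmod (b x)\<close> is an integrable majorant in both
  variables.\<close>

lemma Fubini_dominated:
  fixes k :: "'a::euclidean_space \<Rightarrow> 'b::euclidean_space \<Rightarrow> complex"
  assumes k: "continuous_on UNIV (\<lambda>(p, x). k p x)" and h: "integrable lborel h" "\<And>p x. cmod (k p x) \<le> h p"
    and b: "integrable lborel b"
  shows "(LINT p|lborel. LINT x|lborel. b x * k p x) = (LINT x|lborel. b x * (LINT p|lborel. k p x))"
proof -
  have [measurable]: "b \<in> borel_measurable borel" "h \<in> borel_measurable borel"
    using borel_measurable_integrable[OF b] borel_measurable_integrable[OF h(1)] by auto
  have "(\<lambda>(p, x). k p x) \<in> borel_measurable borel"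
    by (rule borel_measurable_continuous_onI[OF k])
  then have [measurable]: "(\<lambda>(p, x). k p x) \<in> borel_measurable (borel \<Otimes>\<^sub>M borel)"
    by (simp add: borel_prod)
  have h0: "h p \<ge> 0" for p using h(2)[of p] norm_ge_zero order_trans by blast
  have kx: "integrable lborel (\<lambda>x. b x * k p x)" for p
  proof (rule Bochner_Integration.integrable_bound[OF integrable_mult_right[OF integrable_norm[OF b], of "h p"]])
    show "(\<lambda>x. b x * k p x) \<in> borel_measurable lborel"
      by measurable
    show "AE x in lborel. norm (b x * k p x) \<le> norm (h p * norm (b x))"
      using h(2)[of p] h0[of p] by (intro AE_I2) (simp add: norm_mult mult.commute[of "h p"] mult_left_mono)
  qed
  have "integrable (lborel \<Otimes>\<^sub>M lborel) (\<lambda>(p, x). b x * k p x)"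
  proof (rule lborel_pair.Fubini_integrable)
    show "(\<lambda>(p, x). b x * k p x) \<in> borel_measurable (lborel \<Otimes>\<^sub>M lborel)"
      by measurable
    show "integrable lborel (\<lambda>p. LINT x|lborel. norm (case (p, x) of (p, x) \<Rightarrow> b x * k p x))"
    proof (rule Bochner_Integration.integrable_bound[OF integrable_mult_left[OF h(1), of "LINT x|lborel. cmod (b x)"]])
      show "(\<lambda>p. LINT x|lborel. norm (case (p, x) of (p, x) \<Rightarrow> b x * k p x)) \<in> borel_measurable lborel"
        by (rule lborel.borel_measurable_lebesgue_integral) measurable
      have "(LINT x|lborel. cmod (b x * k p x)) \<le> (LINT x|lborel. h p * cmod (b x))" for p
        using h(2)[of p] h0[of p]
        by (intro integral_mono' integrable_mult_right integrable_norm b) (simp_all add: norm_mult mult.commute[of "h p"] mult_left_mono)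
      moreover have "0 \<le> (LINT x|lborel. cmod (b x * k p x))" for p by (rule integral_nonneg_AE) auto
      ultimately show "AE p in lborel. norm (LINT x|lborel. norm (case (p, x) of (p, x) \<Rightarrow> b x * k p x)) \<le>
          norm (h p * (LINT x|lborel. cmod (b x)))"
        using h0 by (intro AE_I2) (simp add: integral_nonneg_AE)
    qed
    show "AE p in lborel. integrable lborel (\<lambda>x. case (p, x) of (p, x) \<Rightarrow> b x * k p x)"
      using kx by simp
  qed
  from lborel_pair.Fubini_integral[OF this]
  have "(LINT p|lborel. LINT x|lborel. b x * k p x) = (LINT x|lborel. LINT p|lborel. b x * k p x)"
    by simp
  then show ?thesis by simp
qed

lemma integrable_pair_mult:
  fixes u :: "'a::euclidean_space \<Rightarrow> complex" and v :: "'b::euclidean_space \<Rightarrow> complex"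
  assumes u: "integrable lborel u" and v: "integrable lborel v"
  shows "integrable lborel (\<lambda>z. u (fst z) * v (snd z))" (is ?A)
    and "(LINT z|lborel. u (fst z) * v (snd z)) = (LINT x|lborel. u x) * (LINT y|lborel. v y)" (is ?B)
proof -
  have [measurable]: "u \<in> borel_measurable borel" "v \<in> borel_measurable borel"
    using borel_measurable_integrable[OF u] borel_measurable_integrable[OF v] by auto
  have i: "integrable (lborel \<Otimes>\<^sub>M lborel) (\<lambda>z. u (fst z) * v (snd z))"
  proof (rule lborel_pair.Fubini_integrable)
    show "(\<lambda>z. u (fst z) * v (snd z)) \<in> borel_measurable (lborel \<Otimes>\<^sub>M lborel)"
      by measurable
    show "integrable lborel (\<lambda>x. LINT y|lborel. norm (u (fst (x, y)) * v (snd (x, y))))"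
      using u by (simp add: norm_mult)
    show "AE x in lborel. integrable lborel (\<lambda>y. u (fst (x, y)) * v (snd (x, y)))"
      using v by simp
  qed
  then show ?A by (simp add: lborel_prod)
  have "(LINT z|lborel. u (fst z) * v (snd z)) = (LINT z|(lborel \<Otimes>\<^sub>M lborel). u (fst z) * v (snd z))"
    by (simp add: lborel_prod)
  also have "\<dots> = (LINT x|lborel. LINT y|lborel. u x * v y)"
    using lborel_pair.integral_fst'[OF i] by simp
  finally show ?B by simp
qed

lemma rapid_gaussian:
  assumes "0 < \<epsilon>" "\<epsilon> \<le> 1"
  shows "rapid (\<lambda>p. of_real (exp (- \<epsilon> * (norm p)\<^sup>2)))"
  unfolding rapid_def
proof (intro conjI allI)
  show "continuous_on UNIV (\<lambda>p. complex_of_real (exp (- \<epsilon> * (norm p)\<^sup>2)))"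
    by (intro continuous_intros)
  show "\<exists>C. \<forall>p. (1 + norm p) ^ N * cmod (of_real (exp (- \<epsilon> * (norm p)\<^sup>2))) \<le> C" for N
    using gaussian_power_bound[OF assms norm_ge_zero, where k = N]
    by (intro exI[of _ "(2 / \<epsilon>) ^ N * fact N * exp 1"] allI) (simp only: norm_of_real abs_exp_cancel)
qed

text \<open>By compactness the excess of spatial distance over time difference attains its minimum
  on the supports, and space-likeness makes it positive. The kernel bound needs such a uniform
  margin.\<close>

lemma spacelike_gap:
  assumes f: "test_function f" and g: "test_function g"
    and sp: "\<And>x y. x \<in> supp f \<Longrightarrow> y \<in> supp g \<Longrightarrow> spacelike (x - y)"
  obtains \<delta> T where "\<delta> > 0" "T \<ge> 0"
    "\<And>x y. x \<in> supp f \<Longrightarrow> y \<in> supp g \<Longrightarrow> \<bar>snd (x - y)\<bar> + \<delta> \<le> norm (fst (x - y)) \<and> \<bar>snd (x - y)\<bar> \<le> T"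
proof (cases "supp f \<times> supp g = {}")
  case True
  then show ?thesis using that[of 1 1] by auto
next
  case False
  let ?K = "supp f \<times> supp g"
  have K: "compact ?K" using f g by (intro compact_Times) (auto simp: test_function_def)
  have "continuous_on ?K (\<lambda>z. norm (fst (fst z - snd z)) - \<bar>snd (fst z - snd z)\<bar>)"
    by (intro continuous_intros)
  from continuous_attains_inf[OF K False this] obtain z where z: "z \<in> ?K"
    "\<And>w. w \<in> ?K \<Longrightarrow> norm (fst (fst z - snd z)) - \<bar>snd (fst z - snd z)\<bar> \<le> norm (fst (fst w - snd w)) - \<bar>snd (fst w - snd w)\<bar>"
    by blast
  have "continuous_on ?K (\<lambda>z. \<bar>snd (fst z - snd z)\<bar>)"
    by (intro continuous_intros)
  from continuous_attains_sup[OF K False this] obtain z' where z': "z' \<in> ?K"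
    "\<And>w. w \<in> ?K \<Longrightarrow> \<bar>snd (fst w - snd w)\<bar> \<le> \<bar>snd (fst z' - snd z')\<bar>"
    by blast
  have "spacelike (fst z - snd z)" using z(1) by (intro sp) auto
  then have "\<bar>snd (fst z - snd z)\<bar>\<^sup>2 < (norm (fst (fst z - snd z)))\<^sup>2"
    unfolding spacelike_def mink_def power2_norm_eq_inner by (simp add: power2_eq_square)
  then have "\<bar>snd (fst z - snd z)\<bar> < norm (fst (fst z - snd z))"
    by (rule power2_less_imp_less) simp
  then show ?thesis
  proof (intro that[of "norm (fst (fst z - snd z)) - \<bar>snd (fst z - snd z)\<bar>" "\<bar>snd (fst z' - snd z')\<bar>"])
    fix x y assume "x \<in> supp f" "y \<in> supp g"
    then show "\<bar>snd (x - y)\<bar> + (norm (fst (fst z - snd z)) - \<bar>snd (fst z - snd z)\<bar>) \<le> norm (fst (x - y)) \<and>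
      \<bar>snd (x - y)\<bar> \<le> \<bar>snd (fst z' - snd z')\<bar>"
      using z(2)[of "(x, y)"] z'(2)[of "(x, y)"] by simp
  qed auto
qed

lemma plane_wave_transform_product:
  fixes p :: "real ^ 3" and m s :: real
  assumes f: "test_function f" and g: "test_function g"
  defines "e \<equiv> \<lambda>x. exp (\<i> * of_real (s * mink (on_shell m p) x))"
  shows "integrable lborel (\<lambda>z. f (fst z) * g (snd z) * e (fst z - snd z))"
    and "(LINT z|lborel. f (fst z) * g (snd z) * e (fst z - snd z)) =
      plane_wave_transform m s f p * plane_wave_transform m (- s) g p"
proof -
  have int: "integrable lborel (\<lambda>x. h x * exp (\<i> * of_real (s' * mink (on_shell m p) x)))" if "test_function h" for h s'
  proof (rule continuous_compact_support_integrable[of _ "supp h"])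
    show "continuous_on UNIV (\<lambda>x. h x * exp (\<i> * of_real (s' * mink (on_shell m p) x)))"
      unfolding mink_def by (intro continuous_intros test_function_continuous that)
  qed (use that in \<open>auto simp: test_function_support, simp add: test_function_def\<close>)
  have eq: "f (fst z) * g (snd z) * e (fst z - snd z) =
      (f (fst z) * exp (\<i> * of_real (s * mink (on_shell m p) (fst z)))) *
      (g (snd z) * exp (\<i> * of_real (- s * mink (on_shell m p) (snd z))))" for z
  proof -
    have d: "mink q (x - y) = mink q x - mink q y" for q x y
      by (simp add: mink_def inner_diff_right algebra_simps)
    then have "e (fst z - snd z) = exp (\<i> * of_real (s * mink (on_shell m p) (fst z))) * exp (\<i> * of_real (- s * mink (on_shell m p) (snd z)))"
      unfolding e_def exp_add[symmetric] d by (intro arg_cong[where f = exp]) (simp add: algebra_simps)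
    then show ?thesis by (simp only: mult_ac)
  qed
  show "integrable lborel (\<lambda>z. f (fst z) * g (snd z) * e (fst z - snd z))"
    unfolding eq by (rule integrable_pair_mult(1)[OF int[OF f] int[OF g]])
  show "(LINT z|lborel. f (fst z) * g (snd z) * e (fst z - snd z)) =
      plane_wave_transform m s f p * plane_wave_transform m (- s) g p"
    unfolding eq plane_wave_transform_def by (rule integrable_pair_mult(2)[OF int[OF f] int[OF g]])
qed

text \<open>The second plane wave is taken at the reversed momentum and with the opposite sign, so
  both waves share their spatial factor and differ in the sign of the energy alone.\<close>

lemma gauss_kernel_real:
  assumes m: "m > 0"
  shows "gauss_kernel \<epsilon> m R S (fst z) (snd z) (cvec p) = of_real (exp (- \<epsilon> * (norm p)\<^sup>2)) *
    (((R (cvec p) + of_real (energy m p) * S (cvec p)) * of_real (1 / energy m p)) *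
       exp (\<i> * of_real (1 * mink (on_shell m p) z)) -
     ((R (cvec p) - of_real (energy m p) * S (cvec p)) * of_real (1 / energy m p)) *
       exp (\<i> * of_real (- 1 * mink (on_shell m (- p)) z)))"
proof -
  have lin: "(\<Sum>i\<in>UNIV. cvec p $ i * of_real (fst z $ i)) = of_real (p \<bullet> fst z)"
    by (simp add: inner_vec_def)
  have 1: "exp (- of_real \<epsilon> * (\<Sum>i\<in>UNIV. (cvec p $ i)\<^sup>2) + \<i> * (\<Sum>i\<in>UNIV. cvec p $ i * of_real (fst z $ i))) =
      of_real (exp (- \<epsilon> * (norm p)\<^sup>2)) * exp (\<i> * of_real (p \<bullet> fst z))"
    unfolding sum_cvec_sq lin exp_add by (simp only: exp_of_real[symmetric] of_real_mult of_real_minus)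
  have 2: "exp (\<i> * of_real (1 * mink (on_shell m p) z)) = exp (\<i> * of_real (p \<bullet> fst z)) * exp (- (\<i> * of_real (energy m p * snd z)))"
    unfolding exp_add[symmetric] by (simp add: mink_def on_shell_def algebra_simps)
  have 3: "exp (\<i> * of_real (- 1 * mink (on_shell m (- p)) z)) = exp (\<i> * of_real (p \<bullet> fst z)) * exp (\<i> * of_real (energy m p * snd z))"
    unfolding exp_add[symmetric] by (simp add: mink_def on_shell_def energy_def algebra_simps)
  show ?thesis
    unfolding gauss_kernel_def 1 2 3 shell_kernel_real[OF m] by (simp only: algebra_simps)
qed

text \<open>
  After replacing $\mathbf{p}$ by $-\mathbf{p}$ in the second integral, the difference of the two sides is
  the limit of the Gaussian regularisations, whose position space kernels decay uniformly at
  space-like separation.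
\<close>

lemma spacelike_symmetry:
  assumes m: "m > 0" and uv: "rest_coefficients j u v" and AB: "admissible j A B" and CD: "admissible j C D"
    and r: "r \<in> components A B" and t: "t \<in> components C D"
    and f: "test_function f" and g: "test_function g"
    and sp: "\<And>x y. x \<in> supp f \<Longrightarrow> y \<in> supp g \<Longrightarrow> spacelike (x - y)"
  shows "(LINT p|lborel. of_real (1 / energy m p) * gram m j u A B C D r t p *
      (plane_wave_transform m 1 f p * plane_wave_transform m (- 1) g p)) =
    (- 1) ^ (A + D) * (LINT p|lborel. of_real (1 / energy m p) * gram m j u A B C D r t p *
      (plane_wave_transform m (- 1) f p * plane_wave_transform m 1 g p))"
proof -
  obtain R S where mR: "moderate R" and mS: "moderate S"
    and gram1: "\<And>p. gram m j u A B C D r t p = R (cvec p) + of_real (energy m p) * S (cvec p)"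
    and gram2: "\<And>p. gram m j u A B C D r t (- p) = (- 1) ^ (A + D) * (R (cvec p) - of_real (energy m p) * S (cvec p))"
    using gram_shell_form[OF m uv AB CD r t] by metis
  define \<eta> :: complex where "\<eta> = (- 1) ^ (A + D)"
  have \<eta>: "\<eta> * \<eta> = 1" by (simp add: \<eta>_def flip: power_mult_distrib)
  define A1 A2 where "A1 p = (R (cvec p) + of_real (energy m p) * S (cvec p)) * of_real (1 / energy m p)"
    and "A2 p = (R (cvec p) - of_real (energy m p) * S (cvec p)) * of_real (1 / energy m p)" for p
  have tA: "tempered A1" "tempered A2"
    unfolding A1_def[abs_def] A2_def[abs_def]
    by (intro tempered_mult tempered_add tempered_diff tempered_moderate mR mS tempered_energy tempered_inverse_energy m)+
  define F1 F2 where "F1 p = plane_wave_transform m 1 f p * plane_wave_transform m (- 1) g p"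
    and "F2 p = plane_wave_transform m (- 1) f p * plane_wave_transform m 1 g p" for p
  have rF: "rapid F1" "rapid F2"
    unfolding F1_def[abs_def] F2_def[abs_def]
    by (intro rapid_mult_tempered rapid_imp_tempered rapid_plane_wave_transform f g; simp)+
  have rF2: "rapid (\<lambda>p. F2 (- p))"
    using rF(2) unfolding rapid_def
  proof (intro conjI allI)
    assume *: "continuous_on UNIV F2 \<and> (\<forall>N. \<exists>C. \<forall>p. (1 + norm p) ^ N * cmod (F2 p) \<le> C)"
    show "continuous_on UNIV (\<lambda>p. F2 (- p))"
      by (rule continuous_on_compose2[OF conjunct1[OF *]]) (auto intro: continuous_intros)
    fix N
    obtain C where "\<And>p. (1 + norm p) ^ N * cmod (F2 p) \<le> C" using conjunct2[OF *] by blast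
    then have "(1 + norm p) ^ N * cmod (F2 (- p)) \<le> C" for p
      using norm_minus_cancel[of p] by metis
    then show "\<exists>C. \<forall>p. (1 + norm p) ^ N * cmod (F2 (- p)) \<le> C" by blast
  qed
  \<comment> \<open>Its integral is the difference of the two sides; the regulator
    \<open>G k\<close> multiplies it and tends to 1.\<close>
  define Df where "Df p = A1 p * F1 p - A2 p * F2 (- p)" for p
  have r1: "rapid (\<lambda>p. A1 p * F1 p)" and r2: "rapid (\<lambda>p. A2 p * F2 (- p))"
    by (rule rapid_mult_tempered'[OF tA(1) rF(1)], rule rapid_mult_tempered'[OF tA(2) rF2])
  have iD: "integrable lborel Df"
    unfolding Df_def by (intro Bochner_Integration.integrable_diff rapid_integrable r1 r2)
  have mD: "Df \<in> borel_measurable borel" using borel_measurable_integrable[OF iD] by simp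
  define G where "G k p = complex_of_real (exp (- (1 / real (Suc k)) * (norm p)\<^sup>2))" for k and p :: "real ^ 3"
  have rG: "rapid (G k)" for k
    unfolding G_def[abs_def] by (rule rapid_gaussian) auto
  define H where "H k p z = gauss_kernel (1 / real (Suc k)) m R S (fst (fst z - snd z)) (snd (fst z - snd z)) (cvec p)"
    for k p and z :: "four_vector \<times> four_vector"
  define b where "b z = f (fst z) * g (snd z)" for z
  have ib: "integrable lborel b"
    unfolding b_def by (rule integrable_pair_mult(1)[OF f[THEN test_function_integrable] g[THEN test_function_integrable]])
  define E1 E2 where "E1 p x = exp (\<i> * of_real (1 * mink (on_shell m p) x))"
    and "E2 p x = exp (\<i> * of_real (- 1 * mink (on_shell m (- p)) x))" for p x
  have H_eq: "H k p z = G k p * (A1 p * E1 p (fst z - snd z) - A2 p * E2 p (fst z - snd z))" for k p z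
    unfolding H_def gauss_kernel_real[OF m] G_def A1_def A2_def E1_def E2_def ..
  \<comment> \<open>A plane wave in the difference of two positions factorises over the two test
    functions, which turns the smeared kernel back into products of transforms.\<close>
  have step_a: "(LINT z|lborel. b z * H k p z) = G k p * Df p" for k p
  proof -
    note w1 = plane_wave_transform_product[OF f g, where s = 1 and m = m and p = p, folded E1_def b_def F1_def]
    note w2 = plane_wave_transform_product[OF f g, where s = "- 1" and m = m and p = "- p", folded E2_def b_def, unfolded minus_minus, folded F2_def]
    have "(LINT z|lborel. b z * H k p z) =
        (LINT z|lborel. (G k p * A1 p) * (b z * E1 p (fst z - snd z)) - (G k p * A2 p) * (b z * E2 p (fst z - snd z)))"
      unfolding H_eq by (intro Bochner_Integration.integral_cong refl) (simp only: algebra_simps)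
    also have "\<dots> = G k p * Df p"
      using w1 w2 by (subst Bochner_Integration.integral_diff) (simp_all add: Df_def right_diff_distrib)
    finally show ?thesis .
  qed
  \<comment> \<open>Thanks to the damping, the kernel has an integrable majorant in the momentum
    that is uniform in the positions, so the momentum integral may be done first and estimated on
    the supports.\<close>
  have step_b: "(LINT p|lborel. G k p * Df p) = (LINT z|lborel. b z * (LINT p|lborel. H k p z))" for k
  proof -
    have "(LINT p|lborel. LINT z|lborel. b z * H k p z) = (LINT z|lborel. b z * (LINT p|lborel. H k p z))"
    proof (rule Fubini_dominated[OF _ _ _ ib])
      have c: "continuous_on UNIV (\<lambda>(p, z). h (p :: real ^ 3))" if "tempered h" for h
        using that unfolding tempered_def case_prod_unfold
        by (auto intro!: continuous_on_compose2[of UNIV h] continuous_intros)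
      have "continuous_on UNIV (\<lambda>(p, z). G k p * (A1 p * E1 p (fst z - snd z) - A2 p * E2 p (fst z - snd z)))"
        using c[OF rG[of k, THEN rapid_imp_tempered]] c[OF tA(1)] c[OF tA(2)]
        unfolding case_prod_unfold E1_def E2_def mink_def on_shell_def fst_conv snd_conv
        by (intro continuous_intros)
      then show "continuous_on UNIV (\<lambda>(p, z). H k p z)" unfolding H_eq .
      have "rapid (\<lambda>p. G k p * A1 p)" "rapid (\<lambda>p. G k p * A2 p)"
        by (intro rapid_mult_tempered rG tA)+
      then show "integrable lborel (\<lambda>p. cmod (G k p * A1 p) + cmod (G k p * A2 p))"
        by (intro Bochner_Integration.integrable_add integrable_norm rapid_integrable)
      show "cmod (H k p z) \<le> cmod (G k p * A1 p) + cmod (G k p * A2 p)" for p z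
      proof -
        have "H k p z = (G k p * A1 p) * E1 p (fst z - snd z) - (G k p * A2 p) * E2 p (fst z - snd z)"
          unfolding H_eq by (simp only: algebra_simps)
        also have "cmod \<dots> \<le> cmod ((G k p * A1 p) * E1 p (fst z - snd z)) + cmod ((G k p * A2 p) * E2 p (fst z - snd z))"
          by (rule norm_triangle_ineq4)
        also have "\<dots> = cmod (G k p * A1 p) + cmod (G k p * A2 p)"
          unfolding norm_mult E1_def E2_def by simp
        finally show ?thesis .
      qed
    qed
    then show ?thesis unfolding step_a .
  qed
  obtain \<delta> T where \<delta>: "\<delta> > 0" "T \<ge> 0" and gap:
    "\<And>x y. x \<in> supp f \<Longrightarrow> y \<in> supp g \<Longrightarrow> \<bar>snd (x - y)\<bar> + \<delta> \<le> norm (fst (x - y)) \<and> \<bar>snd (x - y)\<bar> \<le> T"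
    using spacelike_gap[OF f g sp] by metis
  obtain \<beta> where \<beta>: "\<beta> \<longlonglongrightarrow> 0" and dec: "\<And>k x t. \<bar>t\<bar> + \<delta> \<le> norm x \<Longrightarrow> \<bar>t\<bar> \<le> T \<Longrightarrow>
      cmod (LINT p|lborel. gauss_kernel (1 / real (Suc k)) m R S x t (cvec p)) \<le> \<beta> k"
    using gauss_kernel_decay[OF mR mS \<delta>] by metis
  have nb: "norm (LINT p|lborel. G k p * Df p) \<le> \<bar>\<beta> k\<bar> * (LINT z|lborel. cmod (b z))" for k
  proof -
    have "cmod (b z * (LINT p|lborel. H k p z)) \<le> \<bar>\<beta> k\<bar> * cmod (b z)" for z
    proof (cases "fst z \<in> supp f \<and> snd z \<in> supp g")
      case True
      then have "cmod (LINT p|lborel. H k p z) \<le> \<beta> k"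
        unfolding H_def using gap[of "fst z" "snd z"] by (intro dec) auto
      then have "cmod (LINT p|lborel. H k p z) \<le> \<bar>\<beta> k\<bar>" by linarith
      then show ?thesis unfolding norm_mult by (subst mult.commute) (rule mult_right_mono, simp_all)
    next
      case False
      then have "b z = 0" unfolding b_def using test_function_support[of "fst z" f] test_function_support[of "snd z" g] by auto
      then show ?thesis by simp
    qed
    then have "cmod (LINT z|lborel. b z * (LINT p|lborel. H k p z)) \<le> (LINT z|lborel. \<bar>\<beta> k\<bar> * cmod (b z))"
      by (intro order_trans[OF integral_norm_bound integral_mono'] integrable_mult_right integrable_norm ib) simp_all
    then show ?thesis by (simp add: step_b)
  qed
  have nl: "(\<lambda>k. \<bar>\<beta> k\<bar> * (LINT z|lborel. cmod (b z))) \<longlonglongrightarrow> 0"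
    by (intro tendsto_mult_left_zero tendsto_rabs_zero \<beta>)
  have lim0: "(\<lambda>k. LINT p|lborel. G k p * Df p) \<longlonglongrightarrow> 0"
    by (rule Lim_null_comparison[OF _ nl], rule always_eventually, rule allI, rule nb)
  \<comment> \<open>Removal of the regulator: \<open>Df\<close> is integrable and dominates all
    damped versions of itself.\<close>
  have "(\<lambda>k. LINT p|lborel. G k p * Df p) \<longlonglongrightarrow> (LINT p|lborel. Df p)"
  proof (rule integral_dominated_convergence[where w = "\<lambda>p. cmod (Df p)"])
    show "Df \<in> borel_measurable lborel" using mD by simp
    show "(\<lambda>p. G k p * Df p) \<in> borel_measurable lborel" for k
      using mD rapid_measurable[OF rG[of k]] by simp
    show "integrable lborel (\<lambda>p. cmod (Df p))" using iD by simp
    show "AE p in lborel. (\<lambda>k. G k p * Df p) \<longlonglongrightarrow> Df p"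
    proof (rule AE_I2)
      fix p :: "real ^ 3"
      have "(\<lambda>k. exp (- (1 / real (Suc k)) * (norm p)\<^sup>2)) \<longlonglongrightarrow> exp (- 0 * (norm p)\<^sup>2)"
        using LIMSEQ_inverse_real_of_nat by (intro tendsto_intros) (simp add: inverse_eq_divide)
      then have "(\<lambda>k. G k p) \<longlonglongrightarrow> of_real (exp (- 0 * (norm p)\<^sup>2))"
        unfolding G_def by (rule tendsto_of_real)
      from tendsto_mult_right[OF this, of "Df p"] show "(\<lambda>k. G k p * Df p) \<longlonglongrightarrow> Df p" by simp
    qed
    show "AE p in lborel. norm (G k p * Df p) \<le> cmod (Df p)" for k
    proof (rule AE_I2)
      fix p
      have "cmod (G k p) \<le> 1" unfolding G_def norm_of_real by simp
      then show "norm (G k p * Df p) \<le> cmod (Df p)"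
        unfolding norm_mult by (rule mult_left_le_one_le[rotated 2]) simp_all
    qed
  qed
  from LIMSEQ_unique[OF this lim0]
  have "(LINT p|lborel. A1 p * F1 p) - (LINT p|lborel. A2 p * F2 (- p)) = 0"
    unfolding Df_def by (simp add: Bochner_Integration.integral_diff rapid_integrable r1 r2)
  \<comment> \<open>Undoes the reversal of the momentum; the parity sign is its own inverse.\<close>
  moreover have "(LINT p|lborel. A2 p * F2 (- p)) = \<eta> * (LINT p|lborel. of_real (1 / energy m p) * gram m j u A B C D r t p * F2 p)"
  proof -
    have "tempered (\<lambda>p. of_real (1 / energy m p) * gram m j u A B C D r t p)"
      by (intro tempered_mult tempered_inverse_energy m tempered_gram[OF m uv AB CD r t])
    from rapid_measurable[OF rapid_mult_tempered'[OF this rF(2)]]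
    have "(LINT p|lborel. of_real (1 / energy m p) * gram m j u A B C D r t p * F2 p) =
        (LINT p|lborel. of_real (1 / energy m (- p)) * gram m j u A B C D r t (- p) * F2 (- p))"
      by (rule lborel_integral_uminus[symmetric])
    also have "\<dots> = (LINT p|lborel. \<eta> * (A2 p * F2 (- p)))"
      by (intro Bochner_Integration.integral_cong refl) (simp add: gram2 A2_def \<eta>_def energy_def mult_ac)
    also have "\<dots> = \<eta> * (LINT p|lborel. A2 p * F2 (- p))" by simp
    finally show ?thesis using \<eta> by (simp flip: mult.assoc)
  qed
  moreover have "A1 p * F1 p = of_real (1 / energy m p) * gram m j u A B C D r t p * F1 p" for p
    by (simp add: A1_def gram1 mult_ac)
  ultimately show ?thesis
    by (simp only: F1_def F2_def \<eta>_def right_minus_eq)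
qed

section \<open>The bracket of two fields\<close>

lemma exchange_sign_sq: "exchange_sign st * exchange_sign st = 1"
  by (cases st) simp_all

section \<open>Regularity of Fock space vectors\<close>

text \<open>The definition of \<open>fock_domain\<close> states continuity for momentum families
  indexed by all of \<open>nat\<close>, in the product topology. Composed with continuous families
  it becomes joint continuity in whichever momenta vary.\<close>

lemma fock_domain_continuous:
  fixes ls :: "(species \<times> nat \<times> ('x::topological_space \<Rightarrow> real ^ 3)) list"
  assumes \<Psi>: "\<Psi> \<in> fock_domain st j"
    and c: "\<And>s n c. (s, n, c) \<in> set ls \<Longrightarrow> continuous_on UNIV c"
  shows "continuous_on UNIV (\<lambda>x. \<Psi> (map (\<lambda>(s, n, c). (s, n, c x)) ls))"
proof -
  define lab where "lab = map (\<lambda>(s, n, c). (s, n)) ls"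
  \<comment> \<open>Only the first \<open>length ls\<close> momenta are read; the value 0 beyond
    them keeps every coordinate continuous.\<close>
  define K where "K x i = (if i < length ls then snd (snd (ls ! i)) x else 0)" for x i
  have "\<forall>lab :: (species \<times> nat) list. continuous_on UNIV
        (\<lambda>k :: nat \<Rightarrow> real ^ 3. \<Psi> (map (\<lambda>i. (fst (lab ! i), snd (lab ! i), k i)) [0..<length lab]))"
    using \<Psi> unfolding fock_domain_def by simp
  then have "continuous_on UNIV (\<lambda>k :: nat \<Rightarrow> real ^ 3. \<Psi> (map (\<lambda>i. (fst (lab ! i), snd (lab ! i), k i)) [0..<length lab]))" ..
  moreover have "continuous_on UNIV K"
  proof (rule continuous_on_coordinatewise_then_product)
    fix i
    show "continuous_on UNIV (\<lambda>x. K x i)"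
    proof (cases "i < length ls")
      case True
      obtain s n c' where e: "ls ! i = (s, n, c')" by (metis prod_cases3)
      have "continuous_on UNIV c'"
        using c[of s n c'] nth_mem[OF True] e by simp
      then show ?thesis using True by (simp add: K_def e)
    qed (simp add: K_def)
  qed
  ultimately have "continuous_on UNIV (\<lambda>x. \<Psi> (map (\<lambda>i. (fst (lab ! i), snd (lab ! i), K x i)) [0..<length lab]))"
    by (rule continuous_on_compose2) simp
  moreover have "map (\<lambda>i. (fst (lab ! i), snd (lab ! i), K x i)) [0..<length lab] = map (\<lambda>(s, n, c). (s, n, c x)) ls" for x
    by (rule nth_equalityI) (auto simp: lab_def K_def case_prod_unfold)
  ultimately show ?thesis by simp
qed

lemma fock_domain_bounded:
  assumes \<Psi>: "\<Psi> \<in> fock_domain st j"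
  obtains B where "B \<ge> 0" "\<And>qs. length qs = n \<Longrightarrow> cmod (\<Psi> qs) \<le> B"
proof -
  have "\<forall>n N :: nat. \<exists>C :: real. \<forall>qs. length qs = n \<longrightarrow>
        (\<Prod>(t, \<sigma>, p)\<leftarrow>qs. (1 + norm p) ^ N) * cmod (\<Psi> qs) \<le> C"
    using \<Psi> unfolding fock_domain_def by simp
  then obtain C where C: "\<And>qs. length qs = n \<Longrightarrow> (\<Prod>(t, \<sigma>, p)\<leftarrow>qs. (1 + norm p) ^ 0) * cmod (\<Psi> qs) \<le> C"
    by blast
  have 1: "(\<Prod>(t, \<sigma>, p)\<leftarrow>qs. (1 + norm p) ^ 0) = (1 :: real)" for qs :: "one_particle list"
    by (induction qs) auto
  have "cmod (\<Psi> qs) \<le> \<bar>C\<bar>" if "length qs = n" for qs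
    using C[OF that] unfolding 1 by simp
  then show ?thesis using that[of "\<bar>C\<bar>"] by simp
qed

lemma map_const_momenta:
  "map (\<lambda>(s, n, c). (s, n, c x)) (map (\<lambda>(s, n, p). (s, n, \<lambda>_. p)) qs) = qs"
  by (induction qs) auto

lemma fock_domain_tempered:
  assumes \<Psi>: "\<Psi> \<in> fock_domain st j"
  shows "tempered (\<lambda>p. \<Psi> ((t, \<sigma>, p) # qs))"
proof -
  have "continuous_on UNIV (\<lambda>x. \<Psi> (map (\<lambda>(s, n, c). (s, n, c x)) ((t, \<sigma>, \<lambda>p. p) # map (\<lambda>(s, n, p). (s, n, \<lambda>_. p)) qs)))"
    by (rule fock_domain_continuous[OF \<Psi>]) (auto intro!: continuous_intros)
  then have 1: "continuous_on UNIV (\<lambda>p. \<Psi> ((t, \<sigma>, p) # qs))"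
    by (simp only: list.map(2) prod.case map_const_momenta)
  obtain B where "\<And>qs'. length qs' = Suc (length qs) \<Longrightarrow> cmod (\<Psi> qs') \<le> B"
    using fock_domain_bounded[OF \<Psi>] by metis
  then have "cmod (\<Psi> ((t, \<sigma>, p) # qs)) \<le> B * (1 + norm p) ^ 0" for p by simp
  then show ?thesis unfolding tempered_def using 1 by blast
qed

lemma fock_domain_continuous_pair:
  assumes \<Psi>: "\<Psi> \<in> fock_domain st j"
  shows "continuous_on UNIV (\<lambda>(p, x). \<Psi> ((t', \<sigma>', x) # (t, \<sigma>, p) # qs))"
proof -
  have "continuous_on UNIV (\<lambda>z. \<Psi> (map (\<lambda>(s, n, c). (s, n, c z))
      ((t', \<sigma>', snd) # (t, \<sigma>, fst) # map (\<lambda>(s, n, p). (s, n, \<lambda>_. p)) qs)))"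
    by (rule fock_domain_continuous[OF \<Psi>]) (auto intro!: continuous_intros)
  then have "continuous_on UNIV (\<lambda>z. \<Psi> ((t', \<sigma>', snd z) # (t, \<sigma>, fst z) # qs))"
    by (simp only: list.map(2) prod.case map_const_momenta)
  then show ?thesis
    by (simp only: case_prod_unfold)
qed

text \<open>Integrating one momentum of a bounded continuous wave function against \<open>k\<close>
  leaves a bounded function of another momentum, continuous by dominated convergence. Integrals
  against it are what a second annihilator requires.\<close>

lemma annihilate_tempered:
  assumes \<Psi>: "\<Psi> \<in> fock_domain st j" and k: "rapid k"
  shows "tempered (\<lambda>p. annihilate t' \<sigma>' k \<Psi> ((t, \<sigma>, p) # qs))"
proof -
  let ?F = "\<lambda>p x. k x * \<Psi> ((t', \<sigma>', x) # (t, \<sigma>, p) # qs)"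
  obtain B where B: "B \<ge> 0" "\<And>qs'. length qs' = Suc (Suc (length qs)) \<Longrightarrow> cmod (\<Psi> qs') \<le> B"
    using fock_domain_bounded[OF \<Psi>, of "Suc (Suc (length qs))"] by metis
  have le: "cmod (?F p x) \<le> B * cmod (k x)" for p x
    using mult_left_mono[OF B(2)[of "(t', \<sigma>', x) # (t, \<sigma>, p) # qs"], of "cmod (k x)"]
    by (simp add: norm_mult mult.commute)
  have ik: "integrable lborel (\<lambda>x. B * cmod (k x))"
    using rapid_integrable[OF k] by simp
  have meas: "?F p \<in> borel_measurable lborel" for p
  proof -
    have "rapid (?F p)" by (rule rapid_mult_tempered[OF k fock_domain_tempered[OF \<Psi>]])
    then show ?thesis using rapid_measurable by simp
  qed
  have cont: "continuous_on UNIV (\<lambda>p. LINT x|lborel. ?F p x)"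
    unfolding continuous_on_sequentially o_def
  proof (intro allI ballI impI)
    fix X :: "nat \<Rightarrow> real ^ 3" and p
    assume X: "(\<forall>n. X n \<in> UNIV) \<and> X \<longlonglongrightarrow> p"
    show "(\<lambda>n. LINT x|lborel. ?F (X n) x) \<longlonglongrightarrow> (LINT x|lborel. ?F p x)"
    proof (rule integral_dominated_convergence[OF meas meas ik])
      show "AE x in lborel. (\<lambda>n. ?F (X n) x) \<longlonglongrightarrow> ?F p x"
      proof (rule AE_I2)
        fix x
        have "continuous_on UNIV (\<lambda>p. \<Psi> ((t', \<sigma>', x) # (t, \<sigma>, p) # qs))"
          using continuous_on_compose2[OF fock_domain_continuous_pair[OF \<Psi>, of t' \<sigma>' t \<sigma> qs], of UNIV "\<lambda>p. (p, x)"]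
          by (simp add: continuous_on_Pair continuous_on_id continuous_on_const)
        then have "(\<lambda>n. \<Psi> ((t', \<sigma>', x) # (t, \<sigma>, X n) # qs)) \<longlonglongrightarrow> \<Psi> ((t', \<sigma>', x) # (t, \<sigma>, p) # qs)"
          using X unfolding continuous_on_sequentially o_def by blast
        then show "(\<lambda>n. ?F (X n) x) \<longlonglongrightarrow> ?F p x" by (rule tendsto_mult_left)
      qed
      show "AE x in lborel. norm (?F (X n) x) \<le> B * cmod (k x)" for n
        using le by simp
    qed
  qed
  have bd: "cmod (LINT x|lborel. ?F p x) \<le> (LINT x|lborel. B * cmod (k x)) * (1 + norm p) ^ 0" for p
    using B(1) by (simp only: power_0 mult_1_right)
      (rule order_trans[OF integral_norm_bound integral_mono'[OF ik le]], simp)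
  have "tempered (\<lambda>p. LINT x|lborel. ?F p x)"
    unfolding tempered_def using cont bd by blast
  then show ?thesis
    unfolding annihilate_def by (intro tempered_mult tempered_const) simp
qed

lemma create_tempered:
  assumes \<Psi>: "\<Psi> \<in> fock_domain st j" and k: "rapid k"
  shows "tempered (\<lambda>p. create st t' \<sigma>' k \<Psi> ((t, \<sigma>, p) # qs))"
proof -
  have 1: "tempered (\<lambda>p. case ((t, \<sigma>, p) # qs) ! i of (s, n, p') \<Rightarrow> if s = t' \<and> n = \<sigma>' then k p' else 0)" for i
  proof (cases i)
    case 0
    then show ?thesis
      using rapid_imp_tempered[OF k] by (cases "t = t' \<and> \<sigma> = \<sigma>'") (simp_all only: nth_Cons_0 prod.case if_True if_False tempered_const simp_thms)
  qed simp
  have 2: "tempered (\<lambda>p. \<Psi> (take i ((t, \<sigma>, p) # qs) @ drop (Suc i) ((t, \<sigma>, p) # qs)))" for i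
    using fock_domain_tempered[OF \<Psi>] by (cases i) simp_all
  show ?thesis
    unfolding create_def length_Cons divide_inverse
    by (intro tempered_mult tempered_sum tempered_const 1 2)
qed

text \<open>Both sides are the same double momentum integral up to the exchange symmetry of
  \<open>\<Psi>\<close>, which supplies the sign; boundedness of the wave function permits
  Fubini.\<close>

lemma annihilate_annihilate:
  assumes \<Psi>: "\<Psi> \<in> fock_domain st j" and h: "rapid h" and k: "rapid k"
  shows "annihilate t \<sigma> h (annihilate t' \<sigma>' k \<Psi>) qs = exchange_sign st * annihilate t' \<sigma>' k (annihilate t \<sigma> h \<Psi>) qs"
proof -
  obtain B where B: "B \<ge> 0" "\<And>qs'. length qs' = Suc (Suc (length qs)) \<Longrightarrow> cmod (\<Psi> qs') \<le> B"
    using fock_domain_bounded[OF \<Psi>, of "Suc (Suc (length qs))"] by metis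
  have "\<forall>xs q q' ys. \<Psi> (xs @ q # q' # ys) = exchange_sign st * \<Psi> (xs @ q' # q # ys)"
    using \<Psi> unfolding fock_domain_def mem_Collect_eq by (elim conjE)
  then have ex: "\<Psi> (xs @ q # q' # ys) = exchange_sign st * \<Psi> (xs @ q' # q # ys)" for xs q q' ys
    by (elim allE)
  have ch: "continuous_on UNIV (\<lambda>(p :: real ^ 3, x :: real ^ 3). h p)"
    using h unfolding rapid_def case_prod_unfold
    by (auto intro!: continuous_on_compose2[of UNIV h] continuous_intros)
  have "(LINT p|lborel. h p * (LINT x|lborel. k x * \<Psi> ((t', \<sigma>', x) # (t, \<sigma>, p) # qs))) =
      (LINT p|lborel. LINT x|lborel. k x * (h p * \<Psi> ((t', \<sigma>', x) # (t, \<sigma>, p) # qs)))"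
    by (intro Bochner_Integration.integral_cong refl)
      (simp only: integral_mult_right_zero[symmetric] mult.left_commute)
  also have "\<dots> = (LINT x|lborel. k x * (LINT p|lborel. h p * \<Psi> ((t', \<sigma>', x) # (t, \<sigma>, p) # qs)))"
  proof (rule Fubini_dominated)
    show "continuous_on UNIV (\<lambda>(p, x). h p * \<Psi> ((t', \<sigma>', x) # (t, \<sigma>, p) # qs))"
      using continuous_on_mult[OF ch fock_domain_continuous_pair[OF \<Psi>, of t' \<sigma>' t \<sigma> qs]]
      by (simp add: case_prod_unfold)
    show "integrable lborel (\<lambda>p. B * cmod (h p))" using rapid_integrable[OF h] by simp
    show "cmod (h p * \<Psi> ((t', \<sigma>', x) # (t, \<sigma>, p) # qs)) \<le> B * cmod (h p)" for p x
      using mult_left_mono[OF B(2)[of "(t', \<sigma>', x) # (t, \<sigma>, p) # qs"], of "cmod (h p)"]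
      by (simp add: norm_mult mult.commute)
  qed (rule rapid_integrable[OF k])
  also have "\<dots> = (LINT x|lborel. k x * (LINT p|lborel. exchange_sign st * (h p * \<Psi> ((t, \<sigma>, p) # (t', \<sigma>', x) # qs))))"
  proof -
    have "h p * \<Psi> ((t', \<sigma>', x) # (t, \<sigma>, p) # qs) = exchange_sign st * (h p * \<Psi> ((t, \<sigma>, p) # (t', \<sigma>', x) # qs))" for x p
      unfolding ex[of "[]" "(t', \<sigma>', x)", unfolded append_Nil] by (rule mult.left_commute)
    then show ?thesis
      by (rule Bochner_Integration.integral_cong[OF refl arg_cong2[where f = times, OF refl Bochner_Integration.integral_cong[OF refl]]])
  qed
  also have "\<dots> = exchange_sign st * (LINT x|lborel. k x * (LINT p|lborel. h p * \<Psi> ((t, \<sigma>, p) # (t', \<sigma>', x) # qs)))"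
    by (simp only: integral_mult_right_zero mult.left_commute[of _ "exchange_sign st"])
  finally have "(LINT p|lborel. h p * (LINT x|lborel. k x * \<Psi> ((t', \<sigma>', x) # (t, \<sigma>, p) # qs))) =
    exchange_sign st * (LINT x|lborel. k x * (LINT p|lborel. h p * \<Psi> ((t, \<sigma>, p) # (t', \<sigma>', x) # qs)))" .
  moreover have "annihilate a n h' (annihilate b n' k' \<Psi>) qs =
      of_real (sqrt (real (length qs + 1))) * of_real (sqrt (real (Suc (length qs) + 1))) *
      (LINT p|lborel. h' p * (LINT x|lborel. k' x * \<Psi> ((b, n', x) # (a, n, p) # qs)))" for a n h' b n' k'
    unfolding annihilate_def length_Cons mult.left_commute[of "h' _" "complex_of_real (sqrt (real (Suc (length qs) + 1)))"]
    by (simp only: integral_mult_right_zero mult.assoc)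
  ultimately show ?thesis by (simp only: mult.left_commute)
qed

section \<open>Exchange of two creation operators\<close>

text \<open>\<open>create\<close> without its normalisation. The recursion on the head of the list
  makes the exchange relation a plain induction and avoids the bookkeeping of shifted indices in a
  double sum.\<close>

definition insertion_sum :: "complex \<Rightarrow> ('q \<Rightarrow> complex) \<Rightarrow> ('q list \<Rightarrow> complex) \<Rightarrow> 'q list \<Rightarrow> complex" where
  "insertion_sum e H \<Phi> qs = (\<Sum>i<length qs. e ^ i * H (qs ! i) * \<Phi> (take i qs @ drop (Suc i) qs))"

lemma insertion_sum_Nil [simp]: "insertion_sum e H \<Phi> [] = 0"
  by (simp add: insertion_sum_def)

lemma insertion_sum_Cons [simp]:
  "insertion_sum e H \<Phi> (q # qs) = H q * \<Phi> qs + e * insertion_sum e H (\<lambda>ys. \<Phi> (q # ys)) qs"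
  unfolding insertion_sum_def length_Cons sum.lessThan_Suc_shift
  by (simp add: sum_distrib_left mult.assoc)

lemma insertion_sum_linear:
  "insertion_sum e H (\<lambda>ys. a * \<Phi> ys + b * \<Phi>' ys) qs = a * insertion_sum e H \<Phi> qs + b * insertion_sum e H \<Phi>' qs"
  unfolding insertion_sum_def sum_distrib_left sum.distrib[symmetric]
  by (simp add: algebra_simps)

text \<open>Unfolded at the head of the list, the two terms in which exactly one of
  \<open>H\<close>, \<open>K\<close> is evaluated at the head change places at the price of a factor
  \<open>e\<close>, which \<open>e * e = 1\<close> balances. The term in which neither is evaluated
  there is the induction hypothesis.\<close>

lemma insertion_sum_exchange:
  assumes e: "e * e = 1"
  shows "insertion_sum e H (insertion_sum e K \<Psi>) qs = e * insertion_sum e K (insertion_sum e H \<Psi>) qs"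
proof (induction qs arbitrary: \<Psi>)
  case (Cons q qs)
  have ee: "e * (e * x) = x" for x
    using e by (simp flip: mult.assoc)
  show ?case
    by (simp add: insertion_sum_linear insertion_sum_linear[of _ _ _ _ "1", simplified] Cons.IH[of "\<lambda>ys. \<Psi> (q # ys)"] distrib_left ee mult.left_commute add_ac)
qed simp

lemma create_eq_insertion_sum:
  "create st t \<sigma> h \<Psi> qs =
    insertion_sum (exchange_sign st) (\<lambda>(s, n, p). if s = t \<and> n = \<sigma> then h p else 0) \<Psi> qs / of_real (sqrt (real (length qs)))"
  by (simp add: create_def insertion_sum_def)

lemma create_create:
  "create st t \<sigma> h (create st t' \<sigma>' k \<Psi>) qs = exchange_sign st * create st t' \<sigma>' k (create st t \<sigma> h \<Psi>) qs"
proof -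
  \<comment> \<open>After one removal the list has length \<open>length qs - 1\<close>, so both
    orders of the two operators carry the same normalisation.\<close>
  have norm: "insertion_sum e H (\<lambda>ys. \<Phi> ys / of_real (sqrt (real (length ys)))) qs =
      insertion_sum e H \<Phi> qs / of_real (sqrt (real (length qs - 1)))" for e H and \<Phi> :: fock_state
    unfolding insertion_sum_def sum_divide_distrib by (intro sum.cong refl) (auto simp: min_def)
  define H where "H h t \<sigma> = (\<lambda>(s, n, p). if s = t \<and> n = \<sigma> then h p else (0 :: complex))" for h :: "real ^ 3 \<Rightarrow> complex" and t :: species and \<sigma> :: nat
  have "create st t \<sigma> h (create st t' \<sigma>' k \<Psi>) qs =
      insertion_sum (exchange_sign st) (H h t \<sigma>) (insertion_sum (exchange_sign st) (H k t' \<sigma>') \<Psi>) qs /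
        of_real (sqrt (real (length qs - 1))) / of_real (sqrt (real (length qs)))" for t \<sigma> h t' \<sigma>' k
    unfolding create_eq_insertion_sum[of st t \<sigma> h] create_eq_insertion_sum[of st t' \<sigma>' k, abs_def] norm H_def ..
  then show ?thesis
    by (simp only: insertion_sum_exchange[OF exchange_sign_sq, of st "H h t \<sigma>" "H k t' \<sigma>'"] times_divide_eq_right)
qed

section \<open>The bracket of two smeared fields\<close>

lemma annihilate_linear:
  assumes "\<And>\<tau>. integrable lborel (\<lambda>p. h p * F \<tau> ((t, \<sigma>, p) # qs))" "\<And>\<tau>. integrable lborel (\<lambda>p. h p * G \<tau> ((t, \<sigma>, p) # qs))"
  shows "annihilate t \<sigma> h (\<lambda>qs. c * (\<Sum>\<tau>\<in>I. F \<tau> qs + G \<tau> qs)) qs =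
    c * (\<Sum>\<tau>\<in>I. annihilate t \<sigma> h (F \<tau>) qs + annihilate t \<sigma> h (G \<tau>) qs)"
proof -
  have "(LINT p|lborel. h p * (c * (\<Sum>\<tau>\<in>I. F \<tau> ((t, \<sigma>, p) # qs) + G \<tau> ((t, \<sigma>, p) # qs)))) =
      (LINT p|lborel. c * (\<Sum>\<tau>\<in>I. h p * F \<tau> ((t, \<sigma>, p) # qs) + h p * G \<tau> ((t, \<sigma>, p) # qs)))"
    by (intro Bochner_Integration.integral_cong refl) (simp only: sum_distrib_left distrib_left mult.left_commute)
  also have "\<dots> = c * (\<Sum>\<tau>\<in>I. LINT p|lborel. h p * F \<tau> ((t, \<sigma>, p) # qs) + h p * G \<tau> ((t, \<sigma>, p) # qs))"
    unfolding integral_mult_right_zero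
    by (subst Bochner_Integration.integral_sum) (intro Bochner_Integration.integrable_add assms, rule refl)
  also have "\<dots> = c * (\<Sum>\<tau>\<in>I. (LINT p|lborel. h p * F \<tau> ((t, \<sigma>, p) # qs)) + (LINT p|lborel. h p * G \<tau> ((t, \<sigma>, p) # qs)))"
    by (simp only: Bochner_Integration.integral_add[OF assms])
  finally show ?thesis
    unfolding annihilate_def by (simp only: sum_distrib_left distrib_left mult.left_commute)
qed

lemma create_linear:
  "create st t \<sigma> h (\<lambda>qs. c * (\<Sum>\<tau>\<in>I. F \<tau> qs + G \<tau> qs)) qs =
    c * (\<Sum>\<tau>\<in>I. create st t \<sigma> h (F \<tau>) qs + create st t \<sigma> h (G \<tau>) qs)"
proof -
  let ?w = "\<lambda>i. exchange_sign st ^ i * (case qs ! i of (t', \<sigma>', p) \<Rightarrow> if t' = t \<and> \<sigma>' = \<sigma> then h p else 0)"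
  let ?d = "\<lambda>i. take i qs @ drop (Suc i) qs"
  have "(\<Sum>i<length qs. ?w i * (c * (\<Sum>\<tau>\<in>I. F \<tau> (?d i) + G \<tau> (?d i)))) =
      c * (\<Sum>i<length qs. \<Sum>\<tau>\<in>I. ?w i * F \<tau> (?d i) + ?w i * G \<tau> (?d i))"
    by (simp only: sum_distrib_left distrib_left mult.left_commute[of _ c])
  also have "\<dots> = c * (\<Sum>\<tau>\<in>I. (\<Sum>i<length qs. ?w i * F \<tau> (?d i)) + (\<Sum>i<length qs. ?w i * G \<tau> (?d i)))"
    by (subst sum.swap) (simp only: sum.distrib)
  finally show ?thesis
    unfolding create_def by (simp only: times_divide_eq_right[symmetric] sum_divide_distrib add_divide_distrib)
qed

text \<open>Products of two annihilators and of two creators cancel by the exchange relations; only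
  annihilator against creator of the same species survives. In the antiparticle part the creator
  sits in the first field, so its bracket appears in reversed order and acquires the factor
  \<open>- exchange_sign st\<close>.\<close>

lemma bracket_modes:
  assumes \<Psi>: "\<Psi> \<in> fock_domain st j"
    and h: "\<And>\<sigma>. rapid (h \<sigma>)" and k: "\<And>\<sigma>. rapid (k \<sigma>)" and h': "\<And>\<sigma>. rapid (h' \<sigma>)" and k': "\<And>\<sigma>. rapid (k' \<sigma>)"
  shows "bracket st
      (\<lambda>\<Phi> qs. c * (\<Sum>\<sigma>\<le>j. annihilate Particle \<sigma> (h \<sigma>) \<Phi> qs + create st Antiparticle \<sigma> (k \<sigma>) \<Phi> qs))
      (\<lambda>\<Phi> qs. c * (\<Sum>\<sigma>\<le>j. create st Particle \<sigma> (h' \<sigma>) \<Phi> qs + annihilate Antiparticle \<sigma> (k' \<sigma>) \<Phi> qs)) \<Psi> qs =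
    c * c * ((\<Sum>\<sigma>\<le>j. LINT p|lborel. h \<sigma> p * h' \<sigma> p) - exchange_sign st * (\<Sum>\<sigma>\<le>j. LINT p|lborel. k' \<sigma> p * k \<sigma> p)) * \<Psi> qs"
proof -
  let ?e = "exchange_sign st"
  define a1 where "a1 \<sigma> \<Phi> = annihilate Particle \<sigma> (h \<sigma>) \<Phi>" for \<sigma> \<Phi>
  define c1 where "c1 \<sigma> \<Phi> = create st Antiparticle \<sigma> (k \<sigma>) \<Phi>" for \<sigma> \<Phi>
  define c2 where "c2 \<sigma> \<Phi> = create st Particle \<sigma> (h' \<sigma>) \<Phi>" for \<sigma> \<Phi>
  define a2 where "a2 \<sigma> \<Phi> = annihilate Antiparticle \<sigma> (k' \<sigma>) \<Phi>" for \<sigma> \<Phi>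
  have int_a: "integrable lborel (\<lambda>p. g p * annihilate t' \<sigma>' g' \<Psi> ((t, \<sigma>, p) # qs))"
    and int_c: "integrable lborel (\<lambda>p. g p * create st t' \<sigma>' g' \<Psi> ((t, \<sigma>, p) # qs))"
    and int_\<Psi>: "integrable lborel (\<lambda>p. g p * \<Psi> ((t, \<sigma>, p) # qs))" if "rapid g" "rapid g'" for g g' t \<sigma> t' \<sigma>' qs
    using rapid_integrable[OF rapid_mult_tempered[OF that(1) annihilate_tempered[OF \<Psi> that(2)]]]
      rapid_integrable[OF rapid_mult_tempered[OF that(1) create_tempered[OF \<Psi> that(2)]]]
      rapid_integrable[OF rapid_mult_tempered[OF that(1) fock_domain_tempered[OF \<Psi>]]] by blast+
  have XY: "c * (\<Sum>\<sigma>\<le>j. a1 \<sigma> (\<lambda>qs. c * (\<Sum>\<tau>\<le>j. c2 \<tau> \<Psi> qs + a2 \<tau> \<Psi> qs)) qs + c1 \<sigma> (\<lambda>qs. c * (\<Sum>\<tau>\<le>j. c2 \<tau> \<Psi> qs + a2 \<tau> \<Psi> qs)) qs) =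
      c * c * (\<Sum>\<sigma>\<le>j. \<Sum>\<tau>\<le>j. a1 \<sigma> (c2 \<tau> \<Psi>) qs + a1 \<sigma> (a2 \<tau> \<Psi>) qs + (c1 \<sigma> (c2 \<tau> \<Psi>) qs + c1 \<sigma> (a2 \<tau> \<Psi>) qs))"
    unfolding a1_def c1_def a2_def c2_def create_linear annihilate_linear[OF int_c[OF h h'] int_a[OF h k']]
    by (simp only: sum.distrib distrib_left[symmetric] sum_distrib_left[symmetric] mult.assoc)
  have YX: "c * (\<Sum>\<tau>\<le>j. c2 \<tau> (\<lambda>qs. c * (\<Sum>\<sigma>\<le>j. a1 \<sigma> \<Psi> qs + c1 \<sigma> \<Psi> qs)) qs + a2 \<tau> (\<lambda>qs. c * (\<Sum>\<sigma>\<le>j. a1 \<sigma> \<Psi> qs + c1 \<sigma> \<Psi> qs)) qs) =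
      c * c * (\<Sum>\<tau>\<le>j. \<Sum>\<sigma>\<le>j. c2 \<tau> (a1 \<sigma> \<Psi>) qs + c2 \<tau> (c1 \<sigma> \<Psi>) qs + (a2 \<tau> (a1 \<sigma> \<Psi>) qs + a2 \<tau> (c1 \<sigma> \<Psi>) qs))"
    unfolding a1_def c1_def a2_def c2_def create_linear annihilate_linear[OF int_a[OF k' h] int_c[OF k' k]]
    by (simp only: sum.distrib distrib_left[symmetric] sum_distrib_left[symmetric] mult.assoc)
  let ?I = "\<lambda>\<sigma>. (LINT p|lborel. h \<sigma> p * h' \<sigma> p)" and ?J = "\<lambda>\<sigma>. (LINT p|lborel. k' \<sigma> p * k \<sigma> p)"
  have pw: "(a1 \<sigma> (c2 \<tau> \<Psi>) qs + a1 \<sigma> (a2 \<tau> \<Psi>) qs + (c1 \<sigma> (c2 \<tau> \<Psi>) qs + c1 \<sigma> (a2 \<tau> \<Psi>) qs)) -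
      ?e * (c2 \<tau> (a1 \<sigma> \<Psi>) qs + c2 \<tau> (c1 \<sigma> \<Psi>) qs + (a2 \<tau> (a1 \<sigma> \<Psi>) qs + a2 \<tau> (c1 \<sigma> \<Psi>) qs)) =
      (if \<sigma> = \<tau> then (?I \<sigma> - ?e * ?J \<sigma>) * \<Psi> qs else 0)" for \<sigma> \<tau>
  proof -
    have 1: "a1 \<sigma> (c2 \<tau> \<Psi>) qs - ?e * c2 \<tau> (a1 \<sigma> \<Psi>) qs = (if \<sigma> = \<tau> then ?I \<sigma> * \<Psi> qs else 0)"
    proof -
      have "integrable lborel (\<lambda>p. h \<sigma> p * h' \<tau> p)"
        by (rule rapid_integrable[OF rapid_mult_tempered[OF h rapid_imp_tempered[OF h']]])
      from bracket_annihilate_create[OF this int_\<Psi>[OF h h], where st = st and t = Particle and t' = Particle and \<sigma> = \<sigma> and \<sigma>' = \<tau> and qs = qs]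
      show ?thesis unfolding bracket_def a1_def c2_def by auto
    qed
    have 2: "a1 \<sigma> (a2 \<tau> \<Psi>) qs = ?e * a2 \<tau> (a1 \<sigma> \<Psi>) qs"
      unfolding a1_def a2_def by (rule annihilate_annihilate[OF \<Psi> h k'])
    have 3: "c1 \<sigma> (c2 \<tau> \<Psi>) qs = ?e * c2 \<tau> (c1 \<sigma> \<Psi>) qs"
      unfolding c1_def c2_def by (rule create_create)
    have 4: "a2 \<tau> (c1 \<sigma> \<Psi>) qs - ?e * c1 \<sigma> (a2 \<tau> \<Psi>) qs = (if \<sigma> = \<tau> then ?J \<sigma> * \<Psi> qs else 0)"
    proof -
      have "integrable lborel (\<lambda>p. k' \<tau> p * k \<sigma> p)"
        by (rule rapid_integrable[OF rapid_mult_tempered[OF k' rapid_imp_tempered[OF k]]])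
      from bracket_annihilate_create[OF this int_\<Psi>[OF k' k'], where st = st and t = Antiparticle and t' = Antiparticle and \<sigma> = \<tau> and \<sigma>' = \<sigma> and qs = qs]
      show ?thesis unfolding bracket_def a2_def c1_def by auto
    qed
    have 5: "c1 \<sigma> (a2 \<tau> \<Psi>) qs - ?e * a2 \<tau> (c1 \<sigma> \<Psi>) qs = - ?e * (a2 \<tau> (c1 \<sigma> \<Psi>) qs - ?e * c1 \<sigma> (a2 \<tau> \<Psi>) qs)"
      using exchange_sign_sq[of st] by (simp add: right_diff_distrib flip: mult.assoc)
    have "(a1 \<sigma> (c2 \<tau> \<Psi>) qs + a1 \<sigma> (a2 \<tau> \<Psi>) qs + (c1 \<sigma> (c2 \<tau> \<Psi>) qs + c1 \<sigma> (a2 \<tau> \<Psi>) qs)) -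
      ?e * (c2 \<tau> (a1 \<sigma> \<Psi>) qs + c2 \<tau> (c1 \<sigma> \<Psi>) qs + (a2 \<tau> (a1 \<sigma> \<Psi>) qs + a2 \<tau> (c1 \<sigma> \<Psi>) qs)) =
      (a1 \<sigma> (c2 \<tau> \<Psi>) qs - ?e * c2 \<tau> (a1 \<sigma> \<Psi>) qs) + (c1 \<sigma> (a2 \<tau> \<Psi>) qs - ?e * a2 \<tau> (c1 \<sigma> \<Psi>) qs)"
      unfolding 2 3 by (simp add: distrib_left)
    then show ?thesis
      unfolding 1 5 4 by (simp add: left_diff_distrib)
  qed
  have "bracket st
      (\<lambda>\<Phi> qs. c * (\<Sum>\<sigma>\<le>j. annihilate Particle \<sigma> (h \<sigma>) \<Phi> qs + create st Antiparticle \<sigma> (k \<sigma>) \<Phi> qs))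
      (\<lambda>\<Phi> qs. c * (\<Sum>\<sigma>\<le>j. create st Particle \<sigma> (h' \<sigma>) \<Phi> qs + annihilate Antiparticle \<sigma> (k' \<sigma>) \<Phi> qs)) \<Psi> qs =
      c * c * (\<Sum>\<sigma>\<le>j. \<Sum>\<tau>\<le>j. a1 \<sigma> (c2 \<tau> \<Psi>) qs + a1 \<sigma> (a2 \<tau> \<Psi>) qs + (c1 \<sigma> (c2 \<tau> \<Psi>) qs + c1 \<sigma> (a2 \<tau> \<Psi>) qs)) -
      ?e * (c * c * (\<Sum>\<tau>\<le>j. \<Sum>\<sigma>\<le>j. c2 \<tau> (a1 \<sigma> \<Psi>) qs + c2 \<tau> (c1 \<sigma> \<Psi>) qs + (a2 \<tau> (a1 \<sigma> \<Psi>) qs + a2 \<tau> (c1 \<sigma> \<Psi>) qs)))"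
    unfolding bracket_def XY[symmetric] YX[symmetric] unfolding a1_def a2_def c1_def c2_def ..
  also have "\<dots> = c * c * (\<Sum>\<sigma>\<le>j. \<Sum>\<tau>\<le>j. (if \<sigma> = \<tau> then (?I \<sigma> - ?e * ?J \<sigma>) * \<Psi> qs else 0))"
    unfolding pw[symmetric] sum_subtractf sum_distrib_left[symmetric] right_diff_distrib
    by (subst sum.swap[of _ "{..j}" "{..j}"]) (simp only: mult.left_commute[of ?e])
  also have "\<dots> = c * c * (\<Sum>\<sigma>\<le>j. (?I \<sigma> - ?e * ?J \<sigma>) * \<Psi> qs)"
    by (intro arg_cong2[where f = times] sum.cong refl) (simp add: sum.delta)
  also have "\<dots> = c * c * ((\<Sum>\<sigma>\<le>j. ?I \<sigma>) - ?e * (\<Sum>\<sigma>\<le>j. ?J \<sigma>)) * \<Psi> qs"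
    by (simp only: sum_distrib_right[symmetric] sum_subtractf sum_distrib_left mult.assoc)
  finally show ?thesis .
qed

text \<open>Summing over the spin components turns products of modes into the Gram matrix and the
  squared kinematic factor into \<open>m\<close> times the inverse energy. By
  \<open>gram_rest_coefficients\<close> the same Gram matrix then stands in both integrals, which
  makes them comparable.\<close>

lemma bracket_psi:
  assumes m: "m > 0" and uv: "rest_coefficients j u v" and AB: "admissible j A B" and CD: "admissible j C D"
    and f: "test_function f" and g: "test_function g" and \<Psi>: "\<Psi> \<in> fock_domain st j"
  shows "bracket st (psi st m j u v \<kappa> lam A B r f) (psi_dagger st m j u v \<kappa> lam C D t g) \<Psi> qs =
    (of_real ((2 * pi) powr (- 3 / 2)))\<^sup>2 * of_real m *
      (\<kappa> A B * cnj (\<kappa> C D) * (LINT p|lborel. of_real (1 / energy m p) * gram m j u A B C D r t p *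
          (plane_wave_transform m 1 f p * plane_wave_transform m (- 1) g p)) -
       exchange_sign st * (lam A B * cnj (lam C D)) * (LINT p|lborel. of_real (1 / energy m p) * gram m j u A B C D r t p *
          (plane_wave_transform m (- 1) f p * plane_wave_transform m 1 g p))) * \<Psi> qs"
proof -
  have sum_int: "(\<Sum>\<sigma>\<le>j. LINT p|lborel. (F p * a * boosted m w A B p r \<sigma>) * (G p * b * cnj (boosted m w C D p t \<sigma>))) =
      of_real m * (a * b) * (LINT p|lborel. of_real (1 / energy m p) * gram m j w A B C D r t p * (F p * G p))"
    if "rapid F" "rapid G" for F G a b w
  proof -
    have "integrable lborel (\<lambda>p. (F p * a * boosted m w A B p r \<sigma>) * (G p * b * cnj (boosted m w C D p t \<sigma>)))" for \<sigma>
      by (intro rapid_integrable rapid_mult_tempered that tempered_mult tempered_cnj tempered_const tempered_boosted m rapid_imp_tempered)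
    then have "(\<Sum>\<sigma>\<le>j. LINT p|lborel. (F p * a * boosted m w A B p r \<sigma>) * (G p * b * cnj (boosted m w C D p t \<sigma>))) =
        (LINT p|lborel. (\<Sum>\<sigma>\<le>j. (F p * a * boosted m w A B p r \<sigma>) * (G p * b * cnj (boosted m w C D p t \<sigma>))))"
      by (intro Bochner_Integration.integral_sum[symmetric])
    also have "\<dots> = (LINT p|lborel. of_real m * (a * b) * (of_real (1 / energy m p) * gram m j w A B C D r t p * (F p * G p)))"
    proof (intro Bochner_Integration.integral_cong refl)
      fix p
      have "(\<Sum>\<sigma>\<le>j. (F p * a * boosted m w A B p r \<sigma>) * (G p * b * cnj (boosted m w C D p t \<sigma>))) =
          (F p * G p * (a * b)) * (\<Sum>\<sigma>\<le>j. boosted m w A B p r \<sigma> * cnj (boosted m w C D p t \<sigma>))"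
        unfolding sum_distrib_left by (intro sum.cong refl) (simp only: mult_ac)
      also have "\<dots> = of_real m * (a * b) * (of_real (1 / energy m p) * gram m j w A B C D r t p * (F p * G p))"
        unfolding boosted_gram[OF m] by (simp add: mult_ac)
      finally show "(\<Sum>\<sigma>\<le>j. (F p * a * boosted m w A B p r \<sigma>) * (G p * b * cnj (boosted m w C D p t \<sigma>))) =
        of_real m * (a * b) * (of_real (1 / energy m p) * gram m j w A B C D r t p * (F p * G p))" .
    qed
    also have "\<dots> = of_real m * (a * b) * (LINT p|lborel. of_real (1 / energy m p) * gram m j w A B C D r t p * (F p * G p))"
      by (rule integral_mult_right_zero)
    finally show ?thesis .
  qed
  let ?P = "\<lambda>s f. plane_wave_transform m s f"
  have rap: "rapid (?P s f)" "rapid (?P s g)" if "\<bar>s\<bar> = 1" for s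
    using rapid_plane_wave_transform f g that by blast+
  have "bracket st (psi st m j u v \<kappa> lam A B r f) (psi_dagger st m j u v \<kappa> lam C D t g) \<Psi> qs =
    of_real ((2 * pi) powr (- 3 / 2)) * of_real ((2 * pi) powr (- 3 / 2)) *
    ((\<Sum>\<sigma>\<le>j. LINT p|lborel. (?P 1 f p * \<kappa> A B * boosted m u A B p r \<sigma>) * (?P (- 1) g p * cnj (\<kappa> C D) * cnj (boosted m u C D p t \<sigma>))) -
     exchange_sign st * (\<Sum>\<sigma>\<le>j. LINT p|lborel. (?P 1 g p * cnj (lam C D) * cnj (boosted m v C D p t \<sigma>)) * (?P (- 1) f p * lam A B * boosted m v A B p r \<sigma>))) * \<Psi> qs"
    unfolding psi_def[abs_def] psi_dagger_def[abs_def]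
    by (intro bracket_modes[OF \<Psi>] rapid_mult_tempered rap tempered_const tempered_cnj tempered_boosted m; simp)
  also have "(\<Sum>\<sigma>\<le>j. LINT p|lborel. (?P 1 g p * cnj (lam C D) * cnj (boosted m v C D p t \<sigma>)) * (?P (- 1) f p * lam A B * boosted m v A B p r \<sigma>)) =
      (\<Sum>\<sigma>\<le>j. LINT p|lborel. (?P (- 1) f p * lam A B * boosted m v A B p r \<sigma>) * (?P 1 g p * cnj (lam C D) * cnj (boosted m v C D p t \<sigma>)))"
    by (simp only: mult.commute)
  finally show ?thesis
    unfolding sum_int[OF rap(1)[of 1] rap(2)[of "-1"], simplified] sum_int[OF rap(1)[of "-1"] rap(2)[of 1], simplified]
      gram_rest_coefficients[OF uv AB CD]
    by (simp add: power2_eq_square algebra_simps)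
qed

section \<open>Non-vanishing at space-like separation\<close>

lemma quadratic_form_sum_squares:
  fixes P :: "'i \<Rightarrow> complex"
  shows "(\<Sum>i\<in>I. cnj (P i) * (\<Sum>k\<in>I. (\<Sum>l\<in>J. cnj (N l i) * N l k) * P k)) =
    of_real (\<Sum>l\<in>J. (cmod (\<Sum>k\<in>I. N l k * P k))\<^sup>2)"
proof -
  have "(\<Sum>i\<in>I. cnj (P i) * (\<Sum>k\<in>I. (\<Sum>l\<in>J. cnj (N l i) * N l k) * P k)) =
      (\<Sum>i\<in>I. \<Sum>k\<in>I. \<Sum>l\<in>J. cnj (N l i * P i) * (N l k * P k))"
    unfolding sum_distrib_left sum_distrib_right by (intro sum.cong refl) (simp add: mult_ac)
  also have "\<dots> = (\<Sum>i\<in>I. \<Sum>l\<in>J. \<Sum>k\<in>I. cnj (N l i * P i) * (N l k * P k))"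
    by (rule sum.cong[OF refl], rule sum.swap)
  also have "\<dots> = (\<Sum>l\<in>J. \<Sum>i\<in>I. \<Sum>k\<in>I. cnj (N l i * P i) * (N l k * P k))"
    by (rule sum.swap)
  also have "\<dots> = (\<Sum>l\<in>J. cnj (\<Sum>i\<in>I. N l i * P i) * (\<Sum>k\<in>I. N l k * P k))"
    unfolding sum_product cnj_sum ..
  also have "\<dots> = of_real (\<Sum>l\<in>J. (cmod (\<Sum>k\<in>I. N l k * P k))\<^sup>2)"
    unfolding of_real_sum complex_norm_square by (simp only: mult.commute)
  finally show ?thesis .
qed

text \<open>
  Contracted with its value at rest, the Gram matrix is a sum of squares, because the boosts in
  \<open>gram_eq\<close> are squares of Hermitian matrices.
\<close>

lemma gram_contraction:
  assumes m: "m > 0" and uv: "rest_coefficients j u v" and AB: "admissible j A B" and CD: "admissible j C D"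
  obtains \<nu> :: "real ^ 3 \<Rightarrow> real" where "\<And>p. \<nu> p \<ge> 0" "\<nu> 0 > 0"
    "\<And>p. (\<Sum>r\<in>components A B. \<Sum>t\<in>components C D. cnj (rest_gram j u A B C D r t) * gram m j u A B C D r t p) = of_real (\<nu> p)"
proof -
  let ?P = "rest_gram j u A B C D"
  \<comment> \<open>Square roots of the two boosts in \<open>gram_eq\<close>: the half boost at
    \<open>p\<close> on the index of spin \<open>A\<close> and the one at \<open>- p\<close>,
    transposed, on the index of spin \<open>D\<close>.\<close>
  define N where "N p l k = spin_rep A (herm_of (half_boost m p)) (fst l) (fst k) *
      spin_rep D (herm_of (half_boost m (- p))) (snd k) (snd l)" for p and l k :: "nat \<times> nat"
  define \<nu> where "\<nu> p = (\<Sum>b\<le>B. \<Sum>c\<le>C. \<Sum>l\<in>components A D. (cmod (\<Sum>k\<in>components A D. N p l k * ?P (fst k, b) (c, snd k)))\<^sup>2)" for p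
  have herm: "dagger (herm_of (half_boost m p)) = herm_of (half_boost m p)" for p
    using herm_of_eq_cherm[of "fst (half_boost m p)" "snd (half_boost m p)"]
      dagger_cherm_real[of "fst (half_boost m p)" "snd (half_boost m p)"] by simp
  have adj: "cnj (spin_rep n (herm_of (half_boost m p)) x y) = spin_rep n (herm_of (half_boost m p)) y x"
    if "x \<le> n" "y \<le> n" for n p x y
    using spin_rep_dagger[OF that(2,1), of "herm_of (half_boost m p)"] by (simp add: herm)
  have NN: "(\<Sum>l\<in>components A D. cnj (N p l i) * N p l k) =
      spin_rep A (herm_of (p /\<^sub>R m, energy m p / m)) (fst i) (fst k) *
      spin_rep D (herm_of (- p /\<^sub>R m, energy m p / m)) (snd k) (snd i)"
    if "i \<in> components A D" "k \<in> components A D" for p i k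
  proof -
    let ?a = "\<lambda>x. spin_rep A (herm_of (half_boost m p)) (fst i) x * spin_rep A (herm_of (half_boost m p)) x (fst k)"
    let ?d = "\<lambda>x. spin_rep D (herm_of (half_boost m (- p))) (snd k) x * spin_rep D (herm_of (half_boost m (- p))) x (snd i)"
    have "(\<Sum>l\<in>components A D. cnj (N p l i) * N p l k) = (\<Sum>l\<in>components A D. ?a (fst l) * ?d (snd l))"
      using that by (intro sum.cong refl) (simp add: N_def adj mult_ac)
    also have "\<dots> = (\<Sum>x\<le>A. ?a x) * (\<Sum>x\<le>D. ?d x)"
      by (rule sum_components)
    also have "\<dots> = spin_rep A (herm_of (p /\<^sub>R m, energy m p / m)) (fst i) (fst k) *
        spin_rep D (herm_of (- p /\<^sub>R m, energy m (- p) / m)) (snd k) (snd i)"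
      using that by (simp add: spin_rep_mult[symmetric] herm_of_half_boost_square[OF m])
    finally show ?thesis by (simp add: energy_def)
  qed
  have main: "(\<Sum>r\<in>components A B. \<Sum>t\<in>components C D. cnj (?P r t) * gram m j u A B C D r t p) = of_real (\<nu> p)" for p
  proof -
    have g: "gram m j u A B C D (x, b) (c, z) p =
        (\<Sum>k\<in>components A D. (\<Sum>l\<in>components A D. cnj (N p l (x, z)) * N p l k) * ?P (fst k, b) (c, snd k))"
      if "x \<le> A" "b \<le> B" "c \<le> C" "z \<le> D" for x b c z
    proof -
      have "gram m j u A B C D (x, b) (c, z) p =
          (\<Sum>k\<in>components A D. spin_rep A (herm_of (p /\<^sub>R m, energy m p / m)) x (fst k) * ?P (fst k, b) (c, snd k) *
             spin_rep D (herm_of (- p /\<^sub>R m, energy m p / m)) (snd k) z)"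
        using gram_eq[OF m uv AB CD, of "(x, b)" "(c, z)" p] that by (simp add: sum_components_pair)
      also have "\<dots> = (\<Sum>k\<in>components A D. (\<Sum>l\<in>components A D. cnj (N p l (x, z)) * N p l k) * ?P (fst k, b) (c, snd k))"
      proof (intro sum.cong refl)
        fix k assume k: "k \<in> components A D"
        have "(\<Sum>l\<in>components A D. cnj (N p l (x, z)) * N p l k) =
            spin_rep A (herm_of (p /\<^sub>R m, energy m p / m)) x (fst k) * spin_rep D (herm_of (- p /\<^sub>R m, energy m p / m)) (snd k) z"
          using NN[of "(x, z)" k p] that k by simp
        then show "spin_rep A (herm_of (p /\<^sub>R m, energy m p / m)) x (fst k) * ?P (fst k, b) (c, snd k) *
             spin_rep D (herm_of (- p /\<^sub>R m, energy m p / m)) (snd k) z =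
             (\<Sum>l\<in>components A D. cnj (N p l (x, z)) * N p l k) * ?P (fst k, b) (c, snd k)"
          by (simp only: mult_ac)
      qed
      finally show ?thesis .
    qed
    have "(\<Sum>r\<in>components A B. \<Sum>t\<in>components C D. cnj (?P r t) * gram m j u A B C D r t p) =
        (\<Sum>x\<le>A. \<Sum>b\<le>B. \<Sum>c\<le>C. \<Sum>z\<le>D. cnj (?P (x, b) (c, z)) * gram m j u A B C D (x, b) (c, z) p)"
      by (simp only: sum_components_pair)
    also have "\<dots> = (\<Sum>b\<le>B. \<Sum>x\<le>A. \<Sum>c\<le>C. \<Sum>z\<le>D. cnj (?P (x, b) (c, z)) * gram m j u A B C D (x, b) (c, z) p)"
      by (rule sum.swap)
    also have "\<dots> = (\<Sum>b\<le>B. \<Sum>c\<le>C. \<Sum>x\<le>A. \<Sum>z\<le>D. cnj (?P (x, b) (c, z)) * gram m j u A B C D (x, b) (c, z) p)"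
      by (rule sum.cong[OF refl], rule sum.swap)
    also have "\<dots> = (\<Sum>b\<le>B. \<Sum>c\<le>C. \<Sum>i\<in>components A D. cnj (?P (fst i, b) (c, snd i)) * gram m j u A B C D (fst i, b) (c, snd i) p)"
      by (simp only: sum_components_pair fst_conv snd_conv)
    also have "\<dots> = (\<Sum>b\<le>B. \<Sum>c\<le>C. \<Sum>i\<in>components A D. cnj (?P (fst i, b) (c, snd i)) *
        (\<Sum>k\<in>components A D. (\<Sum>l\<in>components A D. cnj (N p l i) * N p l k) * ?P (fst k, b) (c, snd k)))"
    proof (intro sum.cong refl arg_cong2[where f = times])
      fix b c i assume "b \<in> {..B}" "c \<in> {..C}" "i \<in> components A D"
      then show "gram m j u A B C D (fst i, b) (c, snd i) p =
          (\<Sum>k\<in>components A D. (\<Sum>l\<in>components A D. cnj (N p l i) * N p l k) * ?P (fst k, b) (c, snd k))"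
        using g[of "fst i" b c "snd i"] by simp
    qed
    also have "\<dots> = of_real (\<nu> p)"
      unfolding quadratic_form_sum_squares \<nu>_def by simp
    finally show ?thesis .
  qed
  have nonneg: "\<nu> p \<ge> 0" for p unfolding \<nu>_def by (intro sum_nonneg) simp
  \<comment> \<open>At rest the contraction is the sum of the squared moduli of all entries of the
    rest Gram matrix. Were that matrix zero, multiplying it by the second coefficient matrix, whose
    columns are orthonormal, would annihilate the first, against its own normalisation.\<close>
  have "\<nu> 0 \<noteq> 0"
  proof
    assume z: "\<nu> 0 = 0"
    have g0: "gram m j u A B C D r t 0 = ?P r t" if "r \<in> components A B" "t \<in> components C D" for r t
    proof -
      have "herm_of (0, 1) = mat 1"
        by (simp add: herm_of_eq_cherm vec_eq_iff forall_2 mat_def)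
      then have "gram m j u A B C D r t 0 = (\<Sum>a\<le>A. \<Sum>d\<le>D. (if fst r = a then 1 else 0) * ?P (a, snd r) (fst t, d) * (if d = snd t then 1 else 0))"
        using gram_eq[OF m uv AB CD that, of 0] m that by (simp add: energy_def spin_rep_mat_1)
      also have "\<dots> = ?P r t"
        using that by (simp add: if_distrib[where f = "\<lambda>x. _ * x"] if_distrib[where f = "\<lambda>x. x * _"] cong: if_cong)
      finally show ?thesis .
    qed
    have "(\<Sum>r\<in>components A B. \<Sum>t\<in>components C D. cnj (?P r t) * ?P r t) = 0"
      using main[of 0] z by (simp add: g0)
    also have "(\<Sum>r\<in>components A B. \<Sum>t\<in>components C D. cnj (?P r t) * ?P r t) =
        of_real (\<Sum>r\<in>components A B. \<Sum>t\<in>components C D. (cmod (?P r t))\<^sup>2)"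
      unfolding of_real_sum complex_norm_square by (simp only: mult.commute)
    finally have "(\<Sum>r\<in>components A B. \<Sum>t\<in>components C D. (cmod (?P r t))\<^sup>2) = 0"
      by (simp only: of_real_eq_0_iff)
    then have P0: "?P r t = 0" if "r \<in> components A B" "t \<in> components C D" for r t
      using that by (simp add: sum_nonneg_eq_0_iff sum_nonneg del: components_simps(1))
    have orth: "(\<Sum>r\<in>components A' B'. cnj (u A' B' r \<sigma>) * u A' B' r \<tau>) = (if \<sigma> = \<tau> then 1 else 0)"
      if "admissible j A' B'" "\<sigma> \<le> j" "\<tau> \<le> j" for A' B' \<sigma> \<tau>
      using conjunct1[OF uv[unfolded rest_coefficients_def], rule_format, OF that(1)] that(2,3) by blast
    have "u A B r 0 = 0" if r: "r \<in> components A B" for r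
    proof -
      have "0 = (\<Sum>t\<in>components C D. ?P r t * u C D t 0)"
        using P0[OF r] by simp
      also have "\<dots> = (\<Sum>\<sigma>\<le>j. u A B r \<sigma> * (\<Sum>t\<in>components C D. cnj (u C D t \<sigma>) * u C D t 0))"
        unfolding rest_gram_def sum_distrib_left sum_distrib_right
        by (subst sum.swap) (simp only: mult.assoc)
      also have "\<dots> = (\<Sum>\<sigma>\<le>j. u A B r \<sigma> * (if \<sigma> = 0 then 1 else 0))"
        by (intro sum.cong refl) (simp add: orth[OF CD])
      also have "\<dots> = u A B r 0" by (simp add: if_distrib cong: if_cong)
      finally show ?thesis ..
    qed
    then show False using orth[OF AB, of 0 0] by simp
  qed
  then have "\<nu> 0 > 0" using nonneg[of 0] by simp
  with nonneg main show thesis by (intro that)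
qed

lemma integral_continuous_pos:
  fixes F :: "'a::euclidean_space \<Rightarrow> real"
  assumes c: "continuous_on UNIV F" and i: "integrable lborel F" and nn: "\<And>x. F x \<ge> 0" and pos: "F a > 0"
  shows "(LINT x|lborel. F x) > 0"
proof -
  have "isCont F a" using c by (simp add: continuous_on_eq_continuous_at)
  then obtain d where d: "d > 0" "\<And>x. dist x a < d \<Longrightarrow> dist (F x) (F a) < F a / 2"
    using pos unfolding continuous_at_eps_delta by (metis half_gt_zero)
  have ge: "F a / 2 * indicator (ball a d) x \<le> F x" for x
  proof (cases "x \<in> ball a d")
    case True
    then have "\<bar>F x - F a\<bar> < F a / 2" using d(2)[of x] by (simp add: dist_commute dist_real_def abs_minus_commute)
    then have "F a / 2 \<le> F x" by linarith
    then show ?thesis using True by simp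
  qed (use nn in simp)
  have "0 < F a / 2 * measure lborel (ball a d)"
    using pos content_ball_pos[OF d(1), of a] by simp
  also have "\<dots> = (LINT x|lborel. F a / 2 * indicator (ball a d) x)" by simp
  also have "\<dots> \<le> (LINT x|lborel. F x)"
    by (rule integral_mono'[OF i ge nn])
  finally show ?thesis .
qed

text \<open>
  Along a causal line the Fourier transform of a positive energy measure extends to the lower half
  plane, so its vanishing near one point of the line propagates to the whole line. Tilted lines reach
  the time axis from space-like points, and the time axis contains the origin.
\<close>

lemma positive_energy_vanishing:
  assumes m: "m > 0" and \<mu>: "rapid \<mu>"
    and van: "\<And>z. norm (fst z) > \<bar>snd z\<bar> + c \<Longrightarrow> (LINT p|lborel. \<mu> p * exp (\<i> * of_real (mink (on_shell m p) z))) = 0"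
  shows "(LINT p|lborel. \<mu> p) = 0"
proof -
  define H where "H z = (LINT p|lborel. \<mu> p * exp (\<i> * of_real (mink (on_shell m p) z)))" for z
  have line: "H (a + \<tau> *\<^sub>R b, \<tau>) = 0" if b: "norm b \<le> 1" and ab: "\<alpha> < \<beta>"
    and zero: "\<And>\<tau>. \<alpha> < \<tau> \<Longrightarrow> \<tau> < \<beta> \<Longrightarrow> H (a + \<tau> *\<^sub>R b, \<tau>) = 0" for a b \<alpha> \<beta> \<tau>
  proof -
    \<comment> \<open>The frequency along the line, nonnegative because the line is causal; this
      keeps the integrand bounded for complex times in the lower half plane.\<close>
    define w where "w p = energy m p - p \<bullet> b" for p
    have w: "w p \<ge> 0" for p
    proof -
      have "p \<bullet> b \<le> norm p * norm b" by (rule norm_cauchy_schwarz)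
      also have "\<dots> \<le> norm p" using b by (simp add: mult_left_le)
      finally show ?thesis using norm_less_energy[OF m, of p] by (simp add: w_def)
    qed
    define F where "F \<zeta> p = \<mu> p * exp (\<i> * of_real (p \<bullet> a)) * exp (- (\<i> * \<zeta> * of_real (w p)))" for \<zeta> p
    have cw: "continuous_on UNIV w" unfolding w_def by (intro continuous_intros)
    have mF: "F \<zeta> \<in> borel_measurable lborel" for \<zeta>
    proof -
      have "continuous_on UNIV (F \<zeta>)"
        unfolding F_def using \<mu> cw by (intro continuous_intros) (auto simp: rapid_def)
      then show ?thesis using borel_measurable_continuous_onI by auto
    qed
    have le: "cmod (F \<zeta> p) \<le> cmod (\<mu> p)" if "Im \<zeta> \<le> 0" for \<zeta> p
    proof -
      have "Im \<zeta> * w p \<le> 0" using that w[of p] by (simp add: mult_nonpos_nonneg)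
      then show ?thesis unfolding F_def norm_mult by (simp add: mult_left_le)
    qed
    have i\<mu>: "integrable lborel (\<lambda>p. cmod (\<mu> p))" using rapid_integrable[OF \<mu>] by simp
    have HF: "H (a + \<tau> *\<^sub>R b, \<tau>) = (LINT p|lborel. F (of_real \<tau>) p)" for \<tau>
      unfolding H_def
    proof (intro Bochner_Integration.integral_cong refl)
      fix p
      show "\<mu> p * exp (\<i> * of_real (mink (on_shell m p) (a + \<tau> *\<^sub>R b, \<tau>))) = F (of_real \<tau>) p"
        unfolding F_def mult.assoc exp_add[symmetric]
        by (simp add: mink_def on_shell_def w_def inner_add_right algebra_simps)
    qed
    have "(LINT p|lborel. F (of_real \<tau>) p) = 0"
    proof (rule zero_on_lower_half_plane[of "\<lambda>\<zeta>. LINT p|lborel. F \<zeta> p" \<alpha> \<beta>])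
      show "continuous_on {z. Im z \<le> 0} (\<lambda>\<zeta>. LINT p|lborel. F \<zeta> p)"
        unfolding continuous_on_sequentially o_def
      proof (intro allI ballI impI)
        fix X :: "nat \<Rightarrow> complex" and \<zeta>
        assume X: "(\<forall>n. X n \<in> {z. Im z \<le> 0}) \<and> X \<longlonglongrightarrow> \<zeta>"
        show "(\<lambda>n. LINT p|lborel. F (X n) p) \<longlonglongrightarrow> (LINT p|lborel. F \<zeta> p)"
        proof (rule integral_dominated_convergence[OF mF mF i\<mu>])
          show "AE p in lborel. (\<lambda>n. F (X n) p) \<longlonglongrightarrow> F \<zeta> p"
            unfolding F_def using X by (intro AE_I2 tendsto_intros) auto
          show "AE p in lborel. norm (F (X n) p) \<le> cmod (\<mu> p)" for n
            using le X by simp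
        qed
      qed
      show "(\<lambda>\<zeta>. LINT p|lborel. F \<zeta> p) holomorphic_on {z. Im z < 0}"
      proof (rule holomorphic_on_integral)
        show "open {z. Im z < 0}" by (rule open_halfspace_Im_lt)
        show "(\<lambda>\<zeta>. F \<zeta> p) holomorphic_on {z. Im z < 0}" for p
          unfolding F_def by (intro holomorphic_intros)
        show "\<exists>r>0. \<exists>B. integrable lborel B \<and> (\<forall>v\<in>ball \<zeta> r \<inter> {z. Im z < 0}. \<forall>x\<in>space lborel. cmod (F v x) \<le> B x)" for \<zeta>
          using i\<mu> le by (intro exI[of _ 1] conjI exI[of _ "\<lambda>p. cmod (\<mu> p)"]) auto
      qed (rule mF)
      show "(LINT p|lborel. F (of_real x) p) = 0" if "\<alpha> < x" "x < \<beta>" for x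
        using zero[OF that] by (simp add: HF)
    qed (use ab in auto)
    then show ?thesis by (simp add: HF)
  qed
  define C where "C = \<bar>c\<bar>"
  \<comment> \<open>The line starts at distance \<open>s\<close> from the origin at time 0 and moves
    inwards with velocity 1/2, so it meets the time axis at time \<open>2 * s\<close>. Up to time
    \<open>(s - C) / 2\<close> its distance \<open>s - \<tau> / 2\<close> exceeds
    \<open>\<tau> + c\<close>, which is the initial interval of zeros.\<close>
  have axis: "H (0, 2 * s) = 0" if s: "s > C" for s
  proof -
    let ?e = "axis 1 1 :: real ^ 3"
    have "H (s *\<^sub>R ?e + (2 * s) *\<^sub>R (- (1 / 2) *\<^sub>R ?e), 2 * s) = 0"
    proof (rule line[of _ 0 "(s - C) / 2"])
      fix \<tau> :: real assume \<tau>: "0 < \<tau>" "\<tau> < (s - C) / 2"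
      have "s *\<^sub>R ?e + \<tau> *\<^sub>R (- (1 / 2) *\<^sub>R ?e) = (s - \<tau> / 2) *\<^sub>R ?e"
        by (simp add: scaleR_left_diff_distrib)
      then have "norm (s *\<^sub>R ?e + \<tau> *\<^sub>R (- (1 / 2) *\<^sub>R ?e)) = \<bar>s - \<tau> / 2\<bar>" by simp
      also have "\<dots> > \<tau> + c" using \<tau> s by (simp add: C_def)
      finally show "H (s *\<^sub>R ?e + \<tau> *\<^sub>R (- (1 / 2) *\<^sub>R ?e), \<tau>) = 0"
        unfolding H_def using \<tau> by (intro van) simp
    qed (use s in auto)
    then show ?thesis by simp
  qed
  have "H (0 + 0 *\<^sub>R 0, 0) = 0"
  \<comment> \<open>Now the line is the time axis itself; any interval of times beyond
    \<open>2 * C\<close> provides the zeros.\<close>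
  proof (rule line[of 0 "2 * C + 1" "2 * C + 2"])
    fix \<tau> :: real assume "2 * C + 1 < \<tau>" "\<tau> < 2 * C + 2"
    then show "H (0 + \<tau> *\<^sub>R 0, \<tau>) = 0" using axis[of "\<tau> / 2"] by simp
  qed auto
  then show ?thesis by (simp add: H_def mink_def)
qed

lemma supp_subset_cball:
  assumes "\<And>x. norm (x - z) \<ge> \<rho> \<Longrightarrow> f x = 0"
  shows "supp f \<subseteq> cball z \<rho>"
  unfolding supp_def
proof (rule closure_minimal)
  show "{x. f x \<noteq> 0} \<subseteq> cball z \<rho>"
    using assms by (force simp: dist_norm norm_minus_commute)
qed simp

text \<open>If all pairings vanished at space-like separation, so would their contraction with the
  conjugate rest Gram matrix, taken for a bump and its translates. As a function of the translation
  this is the Fourier transform of a nonnegative density that is positive at rest, and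
  \<open>positive_energy_vanishing\<close> would make its total integral 0.\<close>

lemma causal_pairing_nonzero:
  assumes m: "m > 0" and uv: "rest_coefficients j u v" and AB: "admissible j A B" and CD: "admissible j C D"
  obtains r t f g where "r \<in> components A B" "t \<in> components C D" "test_function f" "test_function g"
    "\<And>x y. x \<in> supp f \<Longrightarrow> y \<in> supp g \<Longrightarrow> spacelike (x - y)"
    "(LINT p|lborel. of_real (1 / energy m p) * gram m j u A B C D r t p *
      (plane_wave_transform m 1 f p * plane_wave_transform m (- 1) g p)) \<noteq> 0"
proof (rule ccontr)
  note witness = that
  assume no: "\<not> thesis"
  have zero: "(LINT p|lborel. of_real (1 / energy m p) * gram m j u A B C D r t p *
      (plane_wave_transform m 1 f p * plane_wave_transform m (- 1) g p)) = 0"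
    if "r \<in> components A B" "t \<in> components C D" "test_function f" "test_function g"
      "\<And>x y. x \<in> supp f \<Longrightarrow> y \<in> supp g \<Longrightarrow> spacelike (x - y)" for r t f g
  proof (rule ccontr)
    assume ne: "\<not> ?thesis"
    have thesis by (rule witness[OF that(1,2,3,4) that(5) ne])
    with no show False by (rule notE)
  qed
  \<comment> \<open>Within radius \<open>1 / m\<close> the phase \<open>m * snd x\<close> at rest
    momentum stays below 1 in modulus, hence below \<open>pi / 2\<close>, so the transform of the
    bump at rest has positive real part.\<close>
  define \<rho> where "\<rho> = 1 / m"
  have \<rho>: "\<rho> > 0" using m by (simp add: \<rho>_def)
  obtain h :: "four_vector \<Rightarrow> real" where h: "test_function (\<lambda>x. complex_of_real (h x))" "\<And>x. h x \<ge> 0" "h 0 > 0"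
    "\<And>x. norm x \<ge> \<rho> \<Longrightarrow> h x = 0"
    using bump_exists[OF \<rho>] by metis
  define \<phi> where "\<phi> x = complex_of_real (h x)" for x
  have \<phi>: "test_function \<phi>" using h(1) by (simp add: \<phi>_def[abs_def])
  define k where "k p = plane_wave_transform m 1 \<phi> p" for p
  have rk: "rapid k" unfolding k_def by (rule rapid_plane_wave_transform[OF \<phi>]) simp
  \<comment> \<open>The bump is real, so its two transforms are conjugate and their product is a
    squared modulus.\<close>
  have k_cnj: "plane_wave_transform m (- 1) \<phi> p = cnj (k p)" for p
    unfolding k_def plane_wave_transform_def Bochner_Integration.integral_cnj[symmetric]
    by (intro Bochner_Integration.integral_cong refl) (simp add: \<phi>_def exp_cnj)
  have k0: "k 0 \<noteq> 0"
  proof -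
    let ?F = "\<lambda>x :: four_vector. h x * cos (m * snd x)"
    have hc: "continuous_on UNIV h"
      using continuous_on_Re[OF test_function_continuous[OF \<phi>]] by (simp add: \<phi>_def)
    have i: "integrable lborel (\<lambda>x. \<phi> x * exp (\<i> * of_real (1 * mink (on_shell m 0) x)))"
    proof (rule continuous_compact_support_integrable[of _ "supp \<phi>"])
      show "continuous_on UNIV (\<lambda>x. \<phi> x * exp (\<i> * of_real (1 * mink (on_shell m 0) x)))"
        unfolding mink_def by (intro continuous_intros test_function_continuous \<phi>)
    qed (use \<phi> in \<open>auto simp: test_function_support, simp add: test_function_def\<close>)
    have Re: "Re (\<phi> x * exp (\<i> * of_real (1 * mink (on_shell m 0) x))) = ?F x" for x
      using m by (simp add: \<phi>_def mink_def on_shell_def energy_def Re_exp)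
    have "Re (k 0) = (LINT x|lborel. ?F x)"
      unfolding k_def plane_wave_transform_def by (subst integral_Re[OF i, symmetric]) (simp only: Re)
    also have "\<dots> > 0"
    proof (rule integral_continuous_pos)
      show "continuous_on UNIV ?F" by (intro continuous_intros hc)
      show "integrable lborel ?F" using integrable_Re[OF i] unfolding Re .
      show "?F 0 > 0" using h(3) by simp
      show "?F x \<ge> 0" for x
      proof (cases "norm x \<ge> \<rho>")
        case False
        have "\<bar>snd x\<bar> \<le> norm x" using norm_snd_le[of "snd x" "fst x"] by simp
        then have "m * \<bar>snd x\<bar> \<le> m * norm x" using m by (simp add: mult_left_mono)
        also have "m * norm x < 1" using False m by (simp add: \<rho>_def field_simps)
        finally have "\<bar>m * snd x\<bar> < 1" using m by (simp add: abs_mult)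
        then have "- (pi / 2) < m * snd x" "m * snd x < pi / 2"
          using pi_gt3 unfolding abs_less_iff by linarith+
        then have "cos (m * snd x) > 0"
          by (rule cos_gt_zero_pi)
        then show ?thesis using h(2)[of x] by simp
      qed (simp add: h(4))
    qed
    finally show ?thesis by auto
  qed
  let ?P = "rest_gram j u A B C D"
  let ?G = "\<lambda>r t p. gram m j u A B C D r t p"
  obtain \<nu> :: "real ^ 3 \<Rightarrow> real" where \<nu>: "\<And>p. \<nu> p \<ge> 0" "\<nu> 0 > 0"
    "\<And>p. (\<Sum>r\<in>components A B. \<Sum>t\<in>components C D. cnj (?P r t) * ?G r t p) = of_real (\<nu> p)"
    by (rule gram_contraction[OF m uv AB CD], rule that) (assumption+)
  define \<mu> where "\<mu> p = of_real (1 / energy m p) * of_real (\<nu> p) * (k p * cnj (k p))" for p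
  have "tempered (\<lambda>p. of_real (1 / energy m p) * (\<Sum>r\<in>components A B. \<Sum>t\<in>components C D. cnj (?P r t) * ?G r t p))"
    by (intro tempered_mult tempered_sum tempered_const tempered_inverse_energy m tempered_gram[OF m uv AB CD])
  then have t\<nu>: "tempered (\<lambda>p. of_real (1 / energy m p) * of_real (\<nu> p))" unfolding \<nu>(3) .
  have r\<mu>: "rapid \<mu>"
    unfolding \<mu>_def[abs_def]
    by (intro rapid_mult_tempered'[OF t\<nu>] rapid_mult_tempered[OF rk] tempered_cnj rapid_imp_tempered[OF rk])
  have "(LINT p|lborel. \<mu> p) = 0"
  proof (rule positive_energy_vanishing[OF m r\<mu>])
    fix z :: four_vector
    \<comment> \<open>Both supports have radius \<open>\<rho>\<close>, so a difference of their
      points deviates from \<open>z\<close> by at most \<open>2 * \<rho>\<close> in space and by as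
      much in time; the margin covers the sum.\<close>
    assume z: "norm (fst z) > \<bar>snd z\<bar> + 4 * \<rho>"
    let ?f = "\<lambda>x. \<phi> (x - z)"
    have sf: "supp ?f \<subseteq> cball z \<rho>" and sg: "supp \<phi> \<subseteq> cball 0 \<rho>"
      by (rule supp_subset_cball, simp add: \<phi>_def h(4))+
    have sp: "spacelike (x - y)" if "x \<in> supp ?f" "y \<in> supp \<phi>" for x y
    proof -
      define d where "d = (x - y) - z"
      have "norm (x - z) \<le> \<rho>" "norm y \<le> \<rho>"
        using subsetD[OF sf that(1)] subsetD[OF sg that(2)] by (simp_all add: dist_norm norm_minus_commute)
      then have d: "norm d \<le> 2 * \<rho>"
        using norm_triangle_ineq4[of "x - z" y] by (simp add: d_def algebra_simps)
      have xy: "x - y = z + d" by (simp add: d_def)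
      have "norm (fst d) \<le> 2 * \<rho>" "\<bar>snd d\<bar> \<le> 2 * \<rho>"
        using d norm_fst_le[of "fst d" "snd d"] norm_snd_le[of "snd d" "fst d"] by simp_all
      moreover have "norm (fst z) \<le> norm (fst z + fst d) + norm (fst d)"
        using norm_triangle_ineq4[of "fst z + fst d" "fst d"] by simp
      ultimately have "\<bar>snd (x - y)\<bar> < norm (fst (x - y))"
        using z unfolding xy by simp
      then have "\<bar>snd (x - y)\<bar>\<^sup>2 < (norm (fst (x - y)))\<^sup>2"
        by (intro power_strict_mono) auto
      then show ?thesis
        unfolding spacelike_def mink_def power2_norm_eq_inner by (simp add: power2_eq_square)
    qed
    have tf: "test_function ?f" by (rule test_function_shift[OF \<phi>])
    let ?T = "\<lambda>r t p. of_real (1 / energy m p) * ?G r t p * (plane_wave_transform m 1 ?f p * plane_wave_transform m (- 1) \<phi> p)"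
    have iT: "integrable lborel (?T r t)" if "r \<in> components A B" "t \<in> components C D" for r t
      by (intro rapid_integrable rapid_mult_tempered' rapid_mult_tempered tempered_mult tempered_inverse_energy m tempered_gram[OF m uv AB CD] that
          rapid_plane_wave_transform tf \<phi> rapid_imp_tempered) simp_all
    have "(LINT p|lborel. \<mu> p * exp (\<i> * of_real (mink (on_shell m p) z))) =
        (LINT p|lborel. (\<Sum>r\<in>components A B. \<Sum>t\<in>components C D. cnj (?P r t) * ?T r t p))"
    proof (intro Bochner_Integration.integral_cong refl)
      fix p
      have "plane_wave_transform m 1 ?f p = exp (\<i> * of_real (mink (on_shell m p) z)) * k p"
        using plane_wave_transform_shift[OF \<phi>, of m 1 z p] by (simp add: k_def)
      then have "(\<Sum>r\<in>components A B. \<Sum>t\<in>components C D. cnj (?P r t) * ?T r t p) =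
          (\<Sum>r\<in>components A B. \<Sum>t\<in>components C D. cnj (?P r t) * ?G r t p) *
          (of_real (1 / energy m p) * (exp (\<i> * of_real (mink (on_shell m p) z)) * k p * cnj (k p)))"
        unfolding k_cnj sum_distrib_right by (simp only: mult_ac)
      then show "\<mu> p * exp (\<i> * of_real (mink (on_shell m p) z)) =
          (\<Sum>r\<in>components A B. \<Sum>t\<in>components C D. cnj (?P r t) * ?T r t p)"
        unfolding \<nu>(3) \<mu>_def by (simp only: mult_ac)
    qed
    also have "\<dots> = (\<Sum>r\<in>components A B. \<Sum>t\<in>components C D. cnj (?P r t) * (LINT p|lborel. ?T r t p))"
    proof -
      have "(LINT p|lborel. (\<Sum>r\<in>components A B. \<Sum>t\<in>components C D. cnj (?P r t) * ?T r t p)) =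
          (\<Sum>r\<in>components A B. LINT p|lborel. (\<Sum>t\<in>components C D. cnj (?P r t) * ?T r t p))"
        by (rule Bochner_Integration.integral_sum) (intro Bochner_Integration.integrable_sum integrable_mult_right iT; assumption)
      also have "\<dots> = (\<Sum>r\<in>components A B. \<Sum>t\<in>components C D. LINT p|lborel. cnj (?P r t) * ?T r t p)"
        by (rule sum.cong[OF refl], rule Bochner_Integration.integral_sum) (intro integrable_mult_right iT; assumption)
      finally show ?thesis by (simp only: integral_mult_right_zero)
    qed
    also have "\<dots> = 0"
      by (intro sum.neutral ballI) (simp only: zero[OF _ _ tf \<phi> sp] mult_zero_right)
    finally show "(LINT p|lborel. \<mu> p * exp (\<i> * of_real (mink (on_shell m p) z))) = 0" .
  qed
  moreover have "(LINT p|lborel. \<mu> p) \<noteq> 0"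
  proof -
    define F where "F p = 1 / energy m p * \<nu> p * (cmod (k p))\<^sup>2" for p
    have \<mu>F: "\<mu> p = of_real (F p)" for p
      unfolding \<mu>_def F_def complex_norm_square[symmetric] by simp
    have "(LINT p|lborel. F p) > 0"
    proof (rule integral_continuous_pos)
      have "F = (\<lambda>p. Re (\<mu> p))" by (simp add: \<mu>F)
      then show "continuous_on UNIV F" "integrable lborel F"
        using r\<mu> integrable_Re[OF rapid_integrable[OF r\<mu>]] by (auto simp: rapid_def intro: continuous_on_Re)
      show "F p \<ge> 0" for p using \<nu>(1)[of p] energy_pos[OF m, of p] by (simp add: F_def)
      show "F 0 > 0" using \<nu>(2) energy_pos[OF m, of 0] k0 by (simp add: F_def)
    qed
    then show ?thesis unfolding \<mu>F by simp
  qed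
  ultimately show False by simp
qed

section \<open>From the bracket to the constants\<close>

definition vacuum :: fock_state where
  "vacuum qs = (if qs = [] then 1 else 0)"

lemma vacuum_in_fock_domain: "vacuum \<in> fock_domain st j"
  unfolding fock_domain_def mem_Collect_eq
proof (intro conjI)
  show "\<exists>N. \<forall>qs. length qs > N \<longrightarrow> vacuum qs = 0"
    by (rule exI[of _ 0]) (simp add: vacuum_def)
  show "\<forall>qs. (\<exists>(t, \<sigma>, p)\<in>set qs. \<sigma> > j) \<longrightarrow> vacuum qs = 0"
    by (auto simp: vacuum_def)
  show "\<forall>xs q q' ys. vacuum (xs @ q # q' # ys) = exchange_sign st * vacuum (xs @ q' # q # ys)"
    by (simp add: vacuum_def)
  show "\<forall>ls :: (species \<times> nat) list. continuous_on UNIV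
        (\<lambda>k :: nat \<Rightarrow> real ^ 3. vacuum (map (\<lambda>i. (fst (ls ! i), snd (ls ! i), k i)) [0..<length ls]))"
    by (simp add: vacuum_def)
  show "\<forall>n N :: nat. \<exists>C :: real. \<forall>qs. length qs = n \<longrightarrow>
        (\<Prod>(t, \<sigma>, p)\<leftarrow>qs. (1 + norm p) ^ N) * cmod (vacuum qs) \<le> C"
    by (intro allI exI[of _ 1]) (auto simp: vacuum_def)
qed

text \<open>At space-like separation the bracket is a non-zero constant times the defect of the
  stated identity, times one pairing, times the state. The identity thus suffices; conversely, one
  configuration with non-zero pairing for each pair of types, tested on the vacuum, forces the
  defect to vanish.\<close>

lemma microcausal_iff:
  assumes m: "m > 0" and uv: "rest_coefficients j u v"
  shows "microcausal st m j u v \<kappa> lam \<longleftrightarrow>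
    (\<forall>A B C D. admissible j A B \<longrightarrow> admissible j C D \<longrightarrow>
      \<kappa> A B * cnj (\<kappa> C D) = exchange_sign st * (- 1) ^ (A + D) * (lam A B * cnj (lam C D)))"
proof -
  let ?I = "\<lambda>A B C D r t f g. (LINT p|lborel. of_real (1 / energy m p) * gram m j u A B C D r t p *
      (plane_wave_transform m 1 f p * plane_wave_transform m (- 1) g p))"
  let ?c = "(complex_of_real ((2 * pi) powr (- 3 / 2)))\<^sup>2 * of_real m"
  have br: "bracket st (psi st m j u v \<kappa> lam A B r f) (psi_dagger st m j u v \<kappa> lam C D t g) \<Psi> qs =
      ?c * (\<kappa> A B * cnj (\<kappa> C D) - exchange_sign st * (- 1) ^ (A + D) * (lam A B * cnj (lam C D))) * ?I A B C D r t f g * \<Psi> qs"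
    if AB: "admissible j A B" and CD: "admissible j C D" and r: "r \<in> components A B" and t: "t \<in> components C D"
      and f: "test_function f" and g: "test_function g"
      and sp: "\<And>x y. x \<in> supp f \<Longrightarrow> y \<in> supp g \<Longrightarrow> spacelike (x - y)" and \<Psi>: "\<Psi> \<in> fock_domain st j"
    for A B C D r t f g \<Psi> qs
  proof -
    define \<eta> :: complex where "\<eta> = (- 1) ^ (A + D)"
    define I2 where "I2 = (LINT p|lborel. of_real (1 / energy m p) * gram m j u A B C D r t p *
          (plane_wave_transform m (- 1) f p * plane_wave_transform m 1 g p))"
    have "\<eta> * \<eta> = 1" by (simp add: \<eta>_def flip: power_mult_distrib)
    moreover have "?I A B C D r t f g = \<eta> * I2"
      unfolding \<eta>_def I2_def by (rule spacelike_symmetry[OF m uv AB CD r t f g sp])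
    ultimately have "I2 = \<eta> * ?I A B C D r t f g" by (simp flip: mult.assoc)
    then show ?thesis
      unfolding bracket_psi[OF m uv AB CD f g \<Psi>] I2_def[symmetric] \<eta>_def[symmetric]
      by (simp only: left_diff_distrib right_diff_distrib mult_ac)
  qed
  show ?thesis
  proof
    assume mc: "microcausal st m j u v \<kappa> lam"
    show "\<forall>A B C D. admissible j A B \<longrightarrow> admissible j C D \<longrightarrow>
      \<kappa> A B * cnj (\<kappa> C D) = exchange_sign st * (- 1) ^ (A + D) * (lam A B * cnj (lam C D))"
    proof (intro allI impI)
      fix A B C D assume AB: "admissible j A B" and CD: "admissible j C D"
      obtain r t f g where rt: "r \<in> components A B" "t \<in> components C D" and fg: "test_function f" "test_function g"
        and sp: "\<And>x y. x \<in> supp f \<Longrightarrow> y \<in> supp g \<Longrightarrow> spacelike (x - y)"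
        and nz: "?I A B C D r t f g \<noteq> 0"
        by (rule causal_pairing_nonzero[OF m uv AB CD], rule that) (assumption+)
      have "bracket st (psi st m j u v \<kappa> lam A B r f) (psi_dagger st m j u v \<kappa> lam C D t g) vacuum [] = 0"
        using mc[unfolded microcausal_def, rule_format, OF AB CD rt fg sp vacuum_in_fock_domain] .
      then have "?c * (\<kappa> A B * cnj (\<kappa> C D) - exchange_sign st * (- 1) ^ (A + D) * (lam A B * cnj (lam C D))) *
          ?I A B C D r t f g * vacuum [] = 0"
        by (subst br[symmetric, OF AB CD rt fg _ vacuum_in_fock_domain]) (rule sp)
      then have "?c * (\<kappa> A B * cnj (\<kappa> C D) - exchange_sign st * (- 1) ^ (A + D) * (lam A B * cnj (lam C D))) = 0"
        unfolding vacuum_def if_P[OF refl] mult_1_right mult_eq_0_iff[of _ "?I A B C D r t f g"] by (simp only: nz simp_thms)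
      moreover have "?c \<noteq> 0" using m by simp
      ultimately show "\<kappa> A B * cnj (\<kappa> C D) = exchange_sign st * (- 1) ^ (A + D) * (lam A B * cnj (lam C D))"
        by simp
    qed
  next
    assume eq: "\<forall>A B C D. admissible j A B \<longrightarrow> admissible j C D \<longrightarrow>
      \<kappa> A B * cnj (\<kappa> C D) = exchange_sign st * (- 1) ^ (A + D) * (lam A B * cnj (lam C D))"
    show "microcausal st m j u v \<kappa> lam"
      unfolding microcausal_def
    proof (intro allI impI ballI)
      fix A B C D r t f g \<Psi> qs
      assume AB: "admissible j A B" and CD: "admissible j C D" and rt: "r \<in> components A B" "t \<in> components C D"
        and fg: "test_function f" "test_function g"
        and sp: "\<forall>x\<in>supp f. \<forall>y\<in>supp g. spacelike (x - y)" and \<Psi>: "\<Psi> \<in> fock_domain st j"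
      have sp': "spacelike (x - y)" if "x \<in> supp f" "y \<in> supp g" for x y using sp that by blast
      have "\<kappa> A B * cnj (\<kappa> C D) = exchange_sign st * (- 1) ^ (A + D) * (lam A B * cnj (lam C D))"
        using eq AB CD by blast
      then show "bracket st (psi st m j u v \<kappa> lam A B r f) (psi_dagger st m j u v \<kappa> lam C D t g) \<Psi> qs = 0"
        by (subst br[OF AB CD rt fg _ \<Psi>]) (rule sp', assumption+, simp)
    qed
  qed
qed

text \<open>In doubled labels the integrality condition is a parity. It trades the sign with
  exponent \<open>A + D\<close> for one with exponent \<open>j\<close>, which decides the
  statistics, and signs in \<open>B\<close> and \<open>D\<close>, which go to the constants.\<close>

lemma admissible_even: "admissible j A B \<Longrightarrow> even (A + B + j)"
proof -
  assume "admissible j A B"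
  then obtain k :: int where "real A / 2 + real B / 2 - real j / 2 = of_int k"
    unfolding admissible_def by (auto elim: Ints_cases)
  then have "real_of_int (int A + int B - int j) = real_of_int (2 * k)" by simp
  then have "int A + int B - int j = 2 * k" by (simp only: of_int_eq_iff)
  then show ?thesis by presburger
qed

text \<open>The third assumption excludes fields whose constants all vanish: these are causal with
  either statistics. The constant must be a phase, since the bracket of a field with its own adjoint
  forces equal moduli of the two constants.\<close>

theorem theorem3p2:
  fixes m :: real and j :: nat and st :: statistics
    and u v :: coefficients
    and \<kappa> lam :: "nat \<Rightarrow> nat \<Rightarrow> complex"
  assumes "m > 0"
    and "rest_coefficients j u v"
    and "\<exists>A B. admissible j A B \<and> (\<kappa> A B \<noteq> 0 \<or> lam A B \<noteq> 0)"
  shows "microcausal st m j u v \<kappa> lam \<longleftrightarrow>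
    (even j \<longrightarrow> st = Boson) \<and> (odd j \<longrightarrow> st = Fermion) \<and>
    (\<exists>c :: complex. cmod c = 1 \<and>
       (\<forall>A B. admissible j A B \<longrightarrow> lam A B = (- 1) ^ B * \<kappa> A B * c))"
proof -
  let ?e = "exchange_sign st"
  have sign: "(- 1 :: complex) ^ (A + D) = (- 1) ^ j * (- 1) ^ B * (- 1) ^ D" if "admissible j A B" for A B D
    using admissible_even[OF that] unfolding power_add[symmetric] by (simp add: minus_one_power_iff) presburger
  have stat: "?e * (- 1) ^ j = 1 \<longleftrightarrow> (even j \<longrightarrow> st = Boson) \<and> (odd j \<longrightarrow> st = Fermion)"
    by (cases st) (auto simp: minus_one_power_iff)
  have sq: "(- 1 :: complex) ^ n * (- 1) ^ n = 1" for n by (simp flip: power_mult_distrib)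
  show ?thesis
    unfolding microcausal_iff[OF assms(1,2)] conj_assoc[symmetric] stat[symmetric]
  proof
    assume eq: "\<forall>A B C D. admissible j A B \<longrightarrow> admissible j C D \<longrightarrow>
      \<kappa> A B * cnj (\<kappa> C D) = ?e * (- 1) ^ (A + D) * (lam A B * cnj (lam C D))"
    obtain A0 B0 where A0: "admissible j A0 B0" "\<kappa> A0 B0 \<noteq> 0 \<or> lam A0 B0 \<noteq> 0" using assms(3) by blast
    have "\<kappa> A0 B0 * cnj (\<kappa> A0 B0) = ?e * (- 1) ^ (A0 + B0) * (lam A0 B0 * cnj (lam A0 B0))"
      using eq A0(1) by blast
    then have n0: "of_real ((cmod (\<kappa> A0 B0))\<^sup>2) = ?e * (- 1) ^ j * of_real ((cmod (lam A0 B0))\<^sup>2)"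
      unfolding sign[OF A0(1)] complex_norm_square using sq[of B0] by (simp add: mult.assoc)
    have "?e * (- 1) ^ j = 1 \<or> ?e * (- 1) ^ j = - 1"
      by (cases st) (auto simp: minus_one_power_iff)
    \<comment> \<open>With the sign -1 the diagonal identity would make the sum of the squared
      moduli vanish at a type where one of the constants is non-zero.\<close>
    then have e1: "?e * (- 1) ^ j = 1"
    proof
      assume neg: "?e * (- 1) ^ j = - 1"
      have "complex_of_real ((cmod (\<kappa> A0 B0))\<^sup>2 + (cmod (lam A0 B0))\<^sup>2) = 0"
        using n0 unfolding neg by simp
      then have "(cmod (\<kappa> A0 B0))\<^sup>2 + (cmod (lam A0 B0))\<^sup>2 = 0" by (simp only: of_real_eq_0_iff)
      then show ?thesis using A0(2) by (simp add: sum_power2_eq_zero_iff)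
    qed
    have "complex_of_real ((cmod (\<kappa> A0 B0))\<^sup>2) = of_real ((cmod (lam A0 B0))\<^sup>2)"
      using n0 unfolding e1 by simp
    then have norm0: "cmod (\<kappa> A0 B0) = cmod (lam A0 B0)"
      by (simp only: of_real_eq_iff power2_eq_iff_nonneg[OF norm_ge_zero norm_ge_zero])
    with A0(2) have nz: "\<kappa> A0 B0 \<noteq> 0" "lam A0 B0 \<noteq> 0" by auto
    \<comment> \<open>The ratio of the constants at the reference type; the sign is its own
      inverse.\<close>
    define c where "c = (- 1) ^ B0 * lam A0 B0 / \<kappa> A0 B0"
    have c1: "cmod c = 1"
      using norm0 nz by (simp add: c_def norm_divide norm_mult norm_power)
    have "lam A B = (- 1) ^ B * \<kappa> A B * c" if AB: "admissible j A B" for A B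
    proof -
      \<comment> \<open>Comparison with the reference type alone already determines
        \<open>lam A B\<close>.\<close>
      have "\<kappa> A B * cnj (\<kappa> A0 B0) = ?e * (- 1) ^ (A + B0) * (lam A B * cnj (lam A0 B0))"
        using eq AB A0(1) by blast
      also have "?e * (- 1) ^ (A + B0) = (- 1) ^ B * (- 1) ^ B0"
        using e1 unfolding sign[OF AB] by (simp flip: mult.assoc)
      finally have k: "\<kappa> A B * cnj (\<kappa> A0 B0) = (- 1) ^ B * (- 1) ^ B0 * (lam A B * cnj (lam A0 B0))" .
      have "cnj c * c = 1"
        using c1 complex_norm_square[of c] by (simp add: mult.commute)
      moreover have "cnj c * cnj (\<kappa> A0 B0) = (- 1) ^ B0 * cnj (lam A0 B0)"
        using nz by (simp add: c_def)
      ultimately have "cnj (\<kappa> A0 B0) = (- 1) ^ B0 * cnj (lam A0 B0) * c"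
        by (metis mult.assoc mult.commute mult.right_neutral)
      then have "(- 1) ^ B0 * cnj (lam A0 B0) * (\<kappa> A B * c) = (- 1) ^ B0 * cnj (lam A0 B0) * ((- 1) ^ B * lam A B)"
        using k by (simp only: mult_ac)
      then have "\<kappa> A B * c = (- 1) ^ B * lam A B"
        using nz by simp
      then have "(- 1) ^ B * (\<kappa> A B * c) = ((- 1) ^ B * (- 1) ^ B) * lam A B" by (simp only: mult.assoc)
      then show ?thesis unfolding sq by (simp add: mult.assoc)
    qed
    with e1 c1 show "?e * (- 1) ^ j = 1 \<and> (\<exists>c. cmod c = 1 \<and> (\<forall>A B. admissible j A B \<longrightarrow> lam A B = (- 1) ^ B * \<kappa> A B * c))"
      by blast
  next
    assume "?e * (- 1) ^ j = 1 \<and> (\<exists>c. cmod c = 1 \<and> (\<forall>A B. admissible j A B \<longrightarrow> lam A B = (- 1) ^ B * \<kappa> A B * c))"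
    then obtain c where e1: "?e * (- 1) ^ j = 1" and c1: "cmod c = 1"
      and lam: "\<And>A B. admissible j A B \<Longrightarrow> lam A B = (- 1) ^ B * \<kappa> A B * c" by blast
    have cc: "c * cnj c = 1" using c1 complex_norm_square[of c] by simp
    show "\<forall>A B C D. admissible j A B \<longrightarrow> admissible j C D \<longrightarrow>
      \<kappa> A B * cnj (\<kappa> C D) = ?e * (- 1) ^ (A + D) * (lam A B * cnj (lam C D))"
    proof (intro allI impI)
      fix A B C D assume AB: "admissible j A B" and CD: "admissible j C D"
      have "?e * (- 1) ^ (A + D) * (lam A B * cnj (lam C D)) =
          (?e * (- 1) ^ j) * ((- 1) ^ B * (- 1) ^ B) * ((- 1) ^ D * (- 1) ^ D) * (c * cnj c) * (\<kappa> A B * cnj (\<kappa> C D))"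
        unfolding sign[OF AB] lam[OF AB] lam[OF CD] by (simp add: mult_ac)
      then show "\<kappa> A B * cnj (\<kappa> C D) = ?e * (- 1) ^ (A + D) * (lam A B * cnj (lam C D))"
        unfolding e1 sq cc by simp
    qed
  qed
qed

end
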